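(* Let $d\ge1$, $\Omega=[0,1]^d$, $f\in L^2(\Omega)$, and let $V$ be a twice weakly differentiable function with $V,\nabla V,\Delta V\in L^\infty(\Omega)$ satisfying, for a.e. $x\in\Omega$, $0<C_{\min}< V(x)\le V_{\max}$, $0<C_{\min}<V(x)^2-\Delta V(x)$ and $-\Delta V(x)\le V_{\max}$. Let $u^\ast\in H^1_0(\Omega)\cap H^2(\Omega)$ be the solution of $-\Delta u+Vu=f$ in $\Omega$, $u=0$ on $\partial\Omega$, which is the minimizer over $H_0^1(\Omega)\cap H^2(\Omega)$ of $$\mathcal E^{\mathrm{PINN}}(u):=\int_\Omega|\Delta u-Vu+f|^2\,dx .$$ Then for every $u\in H^1_0(\Omega)\cap H^2(\Omega)$, $$\min\{1,C_{\min}\}\,\|u-u^\ast\|_{H^2(\Omega)}^2\le \mathcal E^{\mathrm{PINN}}(u)-\mathcal E^{\mathrm{PINN}}(u^\ast)\le 2\big(1+V_{\max}+V_{\max}^2\big)\|u-u^\ast\|_{H^2(\Omega)}^2 .$$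
   Context: $\|v\|_{H^2(\Omega)}^2=\sum_{|\alpha|\le 2}\|D^\alpha v\|_{L^2(\Omega)}^2$. $H^1_0(\Omega)$ is the closure of $C^1_c(\Omega)$ in $H^1(\Omega)$. *)

theory Defs
  imports "HOL-Analysis.Analysis"
begin

definition unit_cube :: "(real^'n) set" where
  "unit_cube = cbox 0 (\<chi> i. 1)"

definition cpartial :: "(real^'n \<Rightarrow> real) \<Rightarrow> 'n \<Rightarrow> real^'n \<Rightarrow> real" where
  "cpartial \<phi> i = (\<lambda>x. frechet_derivative \<phi> (at x) (axis i 1))"

text \<open>Classical iterated derivative D^alpha of order k = |alpha| (for smooth
  functions the order of differentiation is irrelevant).\<close>
primrec cDk :: "nat \<Rightarrow> ('n \<Rightarrow> nat) \<Rightarrow> (real^'n \<Rightarrow> real) \<Rightarrow> real^'n \<Rightarrow> real" where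
  "cDk 0 \<alpha> \<phi> = \<phi>"
| "cDk (Suc k) \<alpha> \<phi> =
     (let i = (SOME i. 0 < \<alpha> i) in cpartial (cDk k (\<alpha>(i := \<alpha> i - 1)) \<phi>) i)"

definition mi_order :: "('n::finite \<Rightarrow> nat) \<Rightarrow> nat" where
  "mi_order \<alpha> = (\<Sum>i\<in>UNIV. \<alpha> i)"

definition cD :: "('n::finite \<Rightarrow> nat) \<Rightarrow> (real^'n \<Rightarrow> real) \<Rightarrow> real^'n \<Rightarrow> real" where
  "cD \<alpha> \<phi> = cDk (mi_order \<alpha>) \<alpha> \<phi>"

definition tsupp :: "(real^'n \<Rightarrow> real) \<Rightarrow> (real^'n) set" where
  "tsupp \<phi> = closure {x. \<phi> x \<noteq> 0}"

definition test_fun :: "(real^'n::finite) set \<Rightarrow> (real^'n \<Rightarrow> real) \<Rightarrow> bool" where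
  "test_fun \<Omega> \<phi> \<longleftrightarrow>
     (\<forall>\<alpha>. (\<forall>x. cD \<alpha> \<phi> differentiable (at x)) \<and> continuous_on UNIV (cD \<alpha> \<phi>))
     \<and> compact (tsupp \<phi>) \<and> tsupp \<phi> \<subseteq> interior \<Omega>"

definition C1c :: "(real^'n::finite) set \<Rightarrow> (real^'n \<Rightarrow> real) \<Rightarrow> bool" where
  "C1c \<Omega> \<phi> \<longleftrightarrow>
     (\<forall>x. \<phi> differentiable (at x)) \<and> (\<forall>i. continuous_on UNIV (cpartial \<phi> i))
     \<and> compact (tsupp \<phi>) \<and> tsupp \<phi> \<subseteq> interior \<Omega>"

definition loc_int :: "(real^'n::finite) set \<Rightarrow> (real^'n \<Rightarrow> real) \<Rightarrow> bool" where
  "loc_int \<Omega> u \<longleftrightarrow> u \<in> borel_measurable (lebesgue_on \<Omega>) \<and>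
     (\<forall>K. compact K \<and> K \<subseteq> interior \<Omega> \<longrightarrow> integrable (lebesgue_on K) u)"

definition L2 :: "(real^'n::finite) set \<Rightarrow> (real^'n \<Rightarrow> real) \<Rightarrow> bool" where
  "L2 \<Omega> u \<longleftrightarrow> u \<in> borel_measurable (lebesgue_on \<Omega>) \<and>
     integrable (lebesgue_on \<Omega>) (\<lambda>x. (u x)\<^sup>2)"

definition Linf :: "(real^'n::finite) set \<Rightarrow> (real^'n \<Rightarrow> real) \<Rightarrow> bool" where
  "Linf \<Omega> u \<longleftrightarrow> u \<in> borel_measurable (lebesgue_on \<Omega>) \<and>
     (\<exists>C. AE x in lebesgue_on \<Omega>. \<bar>u x\<bar> \<le> C)"

definition weak_deriv :: "(real^'n::finite) set \<Rightarrow> ('n \<Rightarrow> nat) \<Rightarrow> (real^'n \<Rightarrow> real)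
    \<Rightarrow> (real^'n \<Rightarrow> real) \<Rightarrow> bool" where
  "weak_deriv \<Omega> \<alpha> u v \<longleftrightarrow> loc_int \<Omega> u \<and> loc_int \<Omega> v \<and>
     (\<forall>\<phi>. test_fun \<Omega> \<phi> \<longrightarrow>
        (\<integral>x. u x * cD \<alpha> \<phi> x \<partial>lebesgue_on \<Omega>)
          = (-1) ^ mi_order \<alpha> * (\<integral>x. v x * \<phi> x \<partial>lebesgue_on \<Omega>))"

definition wD :: "(real^'n::finite) set \<Rightarrow> ('n \<Rightarrow> nat) \<Rightarrow> (real^'n \<Rightarrow> real) \<Rightarrow> real^'n \<Rightarrow> real" where
  "wD \<Omega> \<alpha> u = (SOME v. weak_deriv \<Omega> \<alpha> u v)"

definition Hk :: "nat \<Rightarrow> (real^'n::finite) set \<Rightarrow> (real^'n \<Rightarrow> real) \<Rightarrow> bool" where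
  "Hk k \<Omega> u \<longleftrightarrow> L2 \<Omega> u \<and>
     (\<forall>\<alpha>. mi_order \<alpha> \<le> k \<longrightarrow> (\<exists>v. weak_deriv \<Omega> \<alpha> u v \<and> L2 \<Omega> v))"

definition Hk_norm_sq :: "nat \<Rightarrow> (real^'n::finite) set \<Rightarrow> (real^'n \<Rightarrow> real) \<Rightarrow> real" where
  "Hk_norm_sq k \<Omega> u =
     (\<Sum>\<alpha>\<in>{\<alpha>. mi_order \<alpha> \<le> k}. \<integral>x. (wD \<Omega> \<alpha> u x)\<^sup>2 \<partial>lebesgue_on \<Omega>)"

definition H10 :: "(real^'n::finite) set \<Rightarrow> (real^'n \<Rightarrow> real) \<Rightarrow> bool" where
  "H10 \<Omega> u \<longleftrightarrow> Hk 1 \<Omega> u \<and>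
     (\<exists>\<psi> :: nat \<Rightarrow> real^'n \<Rightarrow> real. (\<forall>m. C1c \<Omega> (\<psi> m)) \<and>
        (\<lambda>m. Hk_norm_sq 1 \<Omega> (\<lambda>x. \<psi> m x - u x)) \<longlonglongrightarrow> 0)"

definition wlap :: "(real^'n::finite) set \<Rightarrow> (real^'n \<Rightarrow> real) \<Rightarrow> real^'n \<Rightarrow> real" where
  "wlap \<Omega> u = (\<lambda>x. \<Sum>i\<in>UNIV. wD \<Omega> (\<lambda>k. if k = i then 2 else 0) u x)"

definition E_PINN :: "(real^'n::finite) set \<Rightarrow> (real^'n \<Rightarrow> real) \<Rightarrow> (real^'n \<Rightarrow> real)
    \<Rightarrow> (real^'n \<Rightarrow> real) \<Rightarrow> real" where
  "E_PINN \<Omega> V f u = (\<integral>x. (wlap \<Omega> u x - V x * u x + f x)\<^sup>2 \<partial>lebesgue_on \<Omega>)"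

end

theory Submission
  imports Defs
begin

text \<open>
  Put \<open>w = u - ustar\<close>. Since the residual of \<open>ustar\<close> vanishes, the energy gap is the integral of
  \<open>(lap w - V w)^2\<close>, and formally two integrations by parts turn it into
  \<open>sum_ij |D_ij w|^2 + 2 V |grad w|^2 + (V^2 - lap V) w^2\<close>, from which both bounds are read
  off (each mixed derivative is counted once in the norm and twice in the double sum).

  To justify this on the cube, \<open>w\<close> is approximated by the partial sums of its sine series, for
  which the integrations by parts produce no boundary terms. Because \<open>w\<close> has zero trace, the sine
  coefficients of \<open>D_ii w\<close> are \<open>-(k_i pi)^2\<close> times those of \<open>w\<close>, so the pure second derivatives
  of the partial sums converge in \<open>L2\<close>. The remaining ones are Cauchy, since \<open>|D_ij s|^2\<close> and
  \<open>D_ii s * D_jj s\<close> have the same integral for a sine polynomial \<open>s\<close>, and \<open>L2\<close> limits of weak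
  derivatives are weak derivatives. The Laplacian of \<open>V\<close> is only needed against \<open>s^2\<close>, which
  vanishes on the boundary together with its gradient, although it need not have compact support.
  Multiplying by smooth cutoffs shows that this suffices: each derivative moved costs one order of
  vanishing.
\<close>

section \<open>Smooth functions\<close>

lemma cpartial_eqI:
  fixes f :: "real^'n::finite \<Rightarrow> real"
  shows "(f has_derivative f') (at x) \<Longrightarrow> cpartial f i x = f' (axis i 1)"
  by (metis cpartial_def frechet_derivative_at)

lemma cpartial_add:
  fixes f g :: "real^'n::finite \<Rightarrow> real"
  assumes "\<And>x. f differentiable (at x)" "\<And>x. g differentiable (at x)"
  shows "cpartial (\<lambda>x. f x + g x) i = (\<lambda>x. cpartial f i x + cpartial g i x)"
  using has_derivative_add[OF assms[unfolded frechet_derivative_works], THEN cpartial_eqI]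
  by (simp add: cpartial_def fun_eq_iff)

lemma cpartial_mult:
  fixes f g :: "real^'n::finite \<Rightarrow> real"
  assumes "\<And>x. f differentiable (at x)" "\<And>x. g differentiable (at x)"
  shows "cpartial (\<lambda>x. f x * g x) i = (\<lambda>x. cpartial f i x * g x + f x * cpartial g i x)"
  using has_derivative_mult[OF assms[unfolded frechet_derivative_works], THEN cpartial_eqI]
  by (simp add: cpartial_def fun_eq_iff)

lemma has_derivative_real_compose:
  fixes f :: "real^'n::finite \<Rightarrow> real"
  assumes "f differentiable (at x)" "(h has_real_derivative h') (at (f x))"
  shows "((\<lambda>x. h (f x)) has_derivative (\<lambda>y. h' * frechet_derivative f (at x) y)) (at x)"
  using has_derivative_compose
    [OF assms[unfolded frechet_derivative_works has_field_derivative_def]] .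

lemma cpartial_compose:
  fixes f :: "real^'n::finite \<Rightarrow> real"
  assumes "f differentiable (at x)" "(h has_real_derivative h') (at (f x))"
  shows "cpartial (\<lambda>x. h (f x)) i x = h' * cpartial f i x"
  using cpartial_eqI[OF has_derivative_real_compose[OF assms]] by (simp add: cpartial_def)

lemma cpartial_const: "cpartial (\<lambda>x. c) i = (\<lambda>x. 0)"
  using cpartial_eqI[OF has_derivative_const] by blast

lemma cpartial_cmult:
  fixes f :: "real^'n::finite \<Rightarrow> real"
  assumes "\<And>x. f differentiable (at x)"
  shows "cpartial (\<lambda>x. c * f x) i = (\<lambda>x. c * cpartial f i x)"
  using cpartial_mult[OF differentiable_const assms] by (simp add: cpartial_const)

lemma cpartial_bounded_linear:
  fixes f :: "real^'n::finite \<Rightarrow> real"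
  shows "bounded_linear f \<Longrightarrow> cpartial f i = (\<lambda>x. f (axis i 1))"
  by (intro ext cpartial_eqI bounded_linear_imp_has_derivative)

lemma has_real_derivative_along_axis:
  fixes F :: "real^'n::finite \<Rightarrow> real"
  assumes "F differentiable (at (x + s *\<^sub>R axis i 1))"
  shows "((\<lambda>s. F (x + s *\<^sub>R axis i 1))
    has_real_derivative cpartial F i (x + s *\<^sub>R axis i 1)) (at s)"
proof -
  let ?D = "frechet_derivative F (at (x + s *\<^sub>R axis i 1))"
  have F: "(F has_derivative ?D) (at (x + s *\<^sub>R axis i 1))"
    using assms frechet_derivative_works by blast
  have "((\<lambda>s. x + s *\<^sub>R axis i 1) has_derivative (\<lambda>h. h *\<^sub>R axis i (1::real))) (at s)"
    by (auto intro!: derivative_eq_intros)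
  from has_derivative_compose[OF this F]
  have "((\<lambda>s. F (x + s *\<^sub>R axis i 1)) has_derivative (\<lambda>h. ?D (h *\<^sub>R axis i 1))) (at s)" .
  moreover have "(\<lambda>h. ?D (h *\<^sub>R axis i 1)) = (*) (cpartial F i (x + s *\<^sub>R axis i 1))"
    using has_derivative_bounded_linear[OF F, THEN bounded_linear.linear]
    by (auto simp: cpartial_def linear_cmul)
  ultimately show ?thesis by (simp add: has_field_derivative_def)
qed

lemma differentiable_imp_continuous_on:
  fixes F :: "real^'n::finite \<Rightarrow> real"
  shows "(\<And>x. F differentiable (at x)) \<Longrightarrow> continuous_on A F"
  by (metis continuous_at_imp_continuous_on differentiable_imp_continuous_within)

primrec ntimes_differentiable :: "nat \<Rightarrow> (real^'n::finite \<Rightarrow> real) \<Rightarrow> bool" where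
  "ntimes_differentiable 0 f \<longleftrightarrow> True"
| "ntimes_differentiable (Suc n) f \<longleftrightarrow>
     (\<forall>x. f differentiable (at x)) \<and> (\<forall>i. ntimes_differentiable n (cpartial f i))"

definition smooth :: "(real^'n::finite \<Rightarrow> real) \<Rightarrow> bool" where
  "smooth f \<longleftrightarrow> (\<forall>n. ntimes_differentiable n f)"

lemma ntimes_differentiable_SucD: "ntimes_differentiable (Suc n) f \<Longrightarrow> ntimes_differentiable n f"
proof (induction n arbitrary: f)
  case (Suc n)
  then have "\<forall>x. f differentiable (at x)" "\<forall>i. ntimes_differentiable (Suc n) (cpartial f i)"
    by (auto simp del: ntimes_differentiable.simps simp: ntimes_differentiable.simps(2)[of "Suc n"])
  then show ?case
    using Suc.IH unfolding ntimes_differentiable.simps(2)[of n f] by blast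
qed simp

lemma ntimes_differentiable_add:
  "ntimes_differentiable n f \<Longrightarrow> ntimes_differentiable n g \<Longrightarrow> ntimes_differentiable n (\<lambda>x. f x + g x)"
  by (induction n arbitrary: f g) (auto simp: cpartial_add)

lemma ntimes_differentiable_mult:
  "ntimes_differentiable n f \<Longrightarrow> ntimes_differentiable n g \<Longrightarrow> ntimes_differentiable n (\<lambda>x. f x * g x)"
proof (induction n arbitrary: f g)
  case (Suc n)
  then have "ntimes_differentiable n f" "ntimes_differentiable n g"
    by (auto intro: ntimes_differentiable_SucD simp del: ntimes_differentiable.simps)
  then show ?case
    using Suc by (auto simp: cpartial_mult intro!: ntimes_differentiable_add Suc.IH)
qed simp

lemma ntimes_differentiable_const: "ntimes_differentiable n (\<lambda>x::real^'n::finite. c)"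
  by (induction n arbitrary: c) (simp_all add: cpartial_const)

lemma ntimes_differentiable_bounded_linear:
  "bounded_linear f \<Longrightarrow> ntimes_differentiable n f"
  by (cases n) (simp_all add: bounded_linear_imp_differentiable cpartial_bounded_linear
      ntimes_differentiable_const)

lemma ntimes_differentiable_compose_family:
  fixes f :: "real^'n::finite \<Rightarrow> real" and h :: "'a \<Rightarrow> real \<Rightarrow> real"
  assumes h: "\<And>a t. (h a has_real_derivative c a * h (p a) t + d a * h (q a) t) (at t)"
    and f: "ntimes_differentiable n f"
  shows "ntimes_differentiable n (\<lambda>x. h a (f x))"
  using f
proof (induction n arbitrary: a)
  case (Suc n)
  then have f: "f differentiable (at x)" "ntimes_differentiable n f" for x
    by (auto intro: ntimes_differentiable_SucD simp del: ntimes_differentiable.simps(2)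
        simp: ntimes_differentiable.simps(2)[of n f])
  have "(\<lambda>x. h a (f x)) differentiable (at x)" for x
    using has_derivative_real_compose[OF f(1) h] by (auto simp: differentiable_def)
  moreover have "cpartial (\<lambda>x. h a (f x)) i =
      (\<lambda>x. (c a * h (p a) (f x) + d a * h (q a) (f x)) * cpartial f i x)" for i
    using cpartial_compose[OF f(1) h] by blast
  ultimately show ?case
    using Suc f by (auto intro!: ntimes_differentiable_mult ntimes_differentiable_add
        ntimes_differentiable_const)
qed simp

lemma smooth_compose_family:
  assumes "\<And>a t. (h a has_real_derivative c a * h (p a) t + d a * h (q a) t) (at t)" "smooth f"
  shows "smooth (\<lambda>x. h a (f x))"
  using assms ntimes_differentiable_compose_family[of h c p d q] unfolding smooth_def by blast

lemma smooth_const: "smooth (\<lambda>x. c)"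
  by (simp add: smooth_def ntimes_differentiable_const)

lemma smooth_add: "smooth f \<Longrightarrow> smooth g \<Longrightarrow> smooth (\<lambda>x. f x + g x)"
  by (simp add: smooth_def ntimes_differentiable_add)

lemma smooth_mult: "smooth f \<Longrightarrow> smooth g \<Longrightarrow> smooth (\<lambda>x. f x * g x)"
  by (simp add: smooth_def ntimes_differentiable_mult)

lemma smooth_diff: "smooth f \<Longrightarrow> smooth g \<Longrightarrow> smooth (\<lambda>x. f x - g x)"
  using smooth_add[of f, OF _ smooth_mult[OF smooth_const[of "-1"]]] by simp

lemma smooth_sum: "(\<And>i. i \<in> I \<Longrightarrow> smooth (f i)) \<Longrightarrow> smooth (\<lambda>x. \<Sum>i\<in>I. f i x)"
  by (induction I rule: infinite_finite_induct) (auto intro: smooth_const smooth_add)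

lemma smooth_prod: "(\<And>i. i \<in> I \<Longrightarrow> smooth (f i)) \<Longrightarrow> smooth (\<lambda>x. \<Prod>i\<in>I. f i x)"
  by (induction I rule: infinite_finite_induct) (auto intro: smooth_const smooth_mult)

lemma smooth_coordinate: "smooth (\<lambda>x. x $ i)"
  by (simp add: smooth_def ntimes_differentiable_bounded_linear bounded_linear_vec_nth)

lemma smooth_sin:
  assumes "smooth f" shows "smooth (\<lambda>x. sin (f x + b))"
proof -
  have "((\<lambda>t. sin (t + b)) has_real_derivative 1 * sin (t + (b + pi / 2)) + 0 * sin (t + b)) (at t)"
    for b t :: real
    using sin_add[of "t + b" "pi / 2"] by (auto intro!: derivative_eq_intros simp: add.assoc)
  from smooth_compose_family[of "\<lambda>b t. sin (t + b)" "\<lambda>_. 1" "\<lambda>b. b + pi / 2" "\<lambda>_. 0" "\<lambda>b. b",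
      OF this assms] show ?thesis .
qed

lemma smooth_cpartial: "smooth f \<Longrightarrow> smooth (cpartial f i)"
  unfolding smooth_def by (metis ntimes_differentiable.simps(2))

lemma smooth_differentiable: "smooth f \<Longrightarrow> f differentiable (at x)"
  unfolding smooth_def by (metis ntimes_differentiable.simps(2))

lemma smooth_continuous: "smooth f \<Longrightarrow> continuous_on A f"
  by (intro differentiable_imp_continuous_on smooth_differentiable)

lemma smooth_cDk: "smooth f \<Longrightarrow> smooth (cDk k \<alpha> f)"
  by (induction k arbitrary: \<alpha>) (auto simp: Let_def smooth_cpartial)

section \<open>Compactly supported functions\<close>

definition compact_support_in :: "(real^'n::finite) set \<Rightarrow> (real^'n \<Rightarrow> real) \<Rightarrow> bool" where
  "compact_support_in \<Omega> \<phi> \<longleftrightarrow> compact (tsupp \<phi>) \<and> tsupp \<phi> \<subseteq> interior \<Omega>"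

lemma closed_tsupp: "closed (tsupp \<phi>)"
  by (simp add: tsupp_def)

lemma tsupp_subset: "closed S \<Longrightarrow> (\<And>x. x \<notin> S \<Longrightarrow> \<phi> x = 0) \<Longrightarrow> tsupp \<phi> \<subseteq> S"
  unfolding tsupp_def by (intro closure_minimal) auto

lemma zero_outside_tsupp: "x \<notin> tsupp \<phi> \<Longrightarrow> \<phi> x = 0"
  unfolding tsupp_def using closure_subset[of "{x. \<phi> x \<noteq> 0}"] by auto

lemma tsupp_cpartial:
  fixes \<phi> :: "real^'n::finite \<Rightarrow> real"
  shows "tsupp (cpartial \<phi> i) \<subseteq> tsupp \<phi>"
proof (rule tsupp_subset[OF closed_tsupp])
  fix x assume x: "x \<notin> tsupp \<phi>"
  have "((\<lambda>x. 0) has_derivative (\<lambda>x. 0)) (at x)" by simp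
  then have "(\<phi> has_derivative (\<lambda>x. 0)) (at x)"
    by (rule has_derivative_transform_within_open[of _ _ _ _ "- tsupp \<phi>"])
      (use x in \<open>auto simp: closed_tsupp open_closed zero_outside_tsupp\<close>)
  then show "cpartial \<phi> i x = 0" using cpartial_eqI by fastforce
qed

lemma tsupp_cDk:
  fixes \<phi> :: "real^'n::finite \<Rightarrow> real"
  shows "tsupp (cDk k \<alpha> \<phi>) \<subseteq> tsupp \<phi>"
proof (induction k arbitrary: \<alpha>)
  case (Suc k)
  then show ?case using tsupp_cpartial by (fastforce simp: Let_def)
qed simp

lemma compact_support_in_closedI:
  assumes "compact K" "K \<subseteq> interior \<Omega>" "\<And>x. x \<notin> K \<Longrightarrow> \<phi> x = 0"
  shows "compact_support_in \<Omega> \<phi>"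
proof -
  have "tsupp \<phi> \<subseteq> K" using assms by (intro tsupp_subset compact_imp_closed)
  then show ?thesis
    using assms compact_Int_closed[OF assms(1) closed_tsupp, of \<phi>]
    by (auto simp: compact_support_in_def inf.absorb2)
qed

lemma compact_support_in_tsupp_mono:
  "compact_support_in \<Omega> \<phi> \<Longrightarrow> tsupp \<psi> \<subseteq> tsupp \<phi> \<Longrightarrow> compact_support_in \<Omega> \<psi>"
  by (rule compact_support_in_closedI[of "tsupp \<phi>"])
    (auto simp: compact_support_in_def intro: zero_outside_tsupp)

lemma compact_support_in_mult_right:
  assumes "compact_support_in \<Omega> \<phi>"
  shows "compact_support_in \<Omega> (\<lambda>x. \<psi> x * \<phi> x)"
  using assms
  by (rule compact_support_in_tsupp_mono) (simp add: tsupp_subset closed_tsupp zero_outside_tsupp)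

lemma compact_support_in_cpartial:
  "compact_support_in \<Omega> \<phi> \<Longrightarrow> compact_support_in \<Omega> (cpartial \<phi> i)"
  by (rule compact_support_in_tsupp_mono[OF _ tsupp_cpartial])

lemma compact_support_in_zero:
  "compact_support_in \<Omega> \<phi> \<Longrightarrow> x \<notin> interior \<Omega> \<Longrightarrow> \<phi> x = 0"
  by (auto simp: compact_support_in_def intro: zero_outside_tsupp)

lemma test_funI: "smooth \<phi> \<Longrightarrow> compact_support_in \<Omega> \<phi> \<Longrightarrow> test_fun \<Omega> \<phi>"
  by (auto simp: test_fun_def cD_def compact_support_in_def
      intro!: smooth_differentiable smooth_continuous smooth_cDk)

lemma test_fun_cD:
  assumes "test_fun \<Omega> \<phi>"
  shows "cD \<alpha> \<phi> differentiable (at x)" "continuous_on A (cD \<alpha> \<phi>)" "compact_support_in \<Omega> (cD \<alpha> \<phi>)"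
proof -
  show "cD \<alpha> \<phi> differentiable (at x)" "continuous_on A (cD \<alpha> \<phi>)"
    using assms by (auto simp: test_fun_def intro: continuous_on_subset)
  have "compact_support_in \<Omega> \<phi>"
    using assms by (simp add: test_fun_def compact_support_in_def)
  then show "compact_support_in \<Omega> (cD \<alpha> \<phi>)"
    by (rule compact_support_in_tsupp_mono) (simp add: cD_def tsupp_cDk)
qed

section \<open>The unit cube and its cutoff functions\<close>

lemma mem_unit_cube: "x \<in> unit_cube \<longleftrightarrow> (\<forall>i. 0 \<le> x $ i \<and> x $ i \<le> 1)"
  by (auto simp: unit_cube_def mem_box_cart)

lemma interior_unit_cube: "interior unit_cube = {x. \<forall>i. 0 < x $ i \<and> x $ i < 1}"
  by (auto simp: unit_cube_def mem_box_cart)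

lemma compact_unit_cube: "compact unit_cube"
  by (simp add: unit_cube_def)

lemma sets_unit_cube [measurable, simp]: "unit_cube \<in> sets lebesgue"
  by (simp add: unit_cube_def)

text \<open>The derivatives of \<open>exp (- 1 / x)\<close>, extended by \<open>0\<close>, are linear combinations of these.\<close>

definition flat_exp :: "nat \<Rightarrow> real \<Rightarrow> real" where
  "flat_exp k x = (if 0 < x then exp (- inverse x) * inverse x ^ k else 0)"

lemma flat_exp_tendsto_0: "((\<lambda>x. flat_exp k x) \<longlongrightarrow> 0) (at 0)"
proof (rule filterlim_split_at)
  show "(flat_exp k \<longlongrightarrow> 0) (at_left 0)"
    by (rule tendsto_eventually) (auto simp: flat_exp_def eventually_at_filter)
  have "((\<lambda>x::real. inverse x ^ k / exp (inverse x)) \<longlongrightarrow> 0) (at_right 0)"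
    by (rule filterlim_compose[OF tendsto_power_div_exp_0 filterlim_inverse_at_top_right])
  then show "(flat_exp k \<longlongrightarrow> 0) (at_right 0)"
    by (rule Lim_transform_eventually)
      (auto simp: eventually_at_filter flat_exp_def exp_minus field_simps)
qed

lemma flat_exp_has_real_derivative:
  "(flat_exp k has_real_derivative flat_exp (k + 2) x - real k * flat_exp (k + 1) x) (at x)"
proof (cases x "0::real" rule: linorder_cases)
  case less
  have "((\<lambda>_. 0) has_real_derivative 0) (at x)" by simp
  then have "(flat_exp k has_real_derivative 0) (at x)"
    by (rule has_field_derivative_transform_within_open[of _ _ _ "{..<0}"])
      (use less in \<open>auto simp: flat_exp_def\<close>)
  with less show ?thesis by (simp add: flat_exp_def)
next
  case equal
  have "((\<lambda>h. (flat_exp k (0 + h) - flat_exp k 0) / h) \<longlongrightarrow> 0) (at 0)"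
    by (rule Lim_transform_eventually[OF flat_exp_tendsto_0[of "Suc k"]])
      (auto simp: eventually_at_filter flat_exp_def field_simps)
  then show ?thesis using equal by (simp add: DERIV_def flat_exp_def)
next
  case greater
  let ?D = "exp (- inverse x) * inverse x ^ (k + 2)
      - real k * (exp (- inverse x) * inverse x ^ (k + 1))"
  have "k = 0 \<or> inverse x * inverse x ^ (k - Suc 0) = inverse x ^ k"
    by (cases k) auto
  then have "((\<lambda>x. exp (- inverse x) * inverse x ^ k) has_real_derivative ?D) (at x)"
    using greater by (auto intro!: derivative_eq_intros simp: power2_eq_square algebra_simps)
  then have "(flat_exp k has_real_derivative ?D) (at x)"
    by (rule has_field_derivative_transform_within_open[of _ _ _ "{0<..}"])
      (use greater in \<open>auto simp: flat_exp_def\<close>)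
  with greater show ?thesis by (simp add: flat_exp_def)
qed

lemma smooth_flat_exp:
  assumes "smooth f" shows "smooth (\<lambda>x. flat_exp k (f x))"
proof -
  have "(flat_exp k has_real_derivative 1 * flat_exp (k + 2) t
        + - real k * flat_exp (k + 1) t) (at t)"
    for k t
    using flat_exp_has_real_derivative[of k t] by simp
  from smooth_compose_family[of flat_exp "\<lambda>_. 1" "\<lambda>k. k + 2" "\<lambda>k. - real k" "\<lambda>k. k + 1",
      OF this assms] show ?thesis .
qed

lemma flat_exp_2_weighted_bound: "\<bar>(y + 1) * flat_exp 2 y\<bar> \<le> 3"
proof (cases "0 < y")
  case True
  define s where "s = inverse y"
  have s: "0 < s" "y * s = 1" using True by (auto simp: s_def)
  have "1 + s + s\<^sup>2 / 2 \<le> exp s" using s by (intro exp_lower_Taylor_quadratic) simp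
  moreover have "0 \<le> s\<^sup>2" by simp
  ultimately have "s + s\<^sup>2 \<le> 3 * exp s" using s(1) by linarith
  moreover have "(y + 1) * s\<^sup>2 = s + s\<^sup>2"
    using s(2) by (simp add: power2_eq_square distrib_right flip: mult.assoc)
  then have "\<bar>(y + 1) * flat_exp 2 y\<bar> = (s + s\<^sup>2) / exp s"
    using True s(1) by (simp add: flat_exp_def s_def[symmetric] exp_minus divide_inverse abs_mult)
  ultimately show ?thesis using s by (simp add: divide_le_eq)
qed (simp add: flat_exp_def)

definition cutoff :: "nat \<Rightarrow> real \<Rightarrow> real" where
  "cutoff m t = flat_exp 0 (real m * (t * (1 - t)) - 1)"

definition cutoff_deriv :: "nat \<Rightarrow> real \<Rightarrow> real" where
  "cutoff_deriv m t = flat_exp 2 (real m * (t * (1 - t)) - 1) * (real m * (1 - 2 * t))"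

lemma cutoff_has_real_derivative: "(cutoff m has_real_derivative cutoff_deriv m t) (at t)"
proof -
  have "((\<lambda>t. real m * (t * (1 - t)) - 1) has_real_derivative real m * (1 - 2 * t)) (at t)"
    by (auto intro!: derivative_eq_intros simp: algebra_simps)
  from DERIV_chain2[OF flat_exp_has_real_derivative[of 0] this] show ?thesis
    by (simp add: cutoff_def[abs_def] cutoff_deriv_def numeral_2_eq_2)
qed

lemma cutoff_eq_0: "real m * (t * (1 - t)) < 1 \<Longrightarrow> cutoff m t = 0"
  by (simp add: cutoff_def flat_exp_def)

lemma cutoff_bounds: "0 \<le> cutoff m t" "cutoff m t \<le> 1"
  by (simp_all add: cutoff_def flat_exp_def)

lemma cutoff_deriv_bound:
  assumes "0 \<le> t" "t \<le> 1"
  shows "t * (1 - t) * \<bar>cutoff_deriv m t\<bar> \<le> 3"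
proof -
  define y where "y = real m * (t * (1 - t)) - 1"
  have "t * (1 - t) * \<bar>cutoff_deriv m t\<bar> = \<bar>(y + 1) * flat_exp 2 y\<bar> * \<bar>1 - 2 * t\<bar>"
    using assms by (simp add: cutoff_deriv_def y_def abs_mult)
  also have "\<dots> \<le> 3 * 1"
    using assms by (intro mult_mono flat_exp_2_weighted_bound) auto
  finally show ?thesis by simp
qed

lemma cutoff_tendsto:
  assumes "0 < t" "t < 1"
  shows "(\<lambda>m. cutoff m t) \<longlonglongrightarrow> 1" "(\<lambda>m. cutoff_deriv m t) \<longlonglongrightarrow> 0"
proof -
  define y where "y m = real m * (t * (1 - t)) - 1" for m
  define s where "s m = inverse (y m)" for m
  have "filterlim (\<lambda>m. (t * (1 - t)) * real m) at_top sequentially"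
    using assms
    by (intro filterlim_tendsto_pos_mult_at_top[
          OF tendsto_const _ filterlim_real_sequentially]) simp
  from filterlim_tendsto_add_at_top[OF tendsto_const this, of "-1"]
  have y: "filterlim y at_top sequentially"
    by (simp add: y_def[abs_def] algebra_simps)
  then have y_pos: "\<forall>\<^sub>F m in sequentially. 0 < y m"
    by (simp add: filterlim_at_top_dense)
  have s: "s \<longlonglongrightarrow> 0"
    unfolding s_def by (rule filterlim_compose[OF tendsto_inverse_0_at_top[OF filterlim_ident] y])
  have "(\<lambda>m. exp (- s m)) \<longlonglongrightarrow> exp (- 0)"
    by (intro tendsto_intros s)
  then show "(\<lambda>m. cutoff m t) \<longlonglongrightarrow> 1"
    by (simp, elim Lim_transform_eventually)
      (use y_pos in \<open>eventually_elim, simp add: cutoff_def flat_exp_def y_def s_def\<close>)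
  have "(\<lambda>m. (s m + (s m)\<^sup>2) * exp (- s m) * ((1 - 2 * t) / (t * (1 - t)))) \<longlonglongrightarrow>
      (0 + 0\<^sup>2) * exp (- 0) * ((1 - 2 * t) / (t * (1 - t)))"
    by (intro tendsto_intros s)
  moreover have "\<forall>\<^sub>F m in sequentially.
      (s m + (s m)\<^sup>2) * exp (- s m) * ((1 - 2 * t) / (t * (1 - t))) = cutoff_deriv m t"
    using y_pos
  proof eventually_elim
    case (elim m)
    have "real m = (y m + 1) / (t * (1 - t))" using assms by (simp add: y_def)
    then have "cutoff_deriv m t = ((y m + 1) * (s m)\<^sup>2)
        * exp (- s m) * ((1 - 2 * t) / (t * (1 - t)))"
      using elim by (simp add: cutoff_deriv_def flat_exp_def y_def[symmetric] s_def)
    moreover have "(y m + 1) * (s m)\<^sup>2 = s m + (s m)\<^sup>2"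
      using elim by (simp add: s_def field_simps power2_eq_square)
    ultimately show ?case by simp
  qed
  ultimately show "(\<lambda>m. cutoff_deriv m t) \<longlonglongrightarrow> 0"
    by (auto elim: Lim_transform_eventually)
qed

definition tensor :: "('n \<Rightarrow> real \<Rightarrow> real) \<Rightarrow> real^'n::finite \<Rightarrow> real" where
  "tensor h x = (\<Prod>i\<in>UNIV. h i (x $ i))"

lemma tensor_remove: "tensor h x = h i (x $ i) * (\<Prod>j\<in>UNIV-{i}. h j (x $ j))"
  unfolding tensor_def by (rule prod.remove) auto

lemma cpartial_tensor:
  fixes h :: "'n::finite \<Rightarrow> real \<Rightarrow> real"
  assumes h: "\<And>j t. (h j has_real_derivative h' j t) (at t)"
  shows "cpartial (tensor h) i = tensor (h(i := h' i))"
proof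
  fix x :: "real^'n"
  have "((\<lambda>x. h j (x $ j)) has_derivative (\<lambda>y. h' j (x $ j) * y $ j)) (at x)" for j
    using has_derivative_compose[
        OF bounded_linear_imp_has_derivative[OF bounded_linear_vec_nth[of j]],
        of "h j" "(*) (h' j (x $ j))" x UNIV] h[of j "x $ j"]
    by (simp add: has_field_derivative_def)
  then have "(tensor h has_derivative
      (\<lambda>y. \<Sum>j\<in>UNIV. (h' j (x $ j) * y $ j) * (\<Prod>l\<in>UNIV-{j}. h l (x $ l)))) (at x)"
    unfolding tensor_def[abs_def] by (intro has_derivative_prod)
  then have "cpartial (tensor h) i x =
      (\<Sum>j\<in>UNIV. (h' j (x $ j) * axis i 1 $ j) * (\<Prod>l\<in>UNIV-{j}. h l (x $ l)))"
    by (rule cpartial_eqI)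
  also have "\<dots> = (\<Sum>j\<in>UNIV. if j = i then h' j (x $ j) * (\<Prod>l\<in>UNIV-{j}. h l (x $ l)) else 0)"
    by (intro sum.cong) (auto simp: axis_def)
  also have "\<dots> = tensor (h(i := h' i)) x"
    unfolding tensor_remove[of _ x i] by simp
  finally show "cpartial (tensor h) i x = tensor (h(i := h' i)) x" .
qed

lemma tensor_tendsto:
  "(\<And>i. (\<lambda>m. h m i (x $ i)) \<longlonglongrightarrow> g i (x $ i)) \<Longrightarrow> (\<lambda>m. tensor (h m) x) \<longlonglongrightarrow> tensor g x"
  unfolding tensor_def by (rule tendsto_prod)

definition cube_cutoff :: "nat \<Rightarrow> real^'n::finite \<Rightarrow> real" where
  "cube_cutoff m = tensor (\<lambda>_. cutoff m)"

lemma smooth_cube_cutoff: "smooth (cube_cutoff m)"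
  unfolding cube_cutoff_def tensor_def[abs_def] cutoff_def
  by (intro smooth_prod smooth_flat_exp smooth_diff smooth_mult smooth_const smooth_coordinate)

lemma cube_cutoff_bounds: "0 \<le> cube_cutoff m x" "cube_cutoff m x \<le> 1"
  by (auto simp: cube_cutoff_def tensor_def cutoff_bounds intro!: prod_nonneg prod_le_1)

lemma cube_cutoff_tendsto_1:
  assumes "x \<in> interior unit_cube" shows "(\<lambda>m. cube_cutoff m x) \<longlonglongrightarrow> 1"
proof -
  have "(\<lambda>m. cube_cutoff m x) \<longlonglongrightarrow> tensor (\<lambda>i t. 1) x"
    unfolding cube_cutoff_def
    using assms by (intro tensor_tendsto cutoff_tendsto) (auto simp: interior_unit_cube)
  then show ?thesis by (simp add: tensor_def)
qed

lemma compact_support_in_cube_cutoff: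
  "compact_support_in unit_cube (cube_cutoff m :: real^'n::finite \<Rightarrow> real)"
proof (rule compact_support_in_closedI)
  define K where "K = {x::real^'n. \<forall>i. 1 \<le> real m * (x $ i * (1 - x $ i))}"
  show "K \<subseteq> interior unit_cube"
  proof
    fix x assume "x \<in> K"
    then have "0 < real m * (x $ i * (1 - x $ i))" for i
      unfolding K_def by (auto intro: less_le_trans[OF zero_less_one])
    then have "0 < x $ i \<and> x $ i < 1" for i
      by (smt (verit) zero_less_mult_iff of_nat_0_le_iff)
    then show "x \<in> interior unit_cube" by (simp add: interior_unit_cube)
  qed
  then have "K = K \<inter> unit_cube" using interior_subset by blast
  moreover have "closed K"
    unfolding K_def by (intro closed_Collect_all closed_Collect_le continuous_intros)
  ultimately show "compact K"
    using closed_Int_compact compact_unit_cube by metis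
  show "cube_cutoff m x = 0" if "x \<notin> K" for x
    using that cutoff_eq_0 by (force simp: K_def not_le cube_cutoff_def tensor_def)
qed

lemma cpartial_cube_cutoff:
  "cpartial (cube_cutoff m) i x = cutoff_deriv m (x $ i) * (\<Prod>j\<in>UNIV-{i}. cutoff m (x $ j))"
  unfolding cube_cutoff_def
  by (simp add: cpartial_tensor[OF cutoff_has_real_derivative] tensor_remove[of _ _ i])

lemma cpartial_cube_cutoff_bound:
  assumes "x \<in> unit_cube"
  shows "x $ i * (1 - x $ i) * \<bar>cpartial (cube_cutoff m) i x\<bar> \<le> 3"
proof -
  let ?P = "\<Prod>j\<in>UNIV-{i}. cutoff m (x $ j)"
  have P: "0 \<le> ?P" "?P \<le> 1" by (auto simp: cutoff_bounds intro!: prod_nonneg prod_le_1)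
  have "x $ i * (1 - x $ i) * \<bar>cpartial (cube_cutoff m) i x\<bar> =
      (x $ i * (1 - x $ i) * \<bar>cutoff_deriv m (x $ i)\<bar>) * ?P"
    using P by (simp add: cpartial_cube_cutoff abs_mult)
  also have "\<dots> \<le> 3 * 1"
    using assms P by (intro mult_mono cutoff_deriv_bound) (auto simp: mem_unit_cube)
  finally show ?thesis by simp
qed

lemma cpartial_cube_cutoff_tendsto_0:
  assumes "x \<in> interior unit_cube"
  shows "(\<lambda>m. cpartial (cube_cutoff m) i x) \<longlonglongrightarrow> 0"
proof -
  have "(\<lambda>m. cpartial (cube_cutoff m) i x) \<longlonglongrightarrow> 0 * (\<Prod>j\<in>UNIV-{i}. 1)"
    unfolding cpartial_cube_cutoff
    using assms by (intro tendsto_mult tendsto_prod cutoff_tendsto) (auto simp: interior_unit_cube)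
  then show ?thesis by simp
qed

abbreviation (input) L2_inner ::
  "(real^'n::finite) set \<Rightarrow> (real^'n \<Rightarrow> real) \<Rightarrow> (real^'n \<Rightarrow> real) \<Rightarrow> real" where
  "L2_inner \<Omega> f g \<equiv> \<integral>x. f x * g x \<partial>lebesgue_on \<Omega>"

abbreviation (input) L2_norm_sq :: "(real^'n::finite) set \<Rightarrow> (real^'n \<Rightarrow> real) \<Rightarrow> real" where
  "L2_norm_sq \<Omega> f \<equiv> \<integral>x. (f x)\<^sup>2 \<partial>lebesgue_on \<Omega>"

abbreviation (input) cube_inner :: "(real^'n::finite \<Rightarrow> real) \<Rightarrow> (real^'n \<Rightarrow> real) \<Rightarrow> real" where
  "cube_inner \<equiv> L2_inner unit_cube"

abbreviation (input) cube_measure :: "(real^'n::finite) measure" where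
  "cube_measure \<equiv> lebesgue_on unit_cube"

lemma finite_cube_measure: "finite_measure cube_measure"
  by (intro finite_measure_lebesgue_on) (simp add: unit_cube_def)

lemma AE_cube_interior: "AE x in cube_measure. x \<in> interior unit_cube"
proof -
  have "negligible (unit_cube - interior unit_cube :: (real^'n) set)"
    using negligible_frontier_interval[of "0::real^'n" "\<chi> i. 1"] by (simp add: unit_cube_def)
  then have "AE x in lebesgue. x \<notin> (unit_cube - interior unit_cube :: (real^'n) set)"
    by (metis AE_not_in negligible_iff_null_sets)
  then show ?thesis
    by (subst AE_restrict_space_iff) (auto elim!: eventually_mono)
qed

lemma AE_cube_ex:
  assumes "AE x in (cube_measure :: (real^'n::finite) measure). P x" obtains x where "P x"
proof -
  have "(\<chi> i. 1/2) \<in> interior (unit_cube :: (real^'n) set)" by (simp add: interior_unit_cube)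
  then have "\<not> negligible (unit_cube :: (real^'n) set)"
    using open_not_negligible[OF open_interior] negligible_subset[OF _ interior_subset] by blast
  then have "emeasure (cube_measure :: (real^'n) measure) (space cube_measure) \<noteq> 0"
    by (simp add: emeasure_restrict_space negligible_iff_emeasure0)
  then show ?thesis
    using assms that eventually_happens' by (metis ae_filter_eq_bot_iff)
qed

lemma borel_measurable_cube_continuous:
  "continuous_on unit_cube f \<Longrightarrow> f \<in> borel_measurable cube_measure"
  by (intro continuous_imp_measurable_on_sets_lebesgue) auto

lemma continuous_on_cube_bounded:
  assumes "continuous_on unit_cube (f :: real^'n::finite \<Rightarrow> real)"
  obtains C where "0 \<le> C" "\<And>x. x \<in> unit_cube \<Longrightarrow> \<bar>f x\<bar> \<le> C"
proof -
  have "bounded (f ` unit_cube)"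
    using assms compact_unit_cube by (intro compact_imp_bounded compact_continuous_image)
  then show ?thesis
    using that unfolding bounded_pos by (metis imageI less_imp_le real_norm_def)
qed

lemma integrable_cube_continuous:
  fixes f :: "real^'n::finite \<Rightarrow> real"
  assumes "continuous_on unit_cube f"
  shows "integrable cube_measure f"
proof -
  obtain C where "\<And>x. x \<in> unit_cube \<Longrightarrow> \<bar>f x\<bar> \<le> C"
    using continuous_on_cube_bounded[OF assms] by blast
  then show ?thesis
    using borel_measurable_cube_continuous[OF assms]
    by (intro finite_measure.integrable_const_bound[OF finite_cube_measure, of _ C] AE_I2) auto
qed

section \<open>Integration by parts on the unit cube\<close>

lemma integral_lborel_eq_0_if_line_integrals_eq_0:
  fixes f :: "real^'n::finite \<Rightarrow> real"
  assumes f: "integrable lborel f"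
    and lines: "\<And>x. x $ i = 0 \<Longrightarrow> (\<integral>t. f (x + t *\<^sub>R axis i 1) \<partial>lborel) = 0"
  shows "integral\<^sup>L lborel f = 0"
proof -
  interpret product_sigma_finite "\<lambda>_::real^'n. lborel :: real measure" ..
  define e where "e = axis i (1::real)"
  define B where "B = Basis - {e}"
  have B: "insert e B = Basis" "finite B" "e \<notin> B"
    by (auto simp: B_def e_def axis_in_Basis_iff)
  define T where "T g = (\<Sum>b\<in>Basis. g b *\<^sub>R b)" for g :: "real^'n \<Rightarrow> real"
  have T: "T \<in> measurable (\<Pi>\<^sub>M b\<in>insert e B. lborel) borel"
    unfolding B(1) T_def[abs_def] by measurable
  have lborel_T: "lborel = distr (\<Pi>\<^sub>M b\<in>insert e B. lborel) borel T"
    unfolding B(1) T_def[abs_def] by (rule lborel_eq)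
  note int_T = integrable_distr[OF T f[unfolded lborel_T]]
  have T_component: "T g $ i = g e" for g
  proof -
    have "T g $ i = T g \<bullet> e" by (simp add: e_def inner_axis)
    also have "\<dots> = g e"
      unfolding T_def using B(1) by (intro inner_sum_left_Basis) blast
    finally show ?thesis .
  qed
  have "(\<integral>t. f (T (g(e := t))) \<partial>lborel) = 0" for g
  proof -
    define x where "x = T (g(e := 0))"
    have "x $ i = 0" by (simp add: x_def T_component)
    moreover have "T (g(e := t)) = x + t *\<^sub>R e" for t
      using B(2,3) by (auto simp: x_def T_def add.commute simp flip: B(1) intro!: sum.cong)
    ultimately show ?thesis using lines by (simp add: e_def)
  qed
  then have "integral\<^sup>L (\<Pi>\<^sub>M b\<in>insert e B. lborel) (\<lambda>g. f (T g)) = 0"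
    by (simp add: product_integral_insert[OF B(2,3) int_T])
  then show ?thesis
    using f by (subst lborel_T) (simp add: integral_distr[OF T])
qed

definition C1_along :: "'n \<Rightarrow> (real^'n::finite \<Rightarrow> real) \<Rightarrow> bool" where
  "C1_along i F \<longleftrightarrow> (\<forall>x. F differentiable (at x)) \<and> continuous_on UNIV (cpartial F i)"

lemma C1_along_continuous:
  assumes "C1_along i F"
  shows "continuous_on A F" "continuous_on A (cpartial F i)"
  using assms by (auto simp: C1_along_def
      intro: differentiable_imp_continuous_on continuous_on_subset)

lemma smooth_C1_along: "smooth F \<Longrightarrow> C1_along i F"
  by (simp add: C1_along_def smooth_differentiable smooth_continuous smooth_cpartial)

lemma cpartial_mult_C1_along:
  assumes "C1_along i f" "C1_along i g"
  shows "cpartial (\<lambda>x. f x * g x) i = (\<lambda>x. cpartial f i x * g x + f x * cpartial g i x)"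
  using assms by (intro cpartial_mult) (simp_all add: C1_along_def)

lemma C1_along_mult:
  assumes "C1_along i f" "C1_along i g"
  shows "C1_along i (\<lambda>x. f x * g x)"
  using assms C1_along_continuous[OF assms(1)] C1_along_continuous[OF assms(2)]
  unfolding C1_along_def cpartial_mult_C1_along[OF assms]
  by (auto intro!: differentiable_mult continuous_intros)

lemma integral_cpartial_unit_cube_eq_0:
  fixes F :: "real^'n::finite \<Rightarrow> real"
  assumes F: "C1_along i F"
    and faces: "\<And>x. x \<in> unit_cube \<Longrightarrow> x $ i = 0 \<Longrightarrow> F (x + axis i 1) = F x"
  shows "(\<integral>x. cpartial F i x \<partial>cube_measure) = 0"
proof -
  let ?G = "\<lambda>x. indicator unit_cube x *\<^sub>R cpartial F i x"
  have cont: "continuous_on A (cpartial F i)" for A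
    by (rule C1_along_continuous[OF F])
  have "integrable lborel ?G"
    by (intro borel_integrable_compact compact_unit_cube cont)
  moreover have "(\<integral>t. ?G (x + t *\<^sub>R axis i 1) \<partial>lborel) = 0" if "x $ i = 0" for x
  proof (cases "x \<in> unit_cube")
    case True
    let ?g = "\<lambda>t. cpartial F i (x + t *\<^sub>R axis i 1)"
    have "x + t *\<^sub>R axis i 1 \<in> unit_cube \<longleftrightarrow> t \<in> {0..1}" for t
      using True that by (auto simp: mem_unit_cube axis_def)
    then have "?G (x + t *\<^sub>R axis i 1) = ?g t * indicator {0..1} t" for t
      by (simp add: indicator_def)
    moreover have "continuous_on UNIV ?g"
      by (intro continuous_on_compose2[OF cont[of UNIV]] continuous_intros) auto
    then have "(\<integral>t. ?g t * indicator {0..1} t \<partial>lborel) =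
        F (x + 1 *\<^sub>R axis i 1) - F (x + 0 *\<^sub>R axis i 1)"
      using F by (intro integral_FTC_Icc_real has_real_derivative_along_axis)
        (auto simp: C1_along_def continuous_on_eq_continuous_at)
    ultimately show ?thesis using faces[OF True that] by (simp only:) simp
  next
    case False
    then have "x + t *\<^sub>R axis i 1 \<notin> unit_cube" for t
      using that by (auto simp: mem_unit_cube axis_def split: if_splits)
        (metis order.refl zero_le_one)+
    then show ?thesis by simp
  qed
  ultimately have "integral\<^sup>L lborel ?G = 0"
    by (rule integral_lborel_eq_0_if_line_integrals_eq_0)
  moreover have "?G \<in> borel_measurable lborel"
    using borel_measurable_continuous_on_indicator[OF _ cont] by (simp add: unit_cube_def)
  ultimately show ?thesis
    by (simp add: integral_restrict_space integral_completion)
qed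

lemma cube_integration_by_parts:
  fixes f g :: "real^'n::finite \<Rightarrow> real"
  assumes f: "C1_along i f" and g: "C1_along i g"
    and faces: "\<And>x. x $ i = 0 \<or> x $ i = 1 \<Longrightarrow> x \<in> unit_cube \<Longrightarrow> f x * g x = 0"
  shows "cube_inner f (cpartial g i) = - cube_inner (cpartial f i) g"
proof -
  have "(\<integral>x. cpartial (\<lambda>x. f x * g x) i x \<partial>cube_measure) = 0"
  proof (rule integral_cpartial_unit_cube_eq_0[OF C1_along_mult[OF f g]])
    fix x :: "real^'n" assume x: "x \<in> unit_cube" "x $ i = 0"
    then have "f (x + axis i 1) * g (x + axis i 1) = 0"
      by (intro faces) (auto simp: mem_unit_cube axis_def)
    then show "f (x + axis i 1) * g (x + axis i 1) = f x * g x"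
      using x faces[of x] by auto
  qed
  moreover have "integrable cube_measure (\<lambda>x. cpartial f i x * g x)"
    "integrable cube_measure (\<lambda>x. f x * cpartial g i x)"
    by (intro integrable_cube_continuous continuous_intros C1_along_continuous[OF f]
        C1_along_continuous[OF g])+
  ultimately show ?thesis by (simp add: cpartial_mult_C1_along[OF f g])
qed

lemma cube_integration_by_parts_compact_support:
  assumes "C1_along i f" "C1_along i g" "compact_support_in unit_cube g"
  shows "cube_inner f (cpartial g i) = - cube_inner (cpartial f i) g"
proof (rule cube_integration_by_parts[OF assms(1,2)])
  fix x :: "real^'a" assume "x $ i = 0 \<or> x $ i = 1"
  then have "\<not> (0 < x $ i \<and> x $ i < 1)" by auto
  then have "x \<notin> interior unit_cube" unfolding interior_unit_cube by blast
  then show "f x * g x = 0" using compact_support_in_zero[OF assms(3)] by simp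
qed

section \<open>Square integrable functions\<close>

lemma L2_measurable: "L2 \<Omega> f \<Longrightarrow> f \<in> borel_measurable (lebesgue_on \<Omega>)"
  by (simp add: L2_def)

lemma L2_integrable_sq: "L2 \<Omega> f \<Longrightarrow> integrable (lebesgue_on \<Omega>) (\<lambda>x. (f x)\<^sup>2)"
  by (simp add: L2_def)

lemma L2_integrable_mult:
  assumes "L2 \<Omega> f" "L2 \<Omega> g"
  shows "integrable (lebesgue_on \<Omega>) (\<lambda>x. f x * g x)"
proof (rule Bochner_Integration.integrable_bound)
  show "integrable (lebesgue_on \<Omega>) (\<lambda>x. (f x)\<^sup>2 + (g x)\<^sup>2)"
    using assms by (intro Bochner_Integration.integrable_add L2_integrable_sq)
  show "(\<lambda>x. f x * g x) \<in> borel_measurable (lebesgue_on \<Omega>)"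
    using assms by (intro borel_measurable_times L2_measurable)
  have "\<bar>a * b\<bar> \<le> a\<^sup>2 + b\<^sup>2" for a b :: real
    using sum_squares_bound[of "\<bar>a\<bar>" "\<bar>b\<bar>"] mult_nonneg_nonneg[of "\<bar>a\<bar>" "\<bar>b\<bar>"]
    unfolding abs_mult power2_abs by linarith
  then show "AE x in lebesgue_on \<Omega>. norm (f x * g x) \<le> norm ((f x)\<^sup>2 + (g x)\<^sup>2)"
    by (simp add: abs_of_nonneg)
qed

lemma L2_add:
  assumes "L2 \<Omega> f" "L2 \<Omega> g"
  shows "L2 \<Omega> (\<lambda>x. f x + g x)"
  using assms L2_integrable_mult[OF assms] by (auto simp: L2_def power2_sum mult.assoc)

lemma L2_cmult: "L2 \<Omega> f \<Longrightarrow> L2 \<Omega> (\<lambda>x. c * f x)"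
  by (auto simp: L2_def power_mult_distrib)

lemma L2_diff:
  assumes "L2 \<Omega> f" "L2 \<Omega> g"
  shows "L2 \<Omega> (\<lambda>x. f x - g x)"
  using L2_add[OF assms(1) L2_cmult[OF assms(2), of "-1"]] by simp

lemma L2_sum: "(\<And>i. i \<in> I \<Longrightarrow> L2 \<Omega> (f i)) \<Longrightarrow> L2 \<Omega> (\<lambda>x. \<Sum>i\<in>I. f i x)"
  by (induction I rule: infinite_finite_induct) (auto intro: L2_add simp: L2_def[of _ "\<lambda>x. 0"])

lemma L2_cong_AE:
  assumes f: "L2 \<Omega> f" and g: "g \<in> borel_measurable (lebesgue_on \<Omega>)"
    and eq: "AE x in lebesgue_on \<Omega>. g x = f x"
  shows "L2 \<Omega> g" "L2_norm_sq \<Omega> g = L2_norm_sq \<Omega> f"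
proof -
  have sq_eq: "AE x in lebesgue_on \<Omega>. (g x)\<^sup>2 = (f x)\<^sup>2" using eq by eventually_elim simp
  show "L2_norm_sq \<Omega> g = L2_norm_sq \<Omega> f"
    by (rule integral_cong_AE[OF _ _ sq_eq]) (use f g in \<open>auto simp: L2_def\<close>)
  have "integrable (lebesgue_on \<Omega>) (\<lambda>x. (g x)\<^sup>2) \<longleftrightarrow> integrable (lebesgue_on \<Omega>) (\<lambda>x. (f x)\<^sup>2)"
    by (rule integrable_cong_AE[OF _ _ sq_eq]) (use f g in \<open>auto simp: L2_def\<close>)
  then show "L2 \<Omega> g" using f g by (simp add: L2_def)
qed

lemma L2_cube_continuous: "continuous_on unit_cube f \<Longrightarrow> L2 unit_cube f"
  by (simp add: L2_def borel_measurable_cube_continuous integrable_cube_continuous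
      continuous_on_power)

lemma L2_cube_smooth: "smooth f \<Longrightarrow> L2 unit_cube f"
  by (intro L2_cube_continuous smooth_continuous)

lemma L2_cube_integrable:
  fixes f :: "real^'n::finite \<Rightarrow> real"
  assumes "L2 unit_cube f" shows "integrable cube_measure f"
  using L2_integrable_mult[OF assms L2_cube_smooth[OF smooth_const[of 1]]] by simp

lemma Linf_cube_integrable:
  fixes a :: "real^'n::finite \<Rightarrow> real"
  assumes "Linf unit_cube a" shows "integrable cube_measure a"
proof -
  obtain C where "AE x in cube_measure. \<bar>a x\<bar> \<le> C" using assms by (auto simp: Linf_def)
  then show ?thesis
    using assms by (intro finite_measure.integrable_const_bound[OF finite_cube_measure, of _ C])
      (auto simp: Linf_def)
qed

lemma L2_inner_diff_left:
  "L2 \<Omega> f \<Longrightarrow> L2 \<Omega> g \<Longrightarrow> L2 \<Omega> h \<Longrightarrow>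
    L2_inner \<Omega> (\<lambda>x. f x - g x) h = L2_inner \<Omega> f h - L2_inner \<Omega> g h"
  by (simp add: left_diff_distrib L2_integrable_mult)

lemma L2_inner_sum_left:
  assumes "\<And>i. i \<in> I \<Longrightarrow> L2 \<Omega> (f i)" "L2 \<Omega> h"
  shows "L2_inner \<Omega> (\<lambda>x. \<Sum>i\<in>I. f i x) h = (\<Sum>i\<in>I. L2_inner \<Omega> (f i) h)"
  unfolding sum_distrib_right
  using assms by (intro Bochner_Integration.integral_sum L2_integrable_mult)

lemma L2_norm_sq_add:
  assumes "L2 \<Omega> f" "L2 \<Omega> g"
  shows "L2_norm_sq \<Omega> (\<lambda>x. f x + g x) = L2_norm_sq \<Omega> f + L2_norm_sq \<Omega> g + 2 * L2_inner \<Omega> f g"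
  using assms by (simp add: power2_sum mult.assoc L2_integrable_sq L2_integrable_mult)

lemma L2_norm_sq_diff:
  assumes "L2 \<Omega> f" "L2 \<Omega> g"
  shows "L2_norm_sq \<Omega> (\<lambda>x. f x - g x) = L2_norm_sq \<Omega> f + L2_norm_sq \<Omega> g - 2 * L2_inner \<Omega> f g"
  using L2_norm_sq_add[OF assms(1) L2_cmult[OF assms(2), of "-1"]] by simp

lemma L2_norm_sq_add_le:
  assumes "L2 \<Omega> f" "L2 \<Omega> g"
  shows "L2_norm_sq \<Omega> (\<lambda>x. f x + g x) \<le> 2 * L2_norm_sq \<Omega> f + 2 * L2_norm_sq \<Omega> g"
proof -
  have "0 \<le> L2_norm_sq \<Omega> (\<lambda>x. f x - g x)" by simp
  then show ?thesis
    unfolding L2_norm_sq_add[OF assms] L2_norm_sq_diff[OF assms] by simp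
qed

lemma L2_norm_sq_diff_le:
  assumes "L2 \<Omega> f" "L2 \<Omega> g"
  shows "L2_norm_sq \<Omega> (\<lambda>x. f x - g x) \<le> 2 * L2_norm_sq \<Omega> f + 2 * L2_norm_sq \<Omega> g"
  using L2_norm_sq_add_le[OF assms(1) L2_cmult[OF assms(2), of "-1"]] by simp

lemma L2_Cauchy_Schwarz:
  assumes "L2 \<Omega> f" "L2 \<Omega> g"
  shows "(L2_inner \<Omega> f g)\<^sup>2 \<le> L2_norm_sq \<Omega> f * L2_norm_sq \<Omega> g"
proof -
  define a b c where "a = L2_norm_sq \<Omega> f" and "b = L2_inner \<Omega> f g" and "c = L2_norm_sq \<Omega> g"
  have "0 \<le> L2_norm_sq \<Omega> (\<lambda>x. c * f x - b * g x)" by simp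
  also have "\<dots> = c * (a * c - b\<^sup>2)"
    unfolding L2_norm_sq_diff[OF L2_cmult[OF assms(1)] L2_cmult[OF assms(2)]]
    by (simp add: a_def[symmetric] b_def[symmetric] c_def[symmetric] power_mult_distrib mult.assoc
        mult.left_commute[of "f _"]) (simp add: algebra_simps power2_eq_square)
  finally have quad: "0 \<le> c * (a * c - b\<^sup>2)" .
  have "b\<^sup>2 \<le> a * c"
  proof (cases "c = 0")
    case True
    then have "AE x in lebesgue_on \<Omega>. (g x)\<^sup>2 = 0"
      using assms(2) by (simp add: c_def L2_def integral_nonneg_eq_0_iff_AE)
    then have "AE x in lebesgue_on \<Omega>. f x * g x = 0" by eventually_elim simp
    then have "b = 0" unfolding b_def by (rule integral_eq_zero_AE)
    then show ?thesis using True by simp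
  next
    case False
    moreover have "0 \<le> c" by (simp add: c_def)
    ultimately show ?thesis using quad by (simp add: zero_le_mult_iff)
  qed
  then show ?thesis by (simp add: a_def b_def c_def)
qed

lemma Linf_mult_sq_le:
  fixes a f :: "real^'n::finite \<Rightarrow> real"
  assumes "AE x in lebesgue_on \<Omega>. \<bar>a x\<bar> \<le> C"
  shows "AE x in lebesgue_on \<Omega>. (a x * f x)\<^sup>2 \<le> C\<^sup>2 * (f x)\<^sup>2"
  using assms
proof eventually_elim
  case (elim x)
  then have "(a x)\<^sup>2 \<le> C\<^sup>2" using power_mono[of "\<bar>a x\<bar>" C 2] by simp
  then show ?case by (simp add: power_mult_distrib mult_right_mono)
qed

lemma L2_Linf_mult:
  assumes "Linf \<Omega> a" "L2 \<Omega> f"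
  shows "L2 \<Omega> (\<lambda>x. a x * f x)"
proof -
  obtain C where C: "AE x in lebesgue_on \<Omega>. \<bar>a x\<bar> \<le> C" and a: "a \<in> borel_measurable (lebesgue_on \<Omega>)"
    using assms by (auto simp: Linf_def)
  have "integrable (lebesgue_on \<Omega>) (\<lambda>x. (a x * f x)\<^sup>2)"
  proof (rule Bochner_Integration.integrable_bound)
    show "integrable (lebesgue_on \<Omega>) (\<lambda>x. C\<^sup>2 * (f x)\<^sup>2)"
      using assms by (intro integrable_mult_right L2_integrable_sq)
    show "AE x in lebesgue_on \<Omega>. norm ((a x * f x)\<^sup>2) \<le> norm (C\<^sup>2 * (f x)\<^sup>2)"
      using Linf_mult_sq_le[OF C] by simp
  qed (use a assms in \<open>auto simp: L2_def\<close>)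
  then show ?thesis using a assms by (auto simp: L2_def)
qed

lemma L2_norm_sq_Linf_mult_le:
  assumes "Linf \<Omega> a" "L2 \<Omega> f" "AE x in lebesgue_on \<Omega>. \<bar>a x\<bar> \<le> C"
  shows "L2_norm_sq \<Omega> (\<lambda>x. a x * f x) \<le> C\<^sup>2 * L2_norm_sq \<Omega> f"
proof -
  have "L2_norm_sq \<Omega> (\<lambda>x. a x * f x) \<le> (\<integral>x. C\<^sup>2 * (f x)\<^sup>2 \<partial>lebesgue_on \<Omega>)"
    using assms Linf_mult_sq_le[OF assms(3)] L2_Linf_mult
    by (intro integral_mono_AE) (auto simp: L2_def)
  then show ?thesis by simp
qed

lemma Linf_weighted_integrable:
  assumes "Linf \<Omega> a" "L2 \<Omega> g"
  shows "integrable (lebesgue_on \<Omega>) (\<lambda>x. a x * (g x)\<^sup>2)"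
  using L2_integrable_mult[OF L2_Linf_mult[OF assms] assms(2)]
  by (simp add: power2_eq_square mult.assoc)

lemma Linf_weighted_integral_ge:
  assumes "Linf \<Omega> a" "L2 \<Omega> g" "AE x in lebesgue_on \<Omega>. c \<le> a x"
  shows "c * L2_norm_sq \<Omega> g \<le> (\<integral>x. a x * (g x)\<^sup>2 \<partial>lebesgue_on \<Omega>)"
proof -
  have "AE x in lebesgue_on \<Omega>. c * (g x)\<^sup>2 \<le> a x * (g x)\<^sup>2"
    using assms(3) by eventually_elim (simp add: mult_right_mono)
  then have "(\<integral>x. c * (g x)\<^sup>2 \<partial>lebesgue_on \<Omega>) \<le> (\<integral>x. a x * (g x)\<^sup>2 \<partial>lebesgue_on \<Omega>)"
    using assms by (intro integral_mono_AE) (auto simp: L2_def Linf_weighted_integrable)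
  then show ?thesis by simp
qed

lemma Linf_weighted_integral_le:
  assumes "Linf \<Omega> a" "L2 \<Omega> g" "AE x in lebesgue_on \<Omega>. a x \<le> c"
  shows "(\<integral>x. a x * (g x)\<^sup>2 \<partial>lebesgue_on \<Omega>) \<le> c * L2_norm_sq \<Omega> g"
proof -
  have "Linf \<Omega> (\<lambda>x. - a x)" using assms(1) by (simp add: Linf_def)
  from Linf_weighted_integral_ge[OF this assms(2), of "- c"] show ?thesis
    using assms(3) by simp
qed

subsection \<open>Convergence in the mean\<close>

definition L2_tendsto ::
  "(real^'n::finite) set \<Rightarrow> (nat \<Rightarrow> real^'n \<Rightarrow> real) \<Rightarrow> (real^'n \<Rightarrow> real) \<Rightarrow> bool" where
  "L2_tendsto \<Omega> F f \<longleftrightarrow> (\<forall>n. L2 \<Omega> (F n)) \<and> L2 \<Omega> f \<and>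
     (\<lambda>n. L2_norm_sq \<Omega> (\<lambda>x. F n x - f x)) \<longlonglongrightarrow> 0"

lemma L2_tendstoD:
  assumes "L2_tendsto \<Omega> F f"
  shows "L2 \<Omega> (F n)" "L2 \<Omega> f" "(\<lambda>n. L2_norm_sq \<Omega> (\<lambda>x. F n x - f x)) \<longlonglongrightarrow> 0"
  using assms by (auto simp: L2_tendsto_def)

lemma L2_tendsto_const: "L2 \<Omega> f \<Longrightarrow> L2_tendsto \<Omega> (\<lambda>n. f) f"
  by (simp add: L2_tendsto_def)

lemma L2_tendsto_add:
  assumes F: "L2_tendsto \<Omega> F f" and G: "L2_tendsto \<Omega> G g"
  shows "L2_tendsto \<Omega> (\<lambda>n x. F n x + G n x) (\<lambda>x. f x + g x)"
proof -
  note F = L2_tendstoD[OF F] and G = L2_tendstoD[OF G]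
  have "(\<lambda>n. L2_norm_sq \<Omega> (\<lambda>x. F n x + G n x - (f x + g x))) \<longlonglongrightarrow> 0"
  proof (rule Lim_null_comparison)
    show "(\<lambda>n. 2 * L2_norm_sq \<Omega> (\<lambda>x. F n x - f x) + 2 * L2_norm_sq \<Omega> (\<lambda>x. G n x - g x)) \<longlonglongrightarrow> 0"
      using F(3) G(3) by (intro tendsto_add_zero tendsto_mult_right_zero)
    show "\<forall>\<^sub>F n in sequentially. norm (L2_norm_sq \<Omega> (\<lambda>x. F n x + G n x - (f x + g x)))
        \<le> 2 * L2_norm_sq \<Omega> (\<lambda>x. F n x - f x) + 2 * L2_norm_sq \<Omega> (\<lambda>x. G n x - g x)"
      using L2_norm_sq_add_le[OF L2_diff[OF F(1,2)] L2_diff[OF G(1,2)]]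
      by (simp add: add_diff_add)
  qed
  then show ?thesis using F G by (simp add: L2_tendsto_def L2_add)
qed

lemma L2_tendsto_sum:
  "(\<And>i. i \<in> I \<Longrightarrow> L2_tendsto \<Omega> (F i) (f i)) \<Longrightarrow>
    L2_tendsto \<Omega> (\<lambda>n x. \<Sum>i\<in>I. F i n x) (\<lambda>x. \<Sum>i\<in>I. f i x)"
proof (induction I rule: infinite_finite_induct)
  case (insert i I)
  then show ?case using L2_tendsto_add[of \<Omega> "F i" "f i"] by simp
qed (auto intro!: L2_tendsto_const simp: L2_def)

lemma L2_tendsto_Linf_mult:
  assumes a: "Linf \<Omega> a" and F: "L2_tendsto \<Omega> F f"
  shows "L2_tendsto \<Omega> (\<lambda>n x. a x * F n x) (\<lambda>x. a x * f x)"
proof -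
  note F = L2_tendstoD[OF F]
  obtain C where C: "AE x in lebesgue_on \<Omega>. \<bar>a x\<bar> \<le> C"
    using a by (auto simp: Linf_def)
  have "(\<lambda>n. L2_norm_sq \<Omega> (\<lambda>x. a x * F n x - a x * f x)) \<longlonglongrightarrow> 0"
  proof (rule Lim_null_comparison)
    show "(\<lambda>n. C\<^sup>2 * L2_norm_sq \<Omega> (\<lambda>x. F n x - f x)) \<longlonglongrightarrow> 0"
      using F(3) by (rule tendsto_mult_right_zero)
    show "\<forall>\<^sub>F n in sequentially. norm (L2_norm_sq \<Omega> (\<lambda>x. a x * F n x - a x * f x))
        \<le> C\<^sup>2 * L2_norm_sq \<Omega> (\<lambda>x. F n x - f x)"
      using L2_norm_sq_Linf_mult_le[OF a L2_diff[OF F(1,2)] C] by (simp add: right_diff_distrib)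
  qed
  then show ?thesis using F a by (simp add: L2_tendsto_def L2_Linf_mult)
qed

lemma L2_tendsto_cong_AE:
  assumes F: "L2_tendsto \<Omega> F f" and g: "g \<in> borel_measurable (lebesgue_on \<Omega>)"
    and eq: "AE x in lebesgue_on \<Omega>. g x = f x"
  shows "L2_tendsto \<Omega> F g"
proof -
  note F = L2_tendstoD[OF F]
  have "L2_norm_sq \<Omega> (\<lambda>x. F n x - g x) = L2_norm_sq \<Omega> (\<lambda>x. F n x - f x)" for n
    by (rule L2_cong_AE[OF L2_diff[OF F(1,2)]])
      (use eq L2_measurable[OF F(1)] g in \<open>auto elim!: eventually_mono\<close>)
  then show ?thesis using F L2_cong_AE(1)[OF F(2) g eq] by (simp add: L2_tendsto_def)
qed

lemma L2_inner_tendsto_0: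
  assumes "\<And>n. L2 \<Omega> (F n)" "\<And>n. L2 \<Omega> (G n)"
    and F: "(\<lambda>n. L2_norm_sq \<Omega> (F n)) \<longlonglongrightarrow> 0" and G: "Bseq (\<lambda>n. L2_norm_sq \<Omega> (G n))"
  shows "(\<lambda>n. L2_inner \<Omega> (F n) (G n)) \<longlonglongrightarrow> 0"
proof -
  obtain C where "\<And>n. L2_norm_sq \<Omega> (G n) \<le> C"
    using G by (auto simp: Bseq_def dest: abs_le_D1)
  then have "(L2_inner \<Omega> (F n) (G n))\<^sup>2 \<le> L2_norm_sq \<Omega> (F n) * C" for n
    by (intro order_trans[OF L2_Cauchy_Schwarz[OF assms(1,2)]] mult_left_mono) auto
  then have "(\<lambda>n. (L2_inner \<Omega> (F n) (G n))\<^sup>2) \<longlonglongrightarrow> 0"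
    by (intro Lim_null_comparison[OF _ tendsto_mult_left_zero[OF F, of C]]) simp
  then show ?thesis by simp
qed

lemma L2_tendsto_inner:
  assumes F: "L2_tendsto \<Omega> F f" and G: "L2_tendsto \<Omega> G g"
  shows "(\<lambda>n. L2_inner \<Omega> (F n) (G n)) \<longlonglongrightarrow> L2_inner \<Omega> f g"
proof -
  note F = L2_tendstoD[OF F] and G = L2_tendstoD[OF G]
  have L2_F_diff: "L2 \<Omega> (\<lambda>x. F n x - f x)" and L2_G_diff: "L2 \<Omega> (\<lambda>x. G n x - g x)" for n
    using F G by (auto intro: L2_diff)
  have "(\<lambda>n. L2_inner \<Omega> (\<lambda>x. F n x - f x) (\<lambda>x. G n x - g x)) \<longlonglongrightarrow> 0"
    using G(3) by (intro L2_inner_tendsto_0 F(3) L2_F_diff L2_G_diff convergent_imp_Bseq)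
      (auto simp: convergent_def)
  moreover have "(\<lambda>n. L2_inner \<Omega> (\<lambda>x. F n x - f x) g) \<longlonglongrightarrow> 0"
    by (intro L2_inner_tendsto_0 F(3) L2_F_diff G(2)) auto
  moreover have "(\<lambda>n. L2_inner \<Omega> (\<lambda>x. G n x - g x) f) \<longlonglongrightarrow> 0"
    by (intro L2_inner_tendsto_0 G(3) L2_G_diff F(2)) auto
  ultimately have "(\<lambda>n. L2_inner \<Omega> (\<lambda>x. F n x - f x) (\<lambda>x. G n x - g x)
      + L2_inner \<Omega> (\<lambda>x. F n x - f x) g + L2_inner \<Omega> (\<lambda>x. G n x - g x) f) \<longlonglongrightarrow> 0"
    by (intro tendsto_add_zero)
  moreover have "L2_inner \<Omega> (\<lambda>x. F n x - f x) (\<lambda>x. G n x - g x)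
      + L2_inner \<Omega> (\<lambda>x. F n x - f x) g + L2_inner \<Omega> (\<lambda>x. G n x - g x) f
      = L2_inner \<Omega> (F n) (G n) - L2_inner \<Omega> f g" for n
    using F(1,2) G(1,2) by (simp add: algebra_simps L2_integrable_mult)
  ultimately show ?thesis by (simp add: LIM_zero_iff)
qed

lemma L2_tendsto_inner_const:
  "L2_tendsto \<Omega> F f \<Longrightarrow> L2 \<Omega> g \<Longrightarrow> (\<lambda>n. L2_inner \<Omega> (F n) g) \<longlonglongrightarrow> L2_inner \<Omega> f g"
  by (intro L2_tendsto_inner L2_tendsto_const)

subsection \<open>Completeness\<close>

definition L2_Cauchy :: "(real^'n::finite) set \<Rightarrow> (nat \<Rightarrow> real^'n \<Rightarrow> real) \<Rightarrow> bool" where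
  "L2_Cauchy \<Omega> F \<longleftrightarrow> (\<forall>n. L2 \<Omega> (F n)) \<and>
     (\<forall>e>0. \<exists>N. \<forall>m\<ge>N. \<forall>n\<ge>N. L2_norm_sq \<Omega> (\<lambda>x. F m x - F n x) \<le> e)"

lemma L2_tendsto_imp_Cauchy:
  assumes F: "L2_tendsto \<Omega> F f"
  shows "L2_Cauchy \<Omega> F"
  unfolding L2_Cauchy_def
proof (intro conjI allI impI)
  note F = L2_tendstoD[OF F]
  show "L2 \<Omega> (F n)" for n by (rule F(1))
  fix e :: real assume "0 < e"
  then have "\<forall>\<^sub>F n in sequentially. L2_norm_sq \<Omega> (\<lambda>x. F n x - f x) < e / 4"
    using F(3) by (intro order_tendstoD) auto
  then obtain N where N: "\<And>n. n \<ge> N \<Longrightarrow> L2_norm_sq \<Omega> (\<lambda>x. F n x - f x) < e / 4"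
    by (auto simp: eventually_sequentially)
  have "L2_norm_sq \<Omega> (\<lambda>x. F m x - F n x) \<le> e" if "m \<ge> N" "n \<ge> N" for m n
  proof -
    have "L2_norm_sq \<Omega> (\<lambda>x. (F m x - f x) - (F n x - f x)) \<le>
        2 * L2_norm_sq \<Omega> (\<lambda>x. F m x - f x) + 2 * L2_norm_sq \<Omega> (\<lambda>x. F n x - f x)"
      by (intro L2_norm_sq_diff_le L2_diff F)
    then show ?thesis using N[OF that(1)] N[OF that(2)] by simp
  qed
  then show "\<exists>N. \<forall>m\<ge>N. \<forall>n\<ge>N. L2_norm_sq \<Omega> (\<lambda>x. F m x - F n x) \<le> e" by blast
qed

lemma L2_Cauchy_interpolation:
  assumes A: "L2_Cauchy \<Omega> A" and B: "L2_Cauchy \<Omega> B" and F: "\<And>n. L2 \<Omega> (F n)"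
    and bound: "\<And>m n. L2_norm_sq \<Omega> (\<lambda>x. F m x - F n x) \<le>
      \<bar>L2_inner \<Omega> (\<lambda>x. A m x - A n x) (\<lambda>x. B m x - B n x)\<bar>"
  shows "L2_Cauchy \<Omega> F"
  unfolding L2_Cauchy_def
proof (intro conjI allI impI F)
  fix e :: real assume e: "0 < e"
  obtain M where M: "\<And>m n. m \<ge> M \<Longrightarrow> n \<ge> M \<Longrightarrow> L2_norm_sq \<Omega> (\<lambda>x. A m x - A n x) \<le> e"
    using A e unfolding L2_Cauchy_def by blast
  obtain N where N: "\<And>m n. m \<ge> N \<Longrightarrow> n \<ge> N \<Longrightarrow> L2_norm_sq \<Omega> (\<lambda>x. B m x - B n x) \<le> e"
    using B e unfolding L2_Cauchy_def by blast
  have "L2_norm_sq \<Omega> (\<lambda>x. F m x - F n x) \<le> e" if "m \<ge> max M N" "n \<ge> max M N" for m n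
  proof -
    define I where "I = L2_inner \<Omega> (\<lambda>x. A m x - A n x) (\<lambda>x. B m x - B n x)"
    have "L2 \<Omega> (\<lambda>x. A m x - A n x)" "L2 \<Omega> (\<lambda>x. B m x - B n x)"
      using A B by (auto simp: L2_Cauchy_def intro: L2_diff)
    then have "I\<^sup>2 \<le> L2_norm_sq \<Omega> (\<lambda>x. A m x - A n x) * L2_norm_sq \<Omega> (\<lambda>x. B m x - B n x)"
      unfolding I_def by (rule L2_Cauchy_Schwarz)
    also have "\<dots> \<le> e * e"
      using M[of m n] N[of m n] that e by (intro mult_mono) simp_all
    finally have "\<bar>I\<bar>\<^sup>2 \<le> e\<^sup>2" by (simp add: power2_eq_square)
    then have "\<bar>I\<bar> \<le> e" by (rule power2_le_imp_le) (use e in simp)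
    then show ?thesis using bound[of m n] by (simp add: I_def)
  qed
  then show "\<exists>N. \<forall>m\<ge>N. \<forall>n\<ge>N. L2_norm_sq \<Omega> (\<lambda>x. F m x - F n x) \<le> e" by blast
qed

lemma L2_Cauchy_fast_subseq:
  assumes "L2_Cauchy \<Omega> F"
  obtains r :: "nat \<Rightarrow> nat" where "strict_mono r"
    "\<And>k n. n \<ge> r k \<Longrightarrow> L2_norm_sq \<Omega> (\<lambda>x. F n x - F (r k) x) \<le> (1/4) ^ k"
proof -
  have "\<exists>N. \<forall>m\<ge>N. \<forall>n\<ge>N. L2_norm_sq \<Omega> (\<lambda>x. F m x - F n x) \<le> (1/4) ^ k" for k :: nat
    using assms by (simp add: L2_Cauchy_def)
  then obtain N where N: "\<And>k m n. m \<ge> N k \<Longrightarrow> n \<ge> N k \<Longrightarrow>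
      L2_norm_sq \<Omega> (\<lambda>x. F m x - F n x) \<le> (1/4) ^ k"
    by metis
  define r where "r k = k + sum N {..k}" for k
  have "strict_mono r" by (simp add: strict_mono_Suc_iff r_def)
  moreover have "N k \<le> r k" for k
    by (simp add: r_def trans_le_add2 member_le_sum)
  ultimately show ?thesis by (intro that[of r] N) (auto intro: order_trans)
qed

lemma AE_summable_if_integrals_summable:
  fixes g :: "nat \<Rightarrow> 'a \<Rightarrow> real"
  assumes g: "\<And>k. integrable M (g k)" "\<And>k x. 0 \<le> g k x" and sum: "summable (\<lambda>k. \<integral>x. g k x \<partial>M)"
  shows "AE x in M. summable (\<lambda>k. g k x)"
proof -
  have "(\<integral>\<^sup>+x. (\<Sum>k. ennreal (g k x)) \<partial>M) = (\<Sum>k. \<integral>\<^sup>+x. ennreal (g k x) \<partial>M)"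
    using g by (intro nn_integral_suminf) auto
  also have "\<dots> = (\<Sum>k. ennreal (\<integral>x. g k x \<partial>M))"
    using g by (simp add: nn_integral_eq_integral)
  also have "\<dots> = ennreal (\<Sum>k. \<integral>x. g k x \<partial>M)"
    using g sum by (intro suminf_ennreal2) auto
  finally have "(\<integral>\<^sup>+x. (\<Sum>k. ennreal (g k x)) \<partial>M) \<noteq> \<infinity>" by simp
  then have "AE x in M. (\<Sum>k. ennreal (g k x)) \<noteq> \<infinity>"
    using g by (intro nn_integral_PInf_AE) auto
  then show ?thesis
    by eventually_elim (auto intro: summable_suminf_not_top g)
qed

lemma L2_fast_Cauchy_AE_convergent:
  assumes F: "\<And>k. L2 \<Omega> (F k)"
    and fast: "\<And>k. L2_norm_sq \<Omega> (\<lambda>x. F (Suc k) x - F k x) \<le> (1/4) ^ k"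
  shows "AE x in lebesgue_on \<Omega>. convergent (\<lambda>k. F k x)"
proof -
  define h where "h k x = 2 ^ k * (F (Suc k) x - F k x)\<^sup>2" for k x
  have bound: "(\<integral>x. h k x \<partial>lebesgue_on \<Omega>) \<le> (1/2) ^ k" for k
  proof -
    have "(\<integral>x. h k x \<partial>lebesgue_on \<Omega>) \<le> 2 ^ k * (1/4) ^ k"
      using fast[of k] by (simp add: h_def)
    also have "\<dots> = (1/2) ^ k" by (simp flip: power_mult_distrib)
    finally show ?thesis .
  qed
  have "summable (\<lambda>k. \<integral>x. h k x \<partial>lebesgue_on \<Omega>)"
    by (rule summable_comparison_test[OF _ summable_geometric[of "1/2"]])
      (use bound in \<open>auto simp: h_def\<close>)
  moreover have "integrable (lebesgue_on \<Omega>) (h k)" for k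
    unfolding h_def using F by (intro integrable_mult_right L2_integrable_sq L2_diff)
  moreover have "0 \<le> h k x" for k x by (simp add: h_def)
  ultimately have "AE x in lebesgue_on \<Omega>. summable (\<lambda>k. h k x)"
    by (intro AE_summable_if_integrals_summable)
  then show ?thesis
  proof eventually_elim
    case (elim x)
    have "\<bar>d\<bar> \<le> 2 ^ k * d\<^sup>2 + (1/2) ^ k" for d :: real and k :: nat
    proof -
      have "0 \<le> 2 ^ k * (\<bar>d\<bar> - (1/2) ^ k)\<^sup>2" by simp
      also have "\<dots> = 2 ^ k * d\<^sup>2 - 2 * \<bar>d\<bar> + (1/2) ^ k"
        by (simp add: power2_eq_square field_simps)
      finally show ?thesis using abs_ge_zero[of d] by linarith
    qed
    then have "summable (\<lambda>k. F (Suc k) x - F k x)"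
      by (intro summable_comparison_test'[OF summable_add[OF elim summable_geometric[of "1/2"]]])
        (simp_all add: h_def)
    then have "convergent (\<lambda>n. F n x - F 0 x)"
      by (simp add: summable_iff_convergent sum_lessThan_telescope[of "\<lambda>n. F n x"])
    then show ?case by (simp add: convergent_diff_const_right_iff)
  qed
qed

lemma L2_Fatou:
  assumes F: "\<And>n. L2 \<Omega> (F n)" and f: "f \<in> borel_measurable (lebesgue_on \<Omega>)"
    and lim: "AE x in lebesgue_on \<Omega>. (\<lambda>n. F n x) \<longlonglongrightarrow> f x"
    and C: "\<forall>\<^sub>F n in sequentially. L2_norm_sq \<Omega> (F n) \<le> C"
  shows "L2 \<Omega> f" "L2_norm_sq \<Omega> f \<le> C"
proof -
  obtain n where "L2_norm_sq \<Omega> (F n) \<le> C" using C by (auto simp: eventually_sequentially)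
  then have C_nonneg: "0 \<le> C" by (rule order_trans[rotated]) simp
  have "AE x in lebesgue_on \<Omega>. ennreal ((f x)\<^sup>2) = liminf (\<lambda>n. ennreal ((F n x)\<^sup>2))"
    using lim
  proof eventually_elim
    case (elim x)
    then have "(\<lambda>n. ennreal ((F n x)\<^sup>2)) \<longlonglongrightarrow> ennreal ((f x)\<^sup>2)"
      by (intro tendsto_ennrealI tendsto_intros)
    then show ?case by (rule lim_imp_Liminf[OF trivial_limit_sequentially, symmetric])
  qed
  then have "(\<integral>\<^sup>+x. ennreal ((f x)\<^sup>2) \<partial>lebesgue_on \<Omega>)
      = (\<integral>\<^sup>+x. liminf (\<lambda>n. ennreal ((F n x)\<^sup>2)) \<partial>lebesgue_on \<Omega>)"
    by (rule nn_integral_cong_AE)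
  also have "\<dots> \<le> liminf (\<lambda>n. \<integral>\<^sup>+x. ennreal ((F n x)\<^sup>2) \<partial>lebesgue_on \<Omega>)"
    using L2_measurable[OF F] by (intro nn_integral_liminf) auto
  also have "\<dots> \<le> limsup (\<lambda>n. \<integral>\<^sup>+x. ennreal ((F n x)\<^sup>2) \<partial>lebesgue_on \<Omega>)"
    by (rule Liminf_le_Limsup) simp
  also have "\<dots> \<le> ennreal C"
    using C F by (intro Limsup_bounded)
      (auto simp: nn_integral_eq_integral L2_def elim!: eventually_mono intro: ennreal_leI)
  finally have nn_integral_le: "(\<integral>\<^sup>+x. ennreal ((f x)\<^sup>2) \<partial>lebesgue_on \<Omega>) \<le> ennreal C" .
  then have "integrable (lebesgue_on \<Omega>) (\<lambda>x. (f x)\<^sup>2)"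
    using f by (intro integrableI_nonneg) (auto intro: le_less_trans)
  then show "L2 \<Omega> f" "L2_norm_sq \<Omega> f \<le> C"
    using nn_integral_le f C_nonneg by (auto simp: L2_def nn_integral_eq_integral)
qed

lemma L2_Cauchy_AE_convergent_subseq:
  assumes F: "L2_Cauchy \<Omega> F"
  obtains r :: "nat \<Rightarrow> nat" and f where "strict_mono r" "f \<in> borel_measurable (lebesgue_on \<Omega>)"
    "AE x in lebesgue_on \<Omega>. (\<lambda>k. F (r k) x) \<longlonglongrightarrow> f x"
proof -
  have L2_F: "L2 \<Omega> (F n)" for n using F by (simp add: L2_Cauchy_def)
  obtain r :: "nat \<Rightarrow> nat" where r: "strict_mono r"
    "\<And>k n. n \<ge> r k \<Longrightarrow> L2_norm_sq \<Omega> (\<lambda>x. F n x - F (r k) x) \<le> (1/4) ^ k"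
    using L2_Cauchy_fast_subseq[OF F] by metis
  have "AE x in lebesgue_on \<Omega>. convergent (\<lambda>k. F (r k) x)"
    by (rule L2_fast_Cauchy_AE_convergent[OF L2_F r(2)]) (simp add: r(1) strict_mono_less_eq)
  then have "AE x in lebesgue_on \<Omega>. (\<lambda>k. F (r k) x) \<longlonglongrightarrow> lim (\<lambda>k. F (r k) x)"
    by (simp add: convergent_LIMSEQ_iff)
  moreover have "(\<lambda>x. lim (\<lambda>k. F (r k) x)) \<in> borel_measurable (lebesgue_on \<Omega>)"
    using L2_measurable[OF L2_F] by (intro borel_measurable_lim_metric)
  ultimately show ?thesis using that r(1) by blast
qed

lemma L2_Cauchy_tendsto_if_AE_subseq_tendsto:
  assumes F: "L2_Cauchy \<Omega> F" and r: "strict_mono r" and f: "f \<in> borel_measurable (lebesgue_on \<Omega>)"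
    and lim: "AE x in lebesgue_on \<Omega>. (\<lambda>k. F (r k) x) \<longlonglongrightarrow> f x"
  shows "L2_tendsto \<Omega> F f"
proof -
  have L2_F: "L2 \<Omega> (F n)" for n using F by (simp add: L2_Cauchy_def)
  have tail: "\<exists>N. \<forall>n\<ge>N. L2 \<Omega> (\<lambda>x. F n x - f x) \<and> L2_norm_sq \<Omega> (\<lambda>x. F n x - f x) \<le> e"
    if e: "0 < e" for e
  proof -
    obtain N where N: "\<And>m n. m \<ge> N \<Longrightarrow> n \<ge> N \<Longrightarrow> L2_norm_sq \<Omega> (\<lambda>x. F m x - F n x) \<le> e"
      using F e unfolding L2_Cauchy_def by blast
    have "L2 \<Omega> (\<lambda>x. F n x - f x) \<and> L2_norm_sq \<Omega> (\<lambda>x. F n x - f x) \<le> e" if "n \<ge> N" for n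
    proof -
      have "\<forall>\<^sub>F k in sequentially. L2_norm_sq \<Omega> (\<lambda>x. F n x - F (r k) x) \<le> e"
        using N that by (intro eventually_sequentiallyI[of N])
          (auto intro: order_trans[OF _ seq_suble[OF r]])
      moreover have "AE x in lebesgue_on \<Omega>. (\<lambda>k. F n x - F (r k) x) \<longlonglongrightarrow> F n x - f x"
        using lim by eventually_elim (intro tendsto_intros)
      ultimately show ?thesis
        using L2_Fatou[of \<Omega> "\<lambda>k x. F n x - F (r k) x" "\<lambda>x. F n x - f x" e] f L2_measurable[OF L2_F]
          L2_diff[OF L2_F L2_F] by auto
    qed
    then show ?thesis by blast
  qed
  obtain N where "L2 \<Omega> (\<lambda>x. F N x - f x)" using tail[of 1] by auto
  from L2_diff[OF L2_F[of N] this] have "L2 \<Omega> f" by simp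
  moreover have "(\<lambda>n. L2_norm_sq \<Omega> (\<lambda>x. F n x - f x)) \<longlonglongrightarrow> 0"
  proof (rule LIMSEQ_I)
    fix e :: real assume "0 < e"
    then obtain N where "\<And>n. n \<ge> N \<Longrightarrow> L2_norm_sq \<Omega> (\<lambda>x. F n x - f x) \<le> e / 2"
      using tail[of "e / 2"] by auto
    then show "\<exists>N. \<forall>n\<ge>N. norm (L2_norm_sq \<Omega> (\<lambda>x. F n x - f x) - 0) < e"
      using \<open>0 < e\<close> by (force intro!: exI[of _ N])
  qed
  ultimately show ?thesis using L2_F by (simp add: L2_tendsto_def)
qed

theorem Riesz_Fischer:
  assumes "L2_Cauchy \<Omega> F"
  obtains f where "L2_tendsto \<Omega> F f"
proof -
  obtain r :: "nat \<Rightarrow> nat" and f where "strict_mono r" "f \<in> borel_measurable (lebesgue_on \<Omega>)"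
    "AE x in lebesgue_on \<Omega>. (\<lambda>k. F (r k) x) \<longlonglongrightarrow> f x"
    by (rule L2_Cauchy_AE_convergent_subseq[OF assms])
  then show ?thesis by (rule that[OF L2_Cauchy_tendsto_if_AE_subseq_tendsto[OF assms]])
qed

section \<open>Weak derivatives\<close>

lemma integrable_mult_bounded:
  fixes f g :: "'a \<Rightarrow> real"
  assumes g: "integrable M g" and f: "f \<in> borel_measurable M" "\<And>x. x \<in> space M \<Longrightarrow> \<bar>f x\<bar> \<le> C"
  shows "integrable M (\<lambda>x. g x * f x)"
proof (rule Bochner_Integration.integrable_bound)
  show "integrable M (\<lambda>x. C * g x)" using g by simp
  show "(\<lambda>x. g x * f x) \<in> borel_measurable M" using g f by auto
  have "\<bar>g x\<bar> * \<bar>f x\<bar> \<le> \<bar>C\<bar> * \<bar>g x\<bar>" if "x \<in> space M" for x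
    using f(2)[OF that] by (subst mult.commute) (intro mult_right_mono, auto)
  then show "AE x in M. norm (g x * f x) \<le> norm (C * g x)"
    by (intro AE_I2) (simp add: abs_mult)
qed

lemma integrable_mult_continuous_compact:
  fixes f g :: "real^'n::finite \<Rightarrow> real"
  assumes "integrable (lebesgue_on K) g" "continuous_on K f" "compact K"
  shows "integrable (lebesgue_on K) (\<lambda>x. g x * f x)"
proof -
  have "bounded (f ` K)"
    using assms by (intro compact_imp_bounded compact_continuous_image)
  then obtain C where "\<And>x. x \<in> K \<Longrightarrow> \<bar>f x\<bar> \<le> C"
    unfolding bounded_iff by (metis imageI real_norm_def)
  then show ?thesis
    using assms by (intro integrable_mult_bounded[of _ _ _ C]
        continuous_imp_measurable_on_sets_lebesgue)
      (auto simp: lmeasurable_compact fmeasurableD)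
qed

lemma bounded_convergence_mult:
  fixes F :: "nat \<Rightarrow> 'a \<Rightarrow> real"
  assumes g: "integrable M g"
    and F: "\<And>m. F m \<in> borel_measurable M" "\<And>m x. x \<in> space M \<Longrightarrow> \<bar>F m x\<bar> \<le> C"
    and f: "f \<in> borel_measurable M" "AE x in M. (\<lambda>m. F m x) \<longlonglongrightarrow> f x"
  shows "(\<lambda>m. \<integral>x. g x * F m x \<partial>M) \<longlonglongrightarrow> (\<integral>x. g x * f x \<partial>M)"
proof (rule integral_dominated_convergence)
  show "(\<lambda>x. g x * f x) \<in> borel_measurable M" "(\<lambda>x. g x * F m x) \<in> borel_measurable M" for m
    using g F f by auto
  show "integrable M (\<lambda>x. \<bar>g x\<bar> * C)" using g by simp
  show "AE x in M. (\<lambda>m. g x * F m x) \<longlonglongrightarrow> g x * f x"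
    using f(2) by eventually_elim (intro tendsto_intros)
  show "AE x in M. norm (g x * F m x) \<le> \<bar>g x\<bar> * C" for m
    using F(2) by (intro AE_I2) (simp add: abs_mult mult_left_mono)
qed

lemma integrable_lebesgue_on_iff:
  fixes f :: "real^'n::finite \<Rightarrow> real"
  shows "S \<in> sets lebesgue \<Longrightarrow> integrable (lebesgue_on S) f \<longleftrightarrow> set_integrable lebesgue S f"
  by (simp add: integrable_restrict_space set_integrable_def)

lemma integrable_imp_loc_int:
  assumes \<Omega>: "\<Omega> \<in> sets lebesgue" and v: "integrable (lebesgue_on \<Omega>) v"
  shows "loc_int \<Omega> v"
proof -
  have "integrable (lebesgue_on K) v" if "compact K" "K \<subseteq> interior \<Omega>" for K
  proof -
    have K: "K \<in> sets lebesgue" "K \<subseteq> \<Omega>"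
      using that interior_subset by (auto simp: lmeasurable_compact fmeasurableD)
    then show ?thesis
      using v \<Omega> set_integrable_subset[OF _ K] by (simp add: integrable_lebesgue_on_iff)
  qed
  then show ?thesis using v by (auto simp: loc_int_def)
qed

lemma L2_cube_loc_int: "L2 unit_cube v \<Longrightarrow> loc_int unit_cube v"
  by (intro integrable_imp_loc_int sets_unit_cube L2_cube_integrable)

lemma loc_int_diff: "loc_int \<Omega> u \<Longrightarrow> loc_int \<Omega> v \<Longrightarrow> loc_int \<Omega> (\<lambda>x. u x - v x)"
  by (auto simp: loc_int_def)

lemma loc_int_integrable_mult:
  fixes v \<phi> :: "real^'n::finite \<Rightarrow> real"
  assumes \<Omega>: "\<Omega> \<in> sets lebesgue" and v: "loc_int \<Omega> v"
    and \<phi>: "continuous_on UNIV \<phi>" "compact_support_in \<Omega> \<phi>"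
  shows "integrable (lebesgue_on \<Omega>) (\<lambda>x. v x * \<phi> x)"
proof -
  let ?K = "tsupp \<phi>"
  have K: "compact ?K" "?K \<subseteq> interior \<Omega>" "?K \<in> sets lebesgue"
    using \<phi>(2) by (auto simp: compact_support_in_def lmeasurable_compact fmeasurableD)
  then have "integrable (lebesgue_on ?K) (\<lambda>x. v x * \<phi> x)"
    using v \<phi>(1) by (intro integrable_mult_continuous_compact)
      (auto simp: loc_int_def intro: continuous_on_subset)
  moreover have "(\<lambda>x. indicator ?K x *\<^sub>R (v x * \<phi> x)) = (\<lambda>x. indicator \<Omega> x *\<^sub>R (v x * \<phi> x))"
    using K(2) interior_subset[of \<Omega>] zero_outside_tsupp[of _ \<phi>]
    by (auto simp: fun_eq_iff indicator_def)
  ultimately show ?thesis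
    using K(3) \<Omega> by (simp only: integrable_lebesgue_on_iff set_integrable_def)
qed

lemma test_fun_integrable_mult:
  assumes "\<Omega> \<in> sets lebesgue" "loc_int \<Omega> v" "test_fun \<Omega> \<phi>"
  shows "integrable (lebesgue_on \<Omega>) (\<lambda>x. v x * cD \<alpha> \<phi> x)"
  using assms by (intro loc_int_integrable_mult test_fun_cD)

abbreviation (input) mi_zero :: "'n \<Rightarrow> nat" where
  "mi_zero \<equiv> \<lambda>_. 0"

lemma mi_order_0: "mi_order mi_zero = 0"
  by (simp add: mi_order_def)

lemma cD_0: "cD mi_zero \<phi> = \<phi>"
  by (simp add: cD_def mi_order_0)

lemma weak_deriv_0: "loc_int \<Omega> u \<Longrightarrow> weak_deriv \<Omega> mi_zero u u"
  by (simp add: weak_deriv_def cD_0 mi_order_0)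

lemma weak_deriv_loc_int:
  assumes "weak_deriv \<Omega> \<alpha> u v" shows "loc_int \<Omega> u" "loc_int \<Omega> v"
  using assms by (auto simp: weak_deriv_def)

lemma weak_deriv_measurable:
  assumes "weak_deriv \<Omega> \<alpha> u v" shows "v \<in> borel_measurable (lebesgue_on \<Omega>)"
  using assms by (auto simp: weak_deriv_def loc_int_def)

lemma weak_deriv_testD:
  "weak_deriv \<Omega> \<alpha> u v \<Longrightarrow> test_fun \<Omega> \<phi> \<Longrightarrow>
    L2_inner \<Omega> u (cD \<alpha> \<phi>) = (-1) ^ mi_order \<alpha> * L2_inner \<Omega> v \<phi>"
  by (simp add: weak_deriv_def)

lemma weak_deriv_diff:
  assumes \<Omega>: "\<Omega> \<in> sets lebesgue"
    and u: "weak_deriv \<Omega> \<alpha> u v" and u': "weak_deriv \<Omega> \<alpha> u' v'"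
  shows "weak_deriv \<Omega> \<alpha> (\<lambda>x. u x - u' x) (\<lambda>x. v x - v' x)"
  unfolding weak_deriv_def
proof (intro conjI allI impI loc_int_diff weak_deriv_loc_int[OF u] weak_deriv_loc_int[OF u'])
  fix \<phi> assume \<phi>: "test_fun \<Omega> \<phi>"
  have "integrable (lebesgue_on \<Omega>) (\<lambda>x. w x * \<phi> x)" if "loc_int \<Omega> w" for w
    using test_fun_integrable_mult[OF \<Omega> that \<phi>, of mi_zero] by (simp add: cD_0)
  then show "L2_inner \<Omega> (\<lambda>x. u x - u' x) (cD \<alpha> \<phi>) =
      (-1) ^ mi_order \<alpha> * L2_inner \<Omega> (\<lambda>x. v x - v' x) \<phi>"
    using weak_deriv_testD[OF u \<phi>] weak_deriv_testD[OF u' \<phi>] weak_deriv_loc_int[OF u]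
      weak_deriv_loc_int[OF u'] test_fun_integrable_mult[OF \<Omega> _ \<phi>]
    by (simp add: left_diff_distrib right_diff_distrib)
qed

definition mi_unit :: "'n \<Rightarrow> 'n \<Rightarrow> nat" where
  "mi_unit i = (\<lambda>k. if k = i then 1 else 0)"

definition mi_pair :: "'n \<Rightarrow> 'n \<Rightarrow> 'n \<Rightarrow> nat" where
  "mi_pair i j = (\<lambda>k. mi_unit i k + mi_unit j k)"

lemma mi_pair_same: "mi_pair i i = (\<lambda>k. if k = i then 2 else 0)"
  by (auto simp: mi_pair_def mi_unit_def)

lemma wlap_eq: "wlap \<Omega> u = (\<lambda>x. \<Sum>i\<in>UNIV. wD \<Omega> (mi_pair i i) u x)"
  by (simp add: wlap_def mi_pair_same)

lemma zero_fun_upd_Suc: "mi_zero(i := Suc 0) = mi_unit i"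
  by (auto simp: mi_unit_def)

lemma mi_unit_fun_upd_Suc: "(mi_unit j)(i := Suc (mi_unit j i)) = mi_pair i j"
  by (auto simp: mi_pair_def mi_unit_def)

lemma mi_order_unit: "mi_order (mi_unit i) = 1"
  by (simp add: mi_order_def mi_unit_def)

lemma mi_order_pair: "mi_order (mi_pair i j) = 2"
  using mi_order_unit[of i] mi_order_unit[of j] by (simp add: mi_order_def mi_pair_def sum.distrib)

lemma mi_order_remove:
  assumes "mi_order \<alpha> = Suc n" "0 < \<alpha> i"
  shows "mi_order (\<alpha>(i := \<alpha> i - 1)) = n"
proof -
  have "mi_order \<alpha> = \<alpha> i + (\<Sum>k\<in>UNIV-{i}. \<alpha> k)"
    "mi_order (\<alpha>(i := \<alpha> i - 1)) = (\<alpha> i - 1) + (\<Sum>k\<in>UNIV-{i}. \<alpha> k)"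
    unfolding mi_order_def by (subst sum.remove[of _ i]; simp)+
  then show ?thesis using assms by simp
qed

lemma cD_SucE:
  assumes "mi_order \<beta> = Suc n"
  obtains i where "0 < \<beta> i" "cD \<beta> \<phi> = cpartial (cD (\<beta>(i := \<beta> i - 1)) \<phi>) i"
proof
  let ?i = "SOME i. 0 < \<beta> i"
  have "\<exists>i. 0 < \<beta> i" using assms by (metis mi_order_def gr0I sum.neutral nat.distinct(1))
  then show "0 < \<beta> ?i" by (rule someI_ex)
  from mi_order_remove[OF assms this]
  show "cD \<beta> \<phi> = cpartial (cD (\<beta>(?i := \<beta> ?i - 1)) \<phi>) ?i"
    using assms by (simp add: cD_def Let_def)
qed

lemma cD_unit: "cD (mi_unit i) \<phi> = cpartial \<phi> i"
proof -
  obtain j where j: "0 < mi_unit i j"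
    and cD: "cD (mi_unit i) \<phi> = cpartial (cD ((mi_unit i)(j := mi_unit i j - 1)) \<phi>) j"
    using cD_SucE[of "mi_unit i" 0] by (auto simp: mi_order_unit)
  have "j = i" using j by (simp add: mi_unit_def split: if_splits)
  moreover have "(mi_unit i)(i := mi_unit i i - 1) = (\<lambda>_. 0)" by (auto simp: mi_unit_def)
  ultimately show ?thesis using cD by (simp only: cD_0)
qed

lemma cD_pair_same: "cD (mi_pair i i) \<phi> = cpartial (cpartial \<phi> i) i"
proof -
  obtain j where j: "0 < mi_pair i i j"
    and cD: "cD (mi_pair i i) \<phi> = cpartial (cD ((mi_pair i i)(j := mi_pair i i j - 1)) \<phi>) j"
    using cD_SucE[of "mi_pair i i" 1] by (auto simp: mi_order_pair)
  have "j = i" using j by (simp add: mi_pair_same split: if_splits)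
  moreover have "(mi_pair i i)(i := mi_pair i i i - 1) = mi_unit i"
    by (auto simp: mi_pair_def mi_unit_def)
  ultimately show ?thesis using cD by (simp only: cD_unit)
qed

lemma weak_deriv_unit_testD:
  assumes "weak_deriv \<Omega> (mi_unit i) u v" "smooth \<phi>" "compact_support_in \<Omega> \<phi>"
  shows "L2_inner \<Omega> u (cpartial \<phi> i) = - L2_inner \<Omega> v \<phi>"
  using weak_deriv_testD[OF assms(1) test_funI[OF assms(2,3)]] by (simp add: cD_unit mi_order_unit)

lemma weak_deriv_iterated_testD:
  assumes v: "weak_deriv \<Omega> (mi_unit i) u v" and w: "weak_deriv \<Omega> (mi_pair i i) u w"
    and \<phi>: "smooth \<phi>" "compact_support_in \<Omega> \<phi>"
  shows "L2_inner \<Omega> w \<phi> = - L2_inner \<Omega> v (cpartial \<phi> i)"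
  using weak_deriv_testD[OF w test_funI[OF \<phi>]]
    weak_deriv_unit_testD[OF v smooth_cpartial[OF \<phi>(1)] compact_support_in_cpartial[OF \<phi>(2)]]
  by (simp add: cD_pair_same mi_order_pair)

subsection \<open>Uniqueness and closedness\<close>

lemma bounded_measurable_continuous_approx:
  fixes f :: "real^'n::finite \<Rightarrow> real"
  assumes f: "f \<in> borel_measurable (lebesgue_on \<Omega>)" and \<Omega>: "\<Omega> \<in> sets lebesgue"
    and C: "\<And>x. \<bar>f x\<bar> \<le> C"
  obtains d where "\<And>n. continuous_on UNIV (d n)" "\<And>n x. \<bar>d n x\<bar> \<le> C"
    "AE x in lebesgue_on \<Omega>. (\<lambda>n. d n x) \<longlonglongrightarrow> f x"
proof -
  have "f measurable_on \<Omega>"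
    using f \<Omega> by (simp add: measurable_on_iff_borel_measurable)
  then obtain N c where N: "negligible N" and c: "\<And>n. continuous_on UNIV (c n)"
    and lim: "\<And>x. x \<notin> N \<Longrightarrow> (\<lambda>n. c n x) \<longlonglongrightarrow> (if x \<in> \<Omega> then f x else 0)"
    unfolding measurable_on_def by blast
  define d where "d n x = max (- C) (min C (c n x))" for n x
  have "(\<lambda>n. d n x) \<longlonglongrightarrow> f x" if "x \<notin> N" "x \<in> \<Omega>" for x
  proof -
    have "(\<lambda>n. d n x) \<longlonglongrightarrow> max (- C) (min C (f x))"
      unfolding d_def using lim[OF that(1)] that(2) by (intro tendsto_intros) simp
    moreover have "max (- C) (min C (f x)) = f x" using C[of x] by linarith
    ultimately show ?thesis by simp
  qed
  moreover have "AE x in lebesgue. x \<notin> N"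
    using N by (metis AE_not_in negligible_iff_null_sets)
  ultimately have "AE x in lebesgue_on \<Omega>. (\<lambda>n. d n x) \<longlonglongrightarrow> f x"
    using \<Omega> by (subst AE_restrict_space_iff) (auto elim!: eventually_mono)
  moreover have "continuous_on UNIV (d n)" for n
    unfolding d_def by (intro continuous_intros c)
  moreover have "\<bar>d n x\<bar> \<le> C" for n x using order_trans[OF abs_ge_zero C] by (auto simp: d_def)
  ultimately show ?thesis using that by blast
qed

lemma AE_zero_if_orthogonal_continuous:
  fixes g :: "real^'n::finite \<Rightarrow> real"
  assumes g: "integrable cube_measure g"
    and orth: "\<And>f. continuous_on UNIV f \<Longrightarrow> cube_inner g f = 0"
  shows "AE x in cube_measure. g x = 0"
proof -
  have sgn: "(\<lambda>x. sgn (g x)) \<in> borel_measurable cube_measure" using g by auto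
  obtain d where d: "\<And>n. continuous_on UNIV (d n)" "\<And>n x. \<bar>d n x\<bar> \<le> 1"
    "AE x in cube_measure. (\<lambda>n. d n x) \<longlonglongrightarrow> sgn (g x)"
    by (rule bounded_measurable_continuous_approx[OF sgn sets_unit_cube, of 1])
      (auto simp: abs_sgn_eq)
  have "(\<lambda>n. cube_inner g (d n)) \<longlonglongrightarrow> cube_inner g (\<lambda>x. sgn (g x))"
    by (rule bounded_convergence_mult[OF g _ d(2) sgn d(3)])
      (auto intro!: borel_measurable_cube_continuous continuous_on_subset[OF d(1)])
  then have "(\<integral>x. \<bar>g x\<bar> \<partial>cube_measure) = 0"
    using orth[OF d(1)] by (simp add: LIMSEQ_const_iff abs_sgn)
  then show ?thesis
    using g by (simp add: integral_nonneg_eq_0_iff_AE)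
qed

lemma AE_zero_if_orthogonal_function_ring:
  fixes g :: "real^'n::finite \<Rightarrow> real"
  assumes R: "function_ring_on R unit_cube" and g: "integrable cube_measure g"
    and orth: "\<And>r. r \<in> R \<Longrightarrow> cube_inner g r = 0"
  shows "AE x in cube_measure. g x = 0"
proof (rule AE_zero_if_orthogonal_continuous[OF g])
  interpret function_ring_on R unit_cube by (rule R)
  fix f :: "real^'n \<Rightarrow> real" assume "continuous_on UNIV f"
  then have f: "continuous_on unit_cube f" by (rule continuous_on_subset) simp
  have "\<exists>r\<in>R. \<forall>x\<in>unit_cube. \<bar>f x - r x\<bar> < inverse (real (Suc n))" for n
    by (rule Stone_Weierstrass_basic[OF f]) simp
  then obtain r where r: "\<And>n. r n \<in> R"
    "\<And>n x. x \<in> unit_cube \<Longrightarrow> \<bar>f x - r n x\<bar> < inverse (real (Suc n))"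
    by metis
  obtain C where C: "\<And>x. x \<in> unit_cube \<Longrightarrow> \<bar>f x\<bar> \<le> C"
    using continuous_on_cube_bounded[OF f] by blast
  have "(\<lambda>n. cube_inner g (r n)) \<longlonglongrightarrow> cube_inner g f"
  proof (rule bounded_convergence_mult[OF g])
    fix n and x :: "real^'n" assume "x \<in> space cube_measure"
    then have "\<bar>r n x\<bar> \<le> \<bar>f x\<bar> + inverse (real (Suc n))" "\<bar>f x\<bar> \<le> C"
      using r(2)[of x n] C[of x] by auto
    moreover have "inverse (real (Suc n)) \<le> 1" by (simp add: field_simps)
    ultimately show "\<bar>r n x\<bar> \<le> C + 1" by linarith
  next
    show "AE x in cube_measure. (\<lambda>n. r n x) \<longlonglongrightarrow> f x"
    proof (rule AE_I2)
      fix x :: "real^'n" assume "x \<in> space cube_measure"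
      then have "(\<lambda>n. r n x - f x) \<longlonglongrightarrow> 0"
        using r(2)[of x] by (intro Lim_null_comparison[OF _ LIMSEQ_inverse_real_of_nat])
          (auto simp: abs_minus_commute less_imp_le)
      then show "(\<lambda>n. r n x) \<longlonglongrightarrow> f x" by (rule LIM_zero_cancel)
    qed
  qed (auto intro: borel_measurable_cube_continuous f continuous r(1))
  then show "cube_inner g f = 0"
    using orth[OF r(1)] by (simp add: LIMSEQ_const_iff)
qed

lemma function_ring_on_smooth: "function_ring_on (Collect smooth) unit_cube"
proof
  show "\<exists>f\<in>Collect smooth. f x \<noteq> f y" if neq: "x \<noteq> y" for x y :: "real^'n::finite"
  proof -
    obtain i where "x $ i \<noteq> y $ i" using neq by (auto simp: vec_eq_iff)
    then show ?thesis by (intro bexI[of _ "\<lambda>x. x $ i"]) (auto intro: smooth_coordinate)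
  qed
qed (auto intro: smooth_continuous smooth_add smooth_mult smooth_const compact_unit_cube)

lemma AE_zero_if_orthogonal_test_functions:
  fixes v :: "real^'n::finite \<Rightarrow> real"
  assumes v: "loc_int unit_cube v"
    and orth: "\<And>\<phi>. smooth \<phi> \<Longrightarrow> compact_support_in unit_cube \<phi> \<Longrightarrow> cube_inner v \<phi> = 0"
  shows "AE x in cube_measure. v x = 0"
proof -
  have "AE x in cube_measure. v x * cube_cutoff m x = 0" for m
  proof (rule AE_zero_if_orthogonal_function_ring[OF function_ring_on_smooth])
    show "integrable cube_measure (\<lambda>x. v x * cube_cutoff m x)"
      by (intro loc_int_integrable_mult sets_unit_cube v smooth_continuous smooth_cube_cutoff
          compact_support_in_cube_cutoff)
    show "cube_inner (\<lambda>x. v x * cube_cutoff m x) p = 0" if "p \<in> Collect smooth" for p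
      using orth[of "\<lambda>x. p x * cube_cutoff m x"] that
      by (simp add: smooth_mult smooth_cube_cutoff compact_support_in_mult_right
          compact_support_in_cube_cutoff mult_ac)
  qed
  then have "AE x in cube_measure. \<forall>m. v x * cube_cutoff m x = 0"
    by (subst AE_all_countable) blast
  then show ?thesis using AE_cube_interior
  proof eventually_elim
    case (elim x)
    have "(\<lambda>m. v x * cube_cutoff m x) \<longlonglongrightarrow> v x * 1"
      by (intro tendsto_intros cube_cutoff_tendsto_1 elim)
    then show ?case using elim(1) by (simp add: LIMSEQ_const_iff)
  qed
qed

lemma weak_deriv_unique:
  assumes "weak_deriv unit_cube \<alpha> u v" "weak_deriv unit_cube \<alpha> u v'"
  shows "AE x in cube_measure. v x = v' x"
proof -
  note diff = weak_deriv_diff[OF sets_unit_cube assms]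
  have "AE x in cube_measure. v x - v' x = 0"
    using weak_deriv_testD[OF diff test_funI]
    by (intro AE_zero_if_orthogonal_test_functions weak_deriv_loc_int[OF diff]) auto
  then show ?thesis by simp
qed

lemma weak_deriv_closed:
  fixes u v :: "real^'n::finite \<Rightarrow> real"
  assumes U: "\<And>n. weak_deriv unit_cube \<alpha> (U n) (V n)" "L2_tendsto unit_cube U u"
    and V: "L2_Cauchy unit_cube V" and v: "weak_deriv unit_cube \<alpha> u v"
  shows "L2_tendsto unit_cube V v"
proof -
  obtain f where f: "L2_tendsto unit_cube V f" using Riesz_Fischer[OF V] by blast
  have "weak_deriv unit_cube \<alpha> u f"
    unfolding weak_deriv_def
  proof (intro conjI allI impI L2_cube_loc_int L2_tendstoD[OF f] L2_tendstoD[OF U(2)])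
    fix \<phi> :: "real^'n \<Rightarrow> real" assume \<phi>: "test_fun unit_cube \<phi>"
    have "L2 unit_cube (cD \<beta> \<phi>)" for \<beta> by (intro L2_cube_continuous test_fun_cD[OF \<phi>])
    from this[of \<alpha>] this[of mi_zero] have L2_\<phi>: "L2 unit_cube (cD \<alpha> \<phi>)" "L2 unit_cube \<phi>"
      by (simp_all add: cD_0)
    have "(\<lambda>n. cube_inner (U n) (cD \<alpha> \<phi>)) \<longlonglongrightarrow> cube_inner u (cD \<alpha> \<phi>)"
      by (rule L2_tendsto_inner_const[OF U(2) L2_\<phi>(1)])
    moreover have "(\<lambda>n. cube_inner (U n) (cD \<alpha> \<phi>)) \<longlonglongrightarrow> (-1) ^ mi_order \<alpha> * cube_inner f \<phi>"
      unfolding weak_deriv_testD[OF U(1) \<phi>]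
      by (intro tendsto_mult_left L2_tendsto_inner_const[OF f L2_\<phi>(2)])
    ultimately show "cube_inner u (cD \<alpha> \<phi>) = (-1) ^ mi_order \<alpha> * cube_inner f \<phi>"
      by (rule LIMSEQ_unique)
  qed
  from weak_deriv_unique[OF v this] show ?thesis
    by (rule L2_tendsto_cong_AE[OF f weak_deriv_measurable[OF v]])
qed

lemma weak_deriv_wD: "weak_deriv \<Omega> \<alpha> u v \<Longrightarrow> weak_deriv \<Omega> \<alpha> u (wD \<Omega> \<alpha> u)"
  unfolding wD_def by (rule someI[of "weak_deriv \<Omega> \<alpha> u"])

lemma wD_AE_eq:
  "weak_deriv unit_cube \<alpha> u v \<Longrightarrow> AE x in cube_measure. wD unit_cube \<alpha> u x = v x"
  by (metis weak_deriv_unique weak_deriv_wD)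

lemma L2_wD:
  assumes "weak_deriv unit_cube \<alpha> u v" "L2 unit_cube v"
  shows "L2 unit_cube (wD unit_cube \<alpha> u)"
    "L2_norm_sq unit_cube (wD unit_cube \<alpha> u) = L2_norm_sq unit_cube v"
  using L2_cong_AE[OF assms(2) weak_deriv_measurable[OF weak_deriv_wD[OF assms(1)]]
      wD_AE_eq[OF assms(1)]] by auto

lemma Hk_wD:
  assumes "Hk k unit_cube u" "mi_order \<alpha> \<le> k"
  shows "weak_deriv unit_cube \<alpha> u (wD unit_cube \<alpha> u)" "L2 unit_cube (wD unit_cube \<alpha> u)"
  using assms weak_deriv_wD L2_wD unfolding Hk_def by blast+

lemma wD_diff_AE:
  assumes "Hk k unit_cube u" "Hk k unit_cube v" "mi_order \<alpha> \<le> k"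
  shows "AE x in cube_measure.
    wD unit_cube \<alpha> (\<lambda>x. u x - v x) x = wD unit_cube \<alpha> u x - wD unit_cube \<alpha> v x"
  using assms by (intro wD_AE_eq weak_deriv_diff sets_unit_cube Hk_wD)

lemma Hk_diff:
  assumes "Hk k unit_cube u" "Hk k unit_cube v"
  shows "Hk k unit_cube (\<lambda>x. u x - v x)"
  unfolding Hk_def
proof (intro conjI allI impI)
  show "L2 unit_cube (\<lambda>x. u x - v x)" using assms by (auto simp: Hk_def intro: L2_diff)
  show "\<exists>w. weak_deriv unit_cube \<alpha> (\<lambda>x. u x - v x) w \<and> L2 unit_cube w" if "mi_order \<alpha> \<le> k" for \<alpha>
    using weak_deriv_diff[OF sets_unit_cube Hk_wD(1)[OF assms(1) that] Hk_wD(1)[OF assms(2) that]]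
      L2_diff[OF Hk_wD(2)[OF assms(1) that] Hk_wD(2)[OF assms(2) that]] by blast
qed

subsection \<open>Test functions that only vanish on the boundary\<close>

lemma frontier_unit_cube:
  "x \<in> frontier unit_cube \<longleftrightarrow> x \<in> unit_cube \<and> (\<exists>i. x $ i = 0 \<or> x $ i = 1)"
proof -
  have "frontier unit_cube = unit_cube - interior unit_cube"
    by (simp add: frontier_def unit_cube_def)
  then show ?thesis by (auto simp: interior_unit_cube mem_unit_cube order_less_le)
qed

lemma abs_le_mult_distance_to_faces:
  fixes \<phi> :: "real^'n::finite \<Rightarrow> real"
  assumes \<phi>: "C1_along i \<phi>" and M: "\<And>x. x \<in> unit_cube \<Longrightarrow> \<bar>cpartial \<phi> i x\<bar> \<le> M"
    and faces: "\<And>x. x \<in> unit_cube \<Longrightarrow> x $ i = 0 \<or> x $ i = 1 \<Longrightarrow> \<phi> x = 0"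
    and x: "x \<in> unit_cube"
  shows "\<bar>\<phi> x\<bar> \<le> 2 * M * (x $ i * (1 - x $ i))"
proof -
  define t where "t = x $ i"
  have t: "0 \<le> t" "t \<le> 1" using x by (auto simp: t_def mem_unit_cube)
  have line: "x + s *\<^sub>R axis i 1 \<in> unit_cube" if "s \<in> {-t..1-t}" for s
    using x that by (auto simp: mem_unit_cube axis_def t_def)
  have "\<bar>\<phi> (x + s *\<^sub>R axis i 1) - \<phi> (x + 0 *\<^sub>R axis i 1)\<bar> \<le> M * \<bar>s - 0\<bar>"
    if "s \<in> {-t..1-t}" for s
    unfolding real_norm_def[symmetric]
  proof (rule field_differentiable_bound[of "{-t..1-t}" "\<lambda>s. \<phi> (x + s *\<^sub>R axis i 1)"])
    show "((\<lambda>s. \<phi> (x + s *\<^sub>R axis i 1)) has_field_derivative cpartial \<phi> i (x + s *\<^sub>R axis i 1))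
        (at s within {-t..1-t})" for s
      using \<phi> by (intro has_real_derivative_along_axis has_field_derivative_at_within)
        (simp add: C1_along_def)
  qed (use that t line M in auto)
  from this[of "-t"] this[of "1-t"] have "\<bar>\<phi> x\<bar> \<le> M * t" "\<bar>\<phi> x\<bar> \<le> M * (1 - t)"
    using t faces[OF line[of "-t"]] faces[OF line[of "1-t"]] by (auto simp: t_def axis_def)
  moreover have "M * t * 1 \<le> M * t * (2 * (1 - t))" if "t \<le> 1/2"
    using that t order_trans[OF abs_ge_zero M[OF x]] by (intro mult_left_mono) auto
  moreover have "M * (1 - t) * 1 \<le> M * (1 - t) * (2 * t)" if "\<not> t \<le> 1/2"
    using that t order_trans[OF abs_ge_zero M[OF x]] by (intro mult_left_mono) auto
  ultimately have "\<bar>\<phi> x\<bar> \<le> 2 * M * (t * (1 - t))"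
    by (cases "t \<le> 1/2") (auto simp: mult_ac)
  then show ?thesis by (simp add: t_def)
qed

lemma cpartial_cutoff_mult:
  assumes "smooth \<phi>"
  shows "cpartial (\<lambda>x. \<phi> x * cube_cutoff m x) i =
    (\<lambda>x. cpartial \<phi> i x * cube_cutoff m x + \<phi> x * cpartial (cube_cutoff m) i x)"
  by (intro cpartial_mult smooth_differentiable smooth_cube_cutoff assms)

lemma cpartial_cutoff_mult_bounded:
  fixes \<phi> :: "real^'n::finite \<Rightarrow> real"
  assumes \<phi>: "smooth \<phi>" and zero: "\<And>x. x \<in> frontier unit_cube \<Longrightarrow> \<phi> x = 0"
  obtains C where
    "\<And>m x. x \<in> unit_cube \<Longrightarrow> \<bar>cpartial (\<lambda>x. \<phi> x * cube_cutoff m x) i x\<bar> \<le> C"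
proof -
  obtain M where M: "\<And>x. x \<in> unit_cube \<Longrightarrow> \<bar>cpartial \<phi> i x\<bar> \<le> M"
    using continuous_on_cube_bounded[OF smooth_continuous[OF smooth_cpartial[OF \<phi>]]] by blast
  have "\<bar>cpartial (\<lambda>x. \<phi> x * cube_cutoff m x) i x\<bar> \<le> M + 2 * M * 3" if x: "x \<in> unit_cube" for m x
  proof -
    have M_nonneg: "0 \<le> M" using order_trans[OF abs_ge_zero M[OF x]] .
    have "\<bar>cpartial \<phi> i x * cube_cutoff m x\<bar> \<le> M * 1"
      unfolding abs_mult using M[OF x] M_nonneg cube_cutoff_bounds[of m x] by (intro mult_mono) auto
    moreover have "\<bar>\<phi> x * cpartial (cube_cutoff m) i x\<bar> \<le> 2 * M * 3"
    proof -
      have "\<bar>\<phi> x\<bar> \<le> 2 * M * (x $ i * (1 - x $ i))"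
        using \<phi> M x zero
        by (intro abs_le_mult_distance_to_faces smooth_C1_along) (auto simp: frontier_unit_cube)
      then have "\<bar>\<phi> x * cpartial (cube_cutoff m) i x\<bar> \<le>
          2 * M * (x $ i * (1 - x $ i)) * \<bar>cpartial (cube_cutoff m) i x\<bar>"
        unfolding abs_mult by (rule mult_right_mono) simp
      also have "\<dots> = 2 * M * (x $ i * (1 - x $ i) * \<bar>cpartial (cube_cutoff m) i x\<bar>)"
        by simp
      also have "\<dots> \<le> 2 * M * 3"
        using M_nonneg cpartial_cube_cutoff_bound[OF x] by (intro mult_left_mono) auto
      finally show ?thesis .
    qed
    ultimately show ?thesis unfolding cpartial_cutoff_mult[OF \<phi>] by linarith
  qed
  then show ?thesis using that by blast
qed

lemma inner_cutoff_mult_tendsto: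
  fixes \<phi> :: "real^'n::finite \<Rightarrow> real"
  assumes g: "integrable cube_measure g" and \<phi>: "smooth \<phi>"
  shows "(\<lambda>m. cube_inner g (\<lambda>x. \<phi> x * cube_cutoff m x)) \<longlonglongrightarrow> cube_inner g \<phi>"
proof -
  have cont: "continuous_on unit_cube \<phi>" by (rule smooth_continuous[OF \<phi>])
  obtain M where M: "0 \<le> M" "\<And>x. x \<in> unit_cube \<Longrightarrow> \<bar>\<phi> x\<bar> \<le> M"
    using continuous_on_cube_bounded[OF cont] by blast
  show ?thesis
  proof (rule bounded_convergence_mult[OF g])
    show "\<bar>\<phi> x * cube_cutoff m x\<bar> \<le> M * 1" if "x \<in> space cube_measure" for m x
      unfolding abs_mult using that M cube_cutoff_bounds[of m x] by (intro mult_mono) auto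
    show "AE x in cube_measure. (\<lambda>m. \<phi> x * cube_cutoff m x) \<longlonglongrightarrow> \<phi> x"
      using AE_cube_interior
    proof eventually_elim
      case (elim x)
      have "(\<lambda>m. \<phi> x * cube_cutoff m x) \<longlonglongrightarrow> \<phi> x * 1"
        by (intro tendsto_intros cube_cutoff_tendsto_1 elim)
      then show ?case by simp
    qed
  qed (intro borel_measurable_cube_continuous continuous_intros cont
      smooth_continuous smooth_cube_cutoff)+
qed

lemma inner_cpartial_cutoff_mult_tendsto:
  fixes \<phi> :: "real^'n::finite \<Rightarrow> real"
  assumes v: "integrable cube_measure v" and \<phi>: "smooth \<phi>"
    and zero: "\<And>x. x \<in> frontier unit_cube \<Longrightarrow> \<phi> x = 0"
  shows "(\<lambda>m. cube_inner v (cpartial (\<lambda>x. \<phi> x * cube_cutoff m x) i)) \<longlonglongrightarrow> cube_inner v (cpartial \<phi> i)"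
proof -
  obtain C where C:
    "\<And>m x. x \<in> unit_cube \<Longrightarrow> \<bar>cpartial (\<lambda>x. \<phi> x * cube_cutoff m x) i x\<bar> \<le> C"
    using cpartial_cutoff_mult_bounded[OF \<phi> zero] by metis
  show ?thesis
  proof (rule bounded_convergence_mult[OF v])
    show "\<bar>cpartial (\<lambda>x. \<phi> x * cube_cutoff m x) i x\<bar> \<le> C" if "x \<in> space cube_measure" for m x
      using that C by simp
    show "AE x in cube_measure.
        (\<lambda>m. cpartial (\<lambda>x. \<phi> x * cube_cutoff m x) i x) \<longlonglongrightarrow> cpartial \<phi> i x"
      using AE_cube_interior
    proof eventually_elim
      case (elim x)
      have "(\<lambda>m. cpartial \<phi> i x * cube_cutoff m x + \<phi> x * cpartial (cube_cutoff m) i x)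
          \<longlonglongrightarrow> cpartial \<phi> i x * 1 + \<phi> x * 0"
        by (intro tendsto_intros cube_cutoff_tendsto_1 cpartial_cube_cutoff_tendsto_0 elim)
      then show ?case by (simp add: cpartial_cutoff_mult[OF \<phi>])
    qed
  qed (intro borel_measurable_cube_continuous smooth_continuous smooth_cpartial smooth_mult
      smooth_cube_cutoff \<phi>)+
qed

lemma weak_divergence_vanishing_boundary:
  fixes v :: "'n::finite \<Rightarrow> real^'n \<Rightarrow> real"
  assumes v: "\<And>i. i \<in> I \<Longrightarrow> integrable cube_measure (v i)" and g: "integrable cube_measure g"
    and weak: "\<And>\<psi>. smooth \<psi> \<Longrightarrow> compact_support_in unit_cube \<psi> \<Longrightarrow>
      cube_inner g \<psi> = - (\<Sum>i\<in>I. cube_inner (v i) (cpartial \<psi> i))"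
    and \<phi>: "smooth \<phi>" and zero: "\<And>x. x \<in> frontier unit_cube \<Longrightarrow> \<phi> x = 0"
  shows "cube_inner g \<phi> = - (\<Sum>i\<in>I. cube_inner (v i) (cpartial \<phi> i))"
proof (rule LIMSEQ_unique[OF inner_cutoff_mult_tendsto[OF g \<phi>]])
  have "cube_inner g (\<lambda>x. \<phi> x * cube_cutoff m x) =
      - (\<Sum>i\<in>I. cube_inner (v i) (cpartial (\<lambda>x. \<phi> x * cube_cutoff m x) i))" for m
    by (intro weak smooth_mult \<phi> smooth_cube_cutoff compact_support_in_mult_right
        compact_support_in_cube_cutoff)
  then show "(\<lambda>m. cube_inner g (\<lambda>x. \<phi> x * cube_cutoff m x)) \<longlonglongrightarrow>
      - (\<Sum>i\<in>I. cube_inner (v i) (cpartial \<phi> i))"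
    by (simp only:) (intro tendsto_minus tendsto_sum inner_cpartial_cutoff_mult_tendsto v \<phi> zero)
qed

lemma weak_partial_vanishing_boundary:
  fixes v g :: "real^'n::finite \<Rightarrow> real"
  assumes "integrable cube_measure v" "integrable cube_measure g"
    and "\<And>\<psi>. smooth \<psi> \<Longrightarrow> compact_support_in unit_cube \<psi> \<Longrightarrow>
      cube_inner g \<psi> = - cube_inner v (cpartial \<psi> i)"
    and "smooth \<phi>" "\<And>x. x \<in> frontier unit_cube \<Longrightarrow> \<phi> x = 0"
  shows "cube_inner g \<phi> = - cube_inner v (cpartial \<phi> i)"
  using weak_divergence_vanishing_boundary[of "{i}" "\<lambda>_. v" g \<phi>] assms by simp

section \<open>Sine polynomials\<close>

text \<open>
  \<open>sin_deriv a j\<close> is the \<open>j\<close>-th derivative of \<open>sin (a * pi * t)\<close>, so \<open>sine k \<alpha>\<close> is the derivative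
  of order \<open>\<alpha>\<close> of the product of the functions \<open>sin (k i * pi * x $ i)\<close>.
\<close>

definition sin_deriv :: "nat \<Rightarrow> nat \<Rightarrow> real \<Rightarrow> real" where
  "sin_deriv a j t = (real a * pi) ^ j * sin (real a * pi * t + real j * (pi / 2))"

definition sine :: "('n \<Rightarrow> nat) \<Rightarrow> ('n \<Rightarrow> nat) \<Rightarrow> real^'n::finite \<Rightarrow> real" where
  "sine k \<alpha> = tensor (\<lambda>i. sin_deriv (k i) (\<alpha> i))"

definition sine_poly ::
  "('n \<Rightarrow> nat) set \<Rightarrow> (('n \<Rightarrow> nat) \<Rightarrow> real) \<Rightarrow> ('n \<Rightarrow> nat) \<Rightarrow> real^'n::finite \<Rightarrow> real" where
  "sine_poly K c \<alpha> x = (\<Sum>k\<in>K. c k * sine k \<alpha> x)"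

lemma sin_deriv_has_real_derivative:
  "(sin_deriv a j has_real_derivative sin_deriv a (Suc j) t) (at t)"
proof -
  have "sin (real a * pi * t + real (Suc j) * (pi / 2)) = cos (real a * pi * t + real j * (pi / 2))"
    using sin_add[of "real a * pi * t + real j * (pi / 2)" "pi / 2"]
    by (simp add: algebra_simps add_divide_distrib)
  then show ?thesis
    unfolding sin_deriv_def by (auto intro!: derivative_eq_intros)
qed

lemma sin_deriv_2: "sin_deriv a 2 t = - (real a * pi)\<^sup>2 * sin_deriv a 0 t"
  by (simp add: sin_deriv_def)

lemma sin_deriv_even_at_endpoints:
  assumes "even j" shows "sin_deriv a j 0 = 0" "sin_deriv a j 1 = 0"
proof -
  obtain l where "j = 2 * l" using assms by blast
  then have "real a * pi + real j * (pi / 2) = real (a + l) * pi" "real j * (pi / 2) = real l * pi"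
    by (simp_all add: algebra_simps)
  then show "sin_deriv a j 0 = 0" "sin_deriv a j 1 = 0"
    by (simp_all add: sin_deriv_def del: of_nat_add)
qed

lemma smooth_sine: "smooth (sine k \<alpha>)"
  unfolding sine_def tensor_def[abs_def] sin_deriv_def
  by (intro smooth_prod smooth_mult smooth_const smooth_sin smooth_coordinate)

lemma sine_pure_second: "sine k (mi_pair i i) x = - (real (k i) * pi)\<^sup>2 * sine k mi_zero x"
  unfolding sine_def tensor_remove[of _ x i] by (simp add: mi_pair_same sin_deriv_2)

lemma sine_zero_on_faces:
  assumes "even (\<alpha> i)" "x $ i = 0 \<or> x $ i = 1" shows "sine k \<alpha> x = 0"
  unfolding sine_def tensor_remove[of _ x i] using assms sin_deriv_even_at_endpoints by auto

lemma cpartial_sine: "cpartial (sine k \<alpha>) i = sine k (\<alpha>(i := Suc (\<alpha> i)))"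
  unfolding sine_def cpartial_tensor[OF sin_deriv_has_real_derivative]
  by (rule arg_cong[of _ _ tensor]) auto

lemma cpartial_linear_combination:
  assumes "\<And>k. k \<in> K \<Longrightarrow> smooth (f k)"
  shows "cpartial (\<lambda>x. \<Sum>k\<in>K. c k * f k x) i = (\<lambda>x. \<Sum>k\<in>K. c k * cpartial (f k) i x)"
  using assms
proof (induction K rule: infinite_finite_induct)
  case (insert k K)
  have "smooth (\<lambda>x. c k * f k x)" "smooth (\<lambda>x. \<Sum>k\<in>K. c k * f k x)"
    using insert.prems by (auto intro!: smooth_sum smooth_mult smooth_const)
  from cpartial_add[OF this[THEN smooth_differentiable]] show ?case
    using insert by (simp add: cpartial_cmult smooth_differentiable)
qed (simp_all add: cpartial_const)

lemma smooth_sine_poly: "smooth (sine_poly K c \<alpha>)"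
  unfolding sine_poly_def[abs_def] by (intro smooth_sum smooth_mult smooth_const smooth_sine)

lemma L2_sine: "L2 unit_cube (sine k \<alpha>)"
  by (intro L2_cube_smooth smooth_sine)

lemma L2_sine_poly: "L2 unit_cube (sine_poly K c \<alpha>)"
  by (intro L2_cube_smooth smooth_sine_poly)

lemma cpartial_sine_poly: "cpartial (sine_poly K c \<alpha>) i = sine_poly K c (\<alpha>(i := Suc (\<alpha> i)))"
  unfolding sine_poly_def[abs_def]
  by (simp add: cpartial_linear_combination smooth_sine cpartial_sine)

lemma sine_poly_singleton: "sine_poly {k} (\<lambda>_. 1) \<alpha> = sine k \<alpha>"
  by (simp add: sine_poly_def[abs_def])

lemma sine_poly_zero_on_faces:
  "even (\<alpha> i) \<Longrightarrow> x $ i = 0 \<or> x $ i = 1 \<Longrightarrow> sine_poly K c \<alpha> x = 0"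
  by (simp add: sine_poly_def sine_zero_on_faces)

lemma sine_poly_zero_on_frontier:
  "x \<in> frontier unit_cube \<Longrightarrow> sine_poly K c mi_zero x = 0"
  using sine_poly_zero_on_faces by (fastforce simp: frontier_unit_cube)

lemma sine_poly_extend:
  "K \<subseteq> L \<Longrightarrow> finite L \<Longrightarrow> sine_poly K c \<alpha> = sine_poly L (\<lambda>k. if k \<in> K then c k else 0) \<alpha>"
  by (auto simp: sine_poly_def fun_eq_iff intro!: sum.mono_neutral_cong_left)

lemma sine_poly_diff:
  "sine_poly K c \<alpha> x - sine_poly K d \<alpha> x = sine_poly K (\<lambda>k. c k - d k) \<alpha> x"
  by (simp add: sine_poly_def sum_subtractf left_diff_distrib)

lemma inner_sine_poly:
  assumes "L2 unit_cube g"
  shows "cube_inner g (sine_poly K c \<alpha>) = (\<Sum>k\<in>K. c k * cube_inner g (sine k \<alpha>))"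
proof -
  have "cube_inner (sine_poly K c \<alpha>) g = (\<Sum>k\<in>K. cube_inner (\<lambda>x. c k * sine k \<alpha> x) g)"
    unfolding sine_poly_def by (intro L2_inner_sum_left L2_cmult L2_sine assms)
  then show ?thesis
    by (simp only: mult.commute[of "g _"] mult.assoc integral_mult_right_zero)
qed

lemma sine_poly_by_parts:
  assumes "even (\<alpha> i) \<or> even (\<beta> i)"
  shows "cube_inner (sine_poly K c (\<alpha>(i := Suc (\<alpha> i)))) (sine_poly L d \<beta>) =
    - cube_inner (sine_poly K c \<alpha>) (sine_poly L d (\<beta>(i := Suc (\<beta> i))))"
proof -
  have "cube_inner (sine_poly K c \<alpha>) (cpartial (sine_poly L d \<beta>) i) =
      - cube_inner (cpartial (sine_poly K c \<alpha>) i) (sine_poly L d \<beta>)"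
    by (intro cube_integration_by_parts smooth_C1_along smooth_sine_poly)
      (use assms in \<open>auto simp: sine_poly_zero_on_faces\<close>)
  then show ?thesis by (simp add: cpartial_sine_poly)
qed

lemma sine_poly_gradient_inner:
  "cube_inner (sine_poly K c (mi_unit i)) (sine_poly L d (mi_unit i)) =
    - cube_inner (sine_poly K c mi_zero) (sine_poly L d (mi_pair i i))"
  using sine_poly_by_parts[of mi_zero i "mi_unit i" K c L d]
  by (simp only: mi_unit_fun_upd_Suc zero_fun_upd_Suc even_zero simp_thms)

lemma sine_poly_hessian_inner:
  "cube_inner (sine_poly K c (mi_pair i j)) (sine_poly L d (mi_pair i j)) =
    cube_inner (sine_poly K c (mi_pair i i)) (sine_poly L d (mi_pair j j))"
proof (cases "i = j")
  case False
  then have even: "even (mi_unit j i)" "even (mi_pair i i j)"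
    and comm: "(mi_pair i j)(i := Suc (mi_pair i j i)) = (mi_pair i i)(j := Suc (mi_pair i i j))"
    by (auto simp: mi_unit_def mi_pair_def)
  have "cube_inner (sine_poly K c (mi_pair i j)) (sine_poly L d (mi_pair i j)) =
      - cube_inner (sine_poly K c ((mi_pair i j)(i := Suc (mi_pair i j i))))
        (sine_poly L d (mi_unit j))"
    using sine_poly_by_parts[of "mi_pair i j" i "mi_unit j" K c L d] even(1)
    by (simp only: mi_unit_fun_upd_Suc simp_thms minus_minus)
  also have "\<dots> = cube_inner (sine_poly K c (mi_pair i i)) (sine_poly L d (mi_pair j j))"
    using sine_poly_by_parts[of "mi_pair i i" j "mi_unit j" K c L d] even(2)
    by (simp only: comm mi_unit_fun_upd_Suc simp_thms minus_minus)
  finally show ?thesis .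
qed simp

lemma sine_orthogonal:
  assumes "k \<noteq> l"
  shows "cube_inner (sine k mi_zero) (sine l mi_zero) = 0"
proof -
  obtain i where i: "k i \<noteq> l i" using assms by auto
  have second: "cube_inner (sine p mi_zero) (sine q (mi_pair i i)) =
      - (real (q i) * pi)\<^sup>2 * cube_inner (sine p mi_zero) (sine q mi_zero)" for p q :: "'a \<Rightarrow> nat"
    unfolding sine_pure_second by (subst integral_mult_right_zero[symmetric]) (simp add: mult_ac)
  have "cube_inner (sine k (mi_unit i)) (sine l (mi_unit i)) =
      - cube_inner (sine k mi_zero) (sine l (mi_pair i i))"
    "cube_inner (sine l (mi_unit i)) (sine k (mi_unit i)) =
      - cube_inner (sine l mi_zero) (sine k (mi_pair i i))"
    using sine_poly_gradient_inner[of "{k}" "\<lambda>_. 1" i "{l}" "\<lambda>_. 1"]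
      sine_poly_gradient_inner[of "{l}" "\<lambda>_. 1" i "{k}" "\<lambda>_. 1"]
    by (simp_all only: sine_poly_singleton)
  then have "(real (l i) * pi)\<^sup>2 * cube_inner (sine k mi_zero) (sine l mi_zero) =
      (real (k i) * pi)\<^sup>2 * cube_inner (sine k mi_zero) (sine l mi_zero)"
    unfolding second by (simp add: mult.commute[of "sine l _ _"])
  moreover have "(real (l i) * pi)\<^sup>2 \<noteq> (real (k i) * pi)\<^sup>2"
    using i by (simp add: power_mult_distrib)
  ultimately show ?thesis by simp
qed

lemma sine_poly_inner_cD:
  assumes \<phi>: "test_fun unit_cube \<phi>"
  shows "mi_order \<beta> = n \<Longrightarrow> cube_inner (sine_poly K c \<alpha>) (cD \<beta> \<phi>) =
    (- 1) ^ n * cube_inner (sine_poly K c (\<lambda>j. \<alpha> j + \<beta> j)) \<phi>"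
proof (induction n arbitrary: \<alpha> \<beta>)
  case 0
  then have "\<beta> = (\<lambda>j. 0)" by (auto simp: mi_order_def)
  then show ?case by (simp add: cD_0)
next
  case (Suc n)
  obtain i where i: "0 < \<beta> i" and cD: "cD \<beta> \<phi> = cpartial (cD (\<beta>(i := \<beta> i - 1)) \<phi>) i"
    using cD_SucE[OF Suc.prems] by blast
  let ?\<beta>' = "\<beta>(i := \<beta> i - 1)"
  have "C1_along i (cD ?\<beta>' \<phi>)"
    using test_fun_cD[OF \<phi>] cD by (metis C1_along_def)
  then have "cube_inner (sine_poly K c \<alpha>) (cpartial (cD ?\<beta>' \<phi>) i) =
      - cube_inner (cpartial (sine_poly K c \<alpha>) i) (cD ?\<beta>' \<phi>)"
    by (rule cube_integration_by_parts_compact_support[OF smooth_C1_along[OF smooth_sine_poly] _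
          test_fun_cD(3)[OF \<phi>]])
  also have "\<dots> = - ((- 1) ^ n * cube_inner (sine_poly K c (\<lambda>j. (\<alpha>(i := Suc (\<alpha> i))) j + ?\<beta>' j)) \<phi>)"
    unfolding cpartial_sine_poly by (simp only: Suc.IH[OF mi_order_remove[OF Suc.prems i]])
  also have "(\<lambda>j. (\<alpha>(i := Suc (\<alpha> i))) j + ?\<beta>' j) = (\<lambda>j. \<alpha> j + \<beta> j)"
    using i by auto
  finally show ?case by (simp add: cD del: fun_upd_apply)
qed

lemma weak_deriv_sine_poly:
  "weak_deriv unit_cube \<beta> (sine_poly K c mi_zero) (sine_poly K c \<beta>)"
  using sine_poly_inner_cD[OF _ refl, of _ K c mi_zero \<beta>]
  by (simp add: weak_deriv_def L2_cube_loc_int L2_sine_poly)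

section \<open>Sine series\<close>

subsection \<open>Completeness of the sine system\<close>

inductive_set sine_span :: "(real^'n::finite \<Rightarrow> real) set" where
  zero: "(\<lambda>_. 0) \<in> sine_span"
| add_sine: "f \<in> sine_span \<Longrightarrow> (\<lambda>x. f x + c * sine k mi_zero x) \<in> sine_span"

lemma sine_span_cmult_sine: "(\<lambda>x. c * sine k mi_zero x) \<in> sine_span"
  using sine_span.add_sine[OF sine_span.zero, of c k] by simp

lemma sine_span_add: "g \<in> sine_span \<Longrightarrow> f \<in> sine_span \<Longrightarrow> (\<lambda>x. f x + g x) \<in> sine_span"
proof (induction rule: sine_span.induct)
  case (add_sine g c k)
  then have "(\<lambda>x. (f x + g x) + c * sine k mi_zero x) \<in> sine_span"
    by (intro sine_span.add_sine) auto
  then show ?case by (simp add: add.assoc)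
qed simp

lemma sine_span_cmult: "f \<in> sine_span \<Longrightarrow> (\<lambda>x. f x * d) \<in> sine_span"
proof (induction rule: sine_span.induct)
  case (add_sine f c k)
  then have "(\<lambda>x. f x * d + (c * d) * sine k mi_zero x) \<in> sine_span"
    by (intro sine_span.add_sine)
  then show ?case by (simp add: algebra_simps)
qed (simp add: sine_span.zero)

lemma sine_mult_cos:
  assumes "k i \<noteq> 0"
  shows "sine k mi_zero x * cos (pi * x $ i) =
    (sine (k(i := k i + 1)) mi_zero x + sine (k(i := k i - 1)) mi_zero x) / 2"
proof -
  define P where "P = (\<Prod>j\<in>UNIV-{i}. sin_deriv (k j) 0 (x $ j))"
  have "sine (k(i := a)) mi_zero x = sin (real a * pi * x $ i) * P" for a
    unfolding sine_def tensor_remove[of _ x i] P_def by (simp add: sin_deriv_def)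
  from this[of "k i"] this[of "k i + 1"] this[of "k i - 1"]
  have "sine k mi_zero x = sin (real (k i) * pi * x $ i) * P"
    "sine (k(i := k i + 1)) mi_zero x = sin (real (k i) * pi * x $ i + pi * x $ i) * P"
    "sine (k(i := k i - 1)) mi_zero x = sin (real (k i) * pi * x $ i - pi * x $ i) * P"
    using assms by (simp_all add: algebra_simps of_nat_diff)
  then show ?thesis by (simp add: sin_add sin_diff field_simps)
qed

lemma sine_span_mult_cos:
  fixes f :: "real^'n::finite \<Rightarrow> real"
  shows "f \<in> sine_span \<Longrightarrow> (\<lambda>x. f x * cos (pi * x $ i)) \<in> sine_span"
proof (induction rule: sine_span.induct)
  case (add_sine f c k)
  have "(\<lambda>x. c * sine k mi_zero x * cos (pi * x $ i)) \<in> sine_span"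
  proof (cases "k i = 0")
    case True
    then have "sine k mi_zero x = 0" for x :: "real^'n"
      unfolding sine_def tensor_remove[of _ x i] by (simp add: sin_deriv_def)
    then show ?thesis by (simp add: sine_span.zero)
  next
    case False
    have "(\<lambda>x. c / 2 * sine (k(i := k i + 1)) mi_zero x + c / 2 * sine (k(i := k i - 1)) mi_zero x)
        \<in> sine_span"
      by (intro sine_span_add sine_span_cmult_sine)
    then show ?thesis by (simp add: sine_mult_cos[of k i, OF False] mult.assoc
        distrib_left add_divide_distrib)
  qed
  from sine_span_add[OF this add_sine.IH] show ?case by (simp add: distrib_right)
qed (simp add: sine_span.zero)

text \<open>Sine polynomials contain no constants, so Stone-Weierstrass is applied to their multipliers.\<close>

definition sine_multipliers :: "(real^'n::finite \<Rightarrow> real) set" where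
  "sine_multipliers = {r. continuous_on unit_cube r \<and> (\<forall>s\<in>sine_span. (\<lambda>x. s x * r x) \<in> sine_span)}"

lemma function_ring_on_sine_multipliers:
  "function_ring_on (sine_multipliers :: (real^'n::finite \<Rightarrow> real) set) unit_cube"
proof
  show "\<exists>f\<in>sine_multipliers. f x \<noteq> f y"
    if xy: "x \<in> unit_cube" "y \<in> unit_cube" "x \<noteq> y" for x y :: "real^'n"
  proof -
    obtain i where i: "x $ i \<noteq> y $ i" using xy(3) by (auto simp: vec_eq_iff)
    have "cos (pi * x $ i) \<noteq> cos (pi * y $ i)"
      using cos_inj_pi[of "pi * x $ i" "pi * y $ i"] i xy by (auto simp: mem_unit_cube)
    moreover have "(\<lambda>x. cos (pi * x $ i)) \<in> sine_multipliers"
      by (auto simp: sine_multipliers_def intro!: sine_span_mult_cos continuous_intros)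
    ultimately show ?thesis by (intro bexI[of _ "\<lambda>x. cos (pi * x $ i)"])
  qed
  fix r r' :: "real^'n \<Rightarrow> real"
  assume r: "r \<in> sine_multipliers" "r' \<in> sine_multipliers"
  have "(\<lambda>x. (s x * r x) * r' x) \<in> sine_span" if "s \<in> sine_span" for s
    using r that by (simp add: sine_multipliers_def)
  then show "(\<lambda>x. r x * r' x) \<in> sine_multipliers"
    using r by (simp add: sine_multipliers_def mult.assoc continuous_on_mult)
  have "(\<lambda>x. s x * r x + s x * r' x) \<in> sine_span" if "s \<in> sine_span" for s
    using r that unfolding sine_multipliers_def by (intro sine_span_add) blast+
  then show "(\<lambda>x. r x + r' x) \<in> sine_multipliers"
    using r by (simp add: sine_multipliers_def distrib_left continuous_on_add)
qed (simp_all add: sine_multipliers_def compact_unit_cube sine_span_cmult)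

lemma sine_complete:
  fixes g :: "real^'n::finite \<Rightarrow> real"
  assumes g: "L2 unit_cube g" and orth: "\<And>k. cube_inner g (sine k mi_zero) = 0"
  shows "AE x in cube_measure. g x = 0"
proof -
  let ?b = "sine (\<lambda>_::'n. 1) mi_zero"
  have span: "L2 unit_cube s \<and> cube_inner g s = 0" if "s \<in> sine_span" for s
    using that
  proof induction
    case (add_sine f c k)
    then show ?case
      using g orth by (auto intro!: L2_add L2_cmult L2_sine
          simp: distrib_left mult.left_commute[of _ c] L2_integrable_mult L2_sine)
  qed (simp add: L2_def)
  have "AE x in cube_measure. g x * ?b x = 0"
  proof (rule AE_zero_if_orthogonal_function_ring[OF function_ring_on_sine_multipliers])
    show "integrable cube_measure (\<lambda>x. g x * ?b x)"
      by (intro L2_integrable_mult g L2_sine)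
    have "?b \<in> sine_span" using sine_span_cmult_sine[of 1] by simp
    then show "cube_inner (\<lambda>x. g x * ?b x) r = 0" if "r \<in> sine_multipliers" for r
      using span that by (auto simp: sine_multipliers_def mult.assoc)
  qed
  then show ?thesis using AE_cube_interior
  proof eventually_elim
    case (elim x)
    then have "0 < ?b x"
      unfolding sine_def tensor_def sin_deriv_def
      by (intro prod_pos) (auto simp: interior_unit_cube intro!: sin_gt_zero)
    then show ?case using elim(1) by simp
  qed
qed

subsection \<open>Mean square convergence\<close>

definition box_index :: "nat \<Rightarrow> ('n::finite \<Rightarrow> nat) set" where
  "box_index N = {k. \<forall>i. k i \<le> N}"

lemma finite_box_index: "finite (box_index N :: ('n::finite \<Rightarrow> nat) set)"
proof -
  have "box_index N = Pi UNIV (\<lambda>_::'n. {..N})" by (auto simp: box_index_def)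
  then show ?thesis
    using finite_PiE[of "UNIV :: 'n set" "\<lambda>_. {..N}"] by (simp add: PiE_UNIV_domain)
qed

lemma box_index_mono: "M \<le> N \<Longrightarrow> box_index M \<subseteq> box_index N"
  by (auto simp: box_index_def intro: order_trans)

lemma eventually_in_box_index: "\<forall>\<^sub>F N in sequentially. k \<in> box_index N"
proof -
  have "\<forall>\<^sub>F N in sequentially. k i \<le> N" for i by (rule eventually_ge_at_top)
  then show ?thesis unfolding box_index_def mem_Collect_eq by (rule eventually_all_finite)
qed

text \<open>If some \<open>k i = 0\<close> then \<open>sine k mi_zero\<close> vanishes and the quotient is \<open>0 / 0 = 0\<close>.\<close>

definition fourier :: "(real^'n::finite \<Rightarrow> real) \<Rightarrow> ('n \<Rightarrow> nat) \<Rightarrow> real" where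
  "fourier g k = cube_inner g (sine k mi_zero) / L2_norm_sq unit_cube (sine k mi_zero)"

abbreviation (input) fourier_sum ::
  "(real^'n::finite \<Rightarrow> real) \<Rightarrow> nat \<Rightarrow> ('n \<Rightarrow> nat) \<Rightarrow> real^'n \<Rightarrow> real" where
  "fourier_sum g N \<equiv> sine_poly (box_index N) (fourier g)"

lemma fourier_mult_norm_sq:
  assumes "L2 unit_cube g"
  shows "fourier g k * L2_norm_sq unit_cube (sine k mi_zero) = cube_inner g (sine k mi_zero)"
  using L2_Cauchy_Schwarz[OF assms L2_sine[of k mi_zero]]
  by (cases "L2_norm_sq unit_cube (sine k mi_zero) = 0") (simp_all add: fourier_def)

lemma fourier_poly_inner_sine:
  assumes g: "L2 unit_cube g" and K: "finite K" "l \<in> K"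
  shows "cube_inner (sine_poly K (fourier g) mi_zero) (sine l mi_zero) =
    cube_inner g (sine l mi_zero)"
proof -
  have "cube_inner (sine l mi_zero) (sine_poly K (fourier g) mi_zero) =
      (\<Sum>k\<in>K. fourier g k * cube_inner (sine l mi_zero) (sine k mi_zero))"
    by (rule inner_sine_poly[OF L2_sine])
  also have "\<dots> = (\<Sum>k\<in>K. if k = l then cube_inner g (sine l mi_zero) else 0)"
    using fourier_mult_norm_sq[OF g, of l] sine_orthogonal[of l]
    by (intro sum.cong) (auto simp: power2_eq_square)
  also have "\<dots> = cube_inner g (sine l mi_zero)" using K by simp
  finally show ?thesis by (simp add: mult.commute)
qed

lemma fourier_poly_inner_sine_poly:
  assumes g: "L2 unit_cube g" and K: "finite K" "L \<subseteq> K"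
  shows "cube_inner (sine_poly K (fourier g) mi_zero) (sine_poly L c mi_zero) =
    cube_inner g (sine_poly L c mi_zero)"
  unfolding inner_sine_poly[OF L2_sine_poly] inner_sine_poly[OF g]
  using K by (intro sum.cong refl) (auto simp: fourier_poly_inner_sine[OF g])

lemma fourier_poly_norm_sq_diff:
  assumes g: "L2 unit_cube g" and L: "finite L" "K \<subseteq> L"
  defines "P \<equiv> \<lambda>K. sine_poly K (fourier g) mi_zero"
  shows "L2_norm_sq unit_cube (\<lambda>x. P L x - P K x) =
    L2_norm_sq unit_cube (P L) - L2_norm_sq unit_cube (P K)"
proof -
  have "cube_inner (P L) (P K) = cube_inner (P K) (P K)"
    using L finite_subset[OF L(2,1)] by (simp add: P_def fourier_poly_inner_sine_poly[OF g])
  then show ?thesis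
    by (simp add: L2_norm_sq_diff P_def L2_sine_poly) (simp add: power2_eq_square)
qed

lemma Bessel_inequality:
  assumes g: "L2 unit_cube g" and K: "finite K"
  shows "L2_norm_sq unit_cube (sine_poly K (fourier g) mi_zero) \<le> L2_norm_sq unit_cube g"
proof -
  let ?P = "sine_poly K (fourier g) mi_zero"
  have "0 \<le> L2_norm_sq unit_cube (\<lambda>x. g x - ?P x)" by simp
  also have "\<dots> = L2_norm_sq unit_cube g - L2_norm_sq unit_cube ?P"
    using fourier_poly_inner_sine_poly[OF g K order_refl, of "fourier g"]
    by (simp add: L2_norm_sq_diff g L2_sine_poly) (simp add: power2_eq_square)
  finally show ?thesis by simp
qed

lemma fourier_sum_norm_sq_mono:
  assumes "L2 unit_cube g" "M \<le> N"
  shows "L2_norm_sq unit_cube (fourier_sum g M mi_zero) \<le>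
    L2_norm_sq unit_cube (fourier_sum g N mi_zero)"
proof -
  have "0 \<le> L2_norm_sq unit_cube (\<lambda>x. fourier_sum g N mi_zero x - fourier_sum g M mi_zero x)"
    by simp
  then show ?thesis
    unfolding fourier_poly_norm_sq_diff[OF assms(1) finite_box_index box_index_mono[OF assms(2)]]
    by simp
qed

lemma fourier_sum_norm_sq_diff:
  assumes "L2 unit_cube g"
  shows "L2_norm_sq unit_cube (\<lambda>x. fourier_sum g M mi_zero x - fourier_sum g N mi_zero x) =
    \<bar>L2_norm_sq unit_cube (fourier_sum g M mi_zero)
      - L2_norm_sq unit_cube (fourier_sum g N mi_zero)\<bar>"
proof -
  note diff = fourier_poly_norm_sq_diff[OF assms finite_box_index box_index_mono]
  show ?thesis
  proof (cases "M \<le> N")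
    case True
    then show ?thesis
      using diff[OF True] fourier_sum_norm_sq_mono[OF assms True]
      by (subst power2_commute) simp
  next
    case False
    then show ?thesis
      using diff[of N M] fourier_sum_norm_sq_mono[OF assms, of N M] by simp
  qed
qed

lemma L2_Cauchy_fourier_sum:
  assumes g: "L2 unit_cube g"
  shows "L2_Cauchy unit_cube (\<lambda>N. fourier_sum g N mi_zero)"
  unfolding L2_Cauchy_def
proof (intro conjI allI impI)
  let ?a = "\<lambda>N. L2_norm_sq unit_cube (fourier_sum g N mi_zero)"
  have "incseq ?a" by (simp add: incseq_def fourier_sum_norm_sq_mono[OF g])
  moreover have "\<forall>N. ?a N \<le> L2_norm_sq unit_cube g"
    by (intro allI Bessel_inequality g finite_box_index)
  ultimately obtain L where "?a \<longlonglongrightarrow> L" by (rule incseq_convergent)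
  then have "Cauchy ?a" by (rule LIMSEQ_imp_Cauchy)
  fix e :: real assume "0 < e"
  then show "\<exists>N. \<forall>m\<ge>N. \<forall>n\<ge>N.
      L2_norm_sq unit_cube (\<lambda>x. fourier_sum g m mi_zero x - fourier_sum g n mi_zero x) \<le> e"
    using \<open>Cauchy ?a\<close> unfolding Cauchy_def fourier_sum_norm_sq_diff[OF g] dist_real_def
    by (meson less_imp_le)
qed (rule L2_sine_poly)

theorem fourier_L2_tendsto:
  fixes g :: "real^'n::finite \<Rightarrow> real"
  assumes g: "L2 unit_cube g"
  shows "L2_tendsto unit_cube (\<lambda>N. fourier_sum g N mi_zero) g"
proof -
  let ?P = "\<lambda>N. fourier_sum g N mi_zero"
  obtain f where f: "L2_tendsto unit_cube ?P f"
    using Riesz_Fischer[OF L2_Cauchy_fourier_sum[OF g]] by blast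
  have "cube_inner f (sine k mi_zero) = cube_inner g (sine k mi_zero)" for k
  proof (rule LIMSEQ_unique[OF L2_tendsto_inner_const[OF f L2_sine]])
    have "\<forall>\<^sub>F N in sequentially. cube_inner (?P N) (sine k mi_zero) = cube_inner g (sine k mi_zero)"
      using eventually_in_box_index by eventually_elim
        (rule fourier_poly_inner_sine[OF g finite_box_index])
    then show "(\<lambda>N. cube_inner (?P N) (sine k mi_zero)) \<longlonglongrightarrow> cube_inner g (sine k mi_zero)"
      by (rule tendsto_eventually)
  qed
  then have "AE x in cube_measure. g x - f x = 0"
    using g L2_tendstoD(2)[OF f] by (intro sine_complete L2_diff)
      (simp_all add: L2_inner_diff_left L2_sine)
  then show ?thesis
    by (intro L2_tendsto_cong_AE[OF f L2_measurable[OF g]]) simp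
qed

section \<open>Sobolev functions with zero boundary values\<close>

lemma finite_mi_order_le: "finite {\<alpha> :: 'n::finite \<Rightarrow> nat. mi_order \<alpha> \<le> k}"
proof (rule finite_subset[OF _ finite_box_index])
  have "\<alpha> i \<le> mi_order \<alpha>" for \<alpha> :: "'n \<Rightarrow> nat" and i
    unfolding mi_order_def by (rule member_le_sum) auto
  then show "{\<alpha> :: 'n \<Rightarrow> nat. mi_order \<alpha> \<le> k} \<subseteq> box_index k"
    by (auto simp: box_index_def intro: order_trans)
qed

lemma mi_order_eq_0_iff: "mi_order \<alpha> = 0 \<longleftrightarrow> \<alpha> = mi_zero"
  by (auto simp: mi_order_def)

lemma mi_order_SucE:
  assumes "mi_order \<alpha> = Suc n"
  obtains i \<beta> where "mi_order \<beta> = n" "\<alpha> = \<beta>(i := Suc (\<beta> i))"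
proof -
  obtain i where "0 < \<alpha> i" using assms by (rule cD_SucE)
  with mi_order_remove[OF assms this] show ?thesis
    by (intro that[of "\<alpha>(i := \<alpha> i - 1)" i]) auto
qed

lemma mi_order_eq_1_iff: "mi_order \<alpha> = 1 \<longleftrightarrow> \<alpha> \<in> range mi_unit"
proof
  assume "mi_order \<alpha> = 1"
  then obtain i \<beta> where "mi_order \<beta> = 0" "\<alpha> = \<beta>(i := Suc (\<beta> i))"
    by (metis One_nat_def mi_order_SucE)
  then have "\<alpha> = mi_unit i" by (auto simp: mi_order_eq_0_iff mi_unit_def)
  then show "\<alpha> \<in> range mi_unit" by blast
qed (auto simp: mi_order_unit)

lemma mi_order_eq_2_iff: "mi_order \<alpha> = 2 \<longleftrightarrow> \<alpha> \<in> range (\<lambda>(i, j). mi_pair i j)"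
proof
  assume "mi_order \<alpha> = 2"
  then obtain i \<beta> where \<beta>: "mi_order \<beta> = 1" "\<alpha> = \<beta>(i := Suc (\<beta> i))"
    by (metis Suc_1 mi_order_SucE)
  then obtain j where "\<beta> = mi_unit j" unfolding mi_order_eq_1_iff by blast
  then have "\<alpha> = mi_pair i j" using \<beta>(2) by (metis mi_unit_fun_upd_Suc)
  then show "\<alpha> \<in> range (\<lambda>(i, j). mi_pair i j)" by auto
qed (auto simp: mi_order_pair)

lemma mi_order_le_1_cases:
  assumes "mi_order \<alpha> \<le> 1"
  obtains "\<alpha> = mi_zero" | i where "\<alpha> = mi_unit i"
proof -
  have "mi_order \<alpha> = 0 \<or> mi_order \<alpha> = 1" using assms by linarith
  then show ?thesis using that unfolding mi_order_eq_0_iff mi_order_eq_1_iff by blast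
qed

lemma mi_order_le_2_cases:
  assumes "mi_order \<alpha> \<le> 2"
  obtains "\<alpha> = mi_zero" | i where "\<alpha> = mi_unit i" | i j where "\<alpha> = mi_pair i j"
proof -
  have "mi_order \<alpha> = 0 \<or> mi_order \<alpha> = 1 \<or> mi_order \<alpha> = 2" using assms by linarith
  then show ?thesis
    using that unfolding mi_order_eq_0_iff mi_order_eq_1_iff mi_order_eq_2_iff by auto
qed

lemma L2_norm_sq_wD_le_Hk_norm_sq:
  assumes "mi_order \<alpha> \<le> k"
  shows "L2_norm_sq \<Omega> (wD \<Omega> \<alpha> u) \<le> Hk_norm_sq k \<Omega> u"
  unfolding Hk_norm_sq_def
  by (rule member_le_sum[of \<alpha> _ "\<lambda>\<alpha>. L2_norm_sq \<Omega> (wD \<Omega> \<alpha> u)"])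
    (use assms finite_mi_order_le in auto)

lemma Hk_norm_sq_diff_le:
  assumes "Hk k unit_cube u" "Hk k unit_cube v"
  shows "Hk_norm_sq k unit_cube (\<lambda>x. u x - v x) \<le>
    2 * Hk_norm_sq k unit_cube u + 2 * Hk_norm_sq k unit_cube v"
  unfolding Hk_norm_sq_def sum_distrib_left sum.distrib[symmetric]
proof (rule sum_mono)
  fix \<alpha> :: "'a \<Rightarrow> nat" assume "\<alpha> \<in> {\<alpha>. mi_order \<alpha> \<le> k}"
  then have \<alpha>: "mi_order \<alpha> \<le> k" by simp
  note u = Hk_wD[OF assms(1) \<alpha>] and v = Hk_wD[OF assms(2) \<alpha>]
  have "L2_norm_sq unit_cube (wD unit_cube \<alpha> (\<lambda>x. u x - v x)) =
      L2_norm_sq unit_cube (\<lambda>x. wD unit_cube \<alpha> u x - wD unit_cube \<alpha> v x)"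
    by (intro L2_wD weak_deriv_diff L2_diff sets_unit_cube u v)
  also have "\<dots> \<le> 2 * L2_norm_sq unit_cube (wD unit_cube \<alpha> u)
      + 2 * L2_norm_sq unit_cube (wD unit_cube \<alpha> v)"
    by (intro L2_norm_sq_diff_le u v)
  finally show "L2_norm_sq unit_cube (wD unit_cube \<alpha> (\<lambda>x. u x - v x)) \<le> \<dots>" .
qed

lemma C1c_C1_along: "C1c \<Omega> \<psi> \<Longrightarrow> C1_along i \<psi>"
  by (simp add: C1c_def C1_along_def)

lemma C1c_weak_deriv_unit:
  fixes \<psi> :: "real^'n::finite \<Rightarrow> real"
  assumes "C1c unit_cube \<psi>"
  shows "weak_deriv unit_cube (mi_unit i) \<psi> (cpartial \<psi> i)"
proof -
  note \<psi> = C1c_C1_along[OF assms]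
  have "cube_inner \<psi> (cpartial \<phi> i) = - cube_inner (cpartial \<psi> i) \<phi>" if "test_fun unit_cube \<phi>" for \<phi>
  proof (rule cube_integration_by_parts_compact_support[OF \<psi>])
    show "C1_along i \<phi>" "compact_support_in unit_cube \<phi>"
      using test_fun_cD[OF that, where \<alpha> = mi_zero] test_fun_cD(2)[OF that, where \<alpha> = "mi_unit i"]
      by (simp_all add: C1_along_def cD_0 cD_unit)
  qed
  then show ?thesis
    by (simp add: weak_deriv_def cD_unit mi_order_unit L2_cube_loc_int L2_cube_continuous
        C1_along_continuous[OF \<psi>])
qed

lemma C1c_L2:
  assumes "C1c unit_cube \<psi>"
  shows "L2 unit_cube \<psi>" "L2 unit_cube (cpartial \<psi> i)"
  by (intro L2_cube_continuous C1_along_continuous[OF C1c_C1_along[OF assms]])+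

lemma C1c_Hk1:
  assumes "C1c unit_cube \<psi>" shows "Hk 1 unit_cube \<psi>"
  unfolding Hk_def
proof (intro conjI allI impI C1c_L2[OF assms])
  fix \<alpha> :: "'a \<Rightarrow> nat" assume "mi_order \<alpha> \<le> 1"
  then show "\<exists>v. weak_deriv unit_cube \<alpha> \<psi> v \<and> L2 unit_cube v"
  proof (cases rule: mi_order_le_1_cases)
    case 1
    then show ?thesis
      using weak_deriv_0[OF L2_cube_loc_int] C1c_L2(1)[OF assms] by blast
  next
    case (2 i)
    then show ?thesis
      using C1c_weak_deriv_unit[OF assms] C1c_L2(2)[OF assms] by blast
  qed
qed

lemma C1c_diff:
  assumes "C1c \<Omega> \<psi>" "C1c \<Omega> \<theta>"
  shows "C1c \<Omega> (\<lambda>x. \<psi> x - \<theta> x)"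
proof -
  have diff: "\<psi> differentiable (at x)" "\<theta> differentiable (at x)" for x
    using assms by (auto simp: C1c_def)
  have "cpartial (\<lambda>x. \<psi> x + -1 * \<theta> x) i = (\<lambda>x. cpartial \<psi> i x + -1 * cpartial \<theta> i x)" for i
    by (simp only: cpartial_add[OF diff(1) differentiable_mult[OF differentiable_const diff(2)]]
        cpartial_cmult[OF diff(2)])
  then have "continuous_on UNIV (cpartial (\<lambda>x. \<psi> x - \<theta> x) i)" for i
    using assms by (simp add: C1c_def continuous_on_diff)
  moreover have "compact_support_in \<Omega> (\<lambda>x. \<psi> x - \<theta> x)"
    using assms by (intro compact_support_in_closedI[of "tsupp \<psi> \<union> tsupp \<theta>"])
      (auto simp: C1c_def zero_outside_tsupp)
  ultimately show ?thesis
    using diff by (simp add: C1c_def compact_support_in_def differentiable_diff)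
qed

lemma H10_diff:
  assumes "H10 unit_cube u" "H10 unit_cube v"
  shows "H10 unit_cube (\<lambda>x. u x - v x)"
proof -
  have Hk1: "Hk 1 unit_cube u" "Hk 1 unit_cube v" using assms by (auto simp: H10_def)
  obtain \<psi> where \<psi>: "\<And>m. C1c unit_cube (\<psi> m)"
    "(\<lambda>m. Hk_norm_sq 1 unit_cube (\<lambda>x. \<psi> m x - u x)) \<longlonglongrightarrow> 0"
    using assms(1) by (auto simp: H10_def)
  obtain \<theta> where \<theta>: "\<And>m. C1c unit_cube (\<theta> m)"
    "(\<lambda>m. Hk_norm_sq 1 unit_cube (\<lambda>x. \<theta> m x - v x)) \<longlonglongrightarrow> 0"
    using assms(2) by (auto simp: H10_def)
  have "(\<lambda>m. Hk_norm_sq 1 unit_cube (\<lambda>x. (\<psi> m x - u x) - (\<theta> m x - v x))) \<longlonglongrightarrow> 0"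
  proof (rule Lim_null_comparison)
    show "(\<lambda>m. 2 * Hk_norm_sq 1 unit_cube (\<lambda>x. \<psi> m x - u x)
        + 2 * Hk_norm_sq 1 unit_cube (\<lambda>x. \<theta> m x - v x)) \<longlonglongrightarrow> 0"
      by (intro tendsto_add_zero tendsto_mult_right_zero \<psi> \<theta>)
    have "0 \<le> Hk_norm_sq 1 unit_cube f" for f :: "real^'a \<Rightarrow> real"
      by (simp add: Hk_norm_sq_def sum_nonneg)
    then show "\<forall>\<^sub>F m in sequentially.
        norm (Hk_norm_sq 1 unit_cube (\<lambda>x. (\<psi> m x - u x) - (\<theta> m x - v x)))
        \<le> 2 * Hk_norm_sq 1 unit_cube (\<lambda>x. \<psi> m x - u x)
          + 2 * Hk_norm_sq 1 unit_cube (\<lambda>x. \<theta> m x - v x)"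
      using Hk_norm_sq_diff_le[OF Hk_diff[OF C1c_Hk1[OF \<psi>(1)] Hk1(1)]
          Hk_diff[OF C1c_Hk1[OF \<theta>(1)] Hk1(2)]] by simp
  qed
  moreover have "(\<psi> m x - u x) - (\<theta> m x - v x) = (\<psi> m x - \<theta> m x) - (u x - v x)" for m x
    by simp
  ultimately show ?thesis
    using Hk_diff[OF Hk1] C1c_diff[OF \<psi>(1) \<theta>(1)] unfolding H10_def
    by (intro conjI exI[of _ "\<lambda>m x. \<psi> m x - \<theta> m x"] allI) simp_all
qed

lemma L2_tendsto_if_Hk_norm_tendsto:
  assumes lim: "(\<lambda>m. Hk_norm_sq k unit_cube (\<lambda>x. U m x - u x)) \<longlonglongrightarrow> 0" and \<alpha>: "mi_order \<alpha> \<le> k"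
    and V: "\<And>m. weak_deriv unit_cube \<alpha> (U m) (V m)" "\<And>m. L2 unit_cube (V m)"
    and v: "weak_deriv unit_cube \<alpha> u v" "L2 unit_cube v"
  shows "L2_tendsto unit_cube V v"
proof -
  have "L2_norm_sq unit_cube (\<lambda>x. V m x - v x) \<le> Hk_norm_sq k unit_cube (\<lambda>x. U m x - u x)" for m
    using L2_wD(2)[OF weak_deriv_diff[OF sets_unit_cube V(1) v(1)] L2_diff[OF V(2) v(2)], of m]
      L2_norm_sq_wD_le_Hk_norm_sq[OF \<alpha>, of unit_cube "\<lambda>x. U m x - u x"] by simp
  then have "(\<lambda>m. L2_norm_sq unit_cube (\<lambda>x. V m x - v x)) \<longlonglongrightarrow> 0"
    by (intro Lim_null_comparison[OF _ lim]) simp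
  then show ?thesis using V v by (simp add: L2_tendsto_def)
qed

lemma H10_integration_by_parts:
  fixes u :: "real^'n::finite \<Rightarrow> real"
  assumes u: "H10 unit_cube u" and \<phi>: "smooth \<phi>"
  shows "cube_inner (wD unit_cube (mi_unit i) u) \<phi> = - cube_inner u (cpartial \<phi> i)"
proof -
  let ?D = "wD unit_cube (mi_unit i) u"
  have Hk1: "Hk 1 unit_cube u" using u by (simp add: H10_def)
  then have L2_u: "L2 unit_cube u" by (simp add: Hk_def)
  obtain \<psi> where \<psi>: "\<And>m. C1c unit_cube (\<psi> m)"
    and lim: "(\<lambda>m. Hk_norm_sq 1 unit_cube (\<lambda>x. \<psi> m x - u x)) \<longlonglongrightarrow> 0"
    using u by (auto simp: H10_def)
  have "L2_tendsto unit_cube \<psi> u"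
    by (rule L2_tendsto_if_Hk_norm_tendsto[OF lim, of mi_zero])
      (auto simp: mi_order_0 L2_u C1c_L2[OF \<psi>] intro!: weak_deriv_0 L2_cube_loc_int)
  then have u_lim: "(\<lambda>m. - cube_inner (\<psi> m) (cpartial \<phi> i)) \<longlonglongrightarrow> - cube_inner u (cpartial \<phi> i)"
    by (intro tendsto_minus L2_tendsto_inner_const L2_cube_smooth smooth_cpartial \<phi>)
  have "L2_tendsto unit_cube (\<lambda>m. cpartial (\<psi> m) i) ?D"
    by (rule L2_tendsto_if_Hk_norm_tendsto[OF lim, of "mi_unit i"])
      (auto simp: mi_order_unit intro!: C1c_L2 C1c_weak_deriv_unit \<psi> Hk_wD[OF Hk1])
  then have D_lim: "(\<lambda>m. cube_inner (cpartial (\<psi> m) i) \<phi>) \<longlonglongrightarrow> cube_inner ?D \<phi>"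
    by (intro L2_tendsto_inner_const L2_cube_smooth \<phi>)
  have "cube_inner (cpartial (\<psi> m) i) \<phi> = - cube_inner (\<psi> m) (cpartial \<phi> i)" for m
  proof -
    have "compact_support_in unit_cube (\<psi> m)"
      using \<psi>[of m] by (simp add: C1c_def compact_support_in_def)
    then have "cube_inner \<phi> (cpartial (\<psi> m) i) = - cube_inner (cpartial \<phi> i) (\<psi> m)"
      by (rule cube_integration_by_parts_compact_support[
            OF smooth_C1_along[OF \<phi>] C1c_C1_along[OF \<psi>]])
    then show ?thesis by (simp add: mult.commute)
  qed
  then show ?thesis using LIMSEQ_unique[OF D_lim] u_lim by simp
qed

lemma H10_H2_second_integration_by_parts:
  fixes u :: "real^'n::finite \<Rightarrow> real"
  assumes u: "H10 unit_cube u" "Hk 2 unit_cube u"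
    and \<phi>: "smooth \<phi>" "\<And>x. x \<in> frontier unit_cube \<Longrightarrow> \<phi> x = 0"
  shows "cube_inner (wD unit_cube (mi_pair i i) u) \<phi> = cube_inner u (cpartial (cpartial \<phi> i) i)"
proof -
  have order: "mi_order (mi_unit i) \<le> 2" "mi_order (mi_pair i i) \<le> 2"
    by (simp_all add: mi_order_unit mi_order_pair)
  note first = Hk_wD[OF u(2) order(1)] and second = Hk_wD[OF u(2) order(2)]
  have "cube_inner (wD unit_cube (mi_pair i i) u) \<phi> =
      - cube_inner (wD unit_cube (mi_unit i) u) (cpartial \<phi> i)"
    by (rule weak_partial_vanishing_boundary[
          OF L2_cube_integrable[OF first(2)] L2_cube_integrable[OF second(2)]
          weak_deriv_iterated_testD[OF first(1) second(1)] \<phi>])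
  then show ?thesis
    by (simp add: H10_integration_by_parts[OF u(1) smooth_cpartial[OF \<phi>(1)]])
qed

subsection \<open>Convergence of the sine series with its derivatives\<close>

lemma fourier_sum_diff:
  obtains c where "\<And>\<alpha> x. fourier_sum g M \<alpha> x - fourier_sum g N \<alpha> x =
    sine_poly (box_index (max M N)) c \<alpha> x"
proof
  let ?c = "\<lambda>K k. if k \<in> box_index K then fourier g k else 0"
  have extend: "fourier_sum g K \<alpha> = sine_poly (box_index (max M N)) (?c K) \<alpha>"
    if "K \<le> max M N" for K \<alpha>
    by (intro sine_poly_extend box_index_mono finite_box_index that)
  show "fourier_sum g M \<alpha> x - fourier_sum g N \<alpha> x =
      sine_poly (box_index (max M N)) (\<lambda>k. ?c M k - ?c N k) \<alpha> x" for \<alpha> x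
    unfolding extend[OF max.cobounded1] extend[OF max.cobounded2] by (rule sine_poly_diff)
qed

lemma L2_Cauchy_fourier_sum_interpolation:
  assumes "L2_Cauchy unit_cube (\<lambda>N. fourier_sum g N \<alpha>)"
    "L2_Cauchy unit_cube (\<lambda>N. fourier_sum g N \<beta>)"
    and norm: "\<And>K c. L2_norm_sq unit_cube (sine_poly K c \<gamma>) =
      \<bar>cube_inner (sine_poly K c \<alpha>) (sine_poly K c \<beta>)\<bar>"
  shows "L2_Cauchy unit_cube (\<lambda>N. fourier_sum g N \<gamma>)"
proof (rule L2_Cauchy_interpolation[OF assms(1,2) L2_sine_poly])
  fix M N
  obtain c where "\<And>\<delta> x. fourier_sum g M \<delta> x - fourier_sum g N \<delta> x =
      sine_poly (box_index (max M N)) c \<delta> x"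
    using fourier_sum_diff[of M g N] by blast
  then show "L2_norm_sq unit_cube (\<lambda>x. fourier_sum g M \<gamma> x - fourier_sum g N \<gamma> x) \<le>
      \<bar>cube_inner (\<lambda>x. fourier_sum g M \<alpha> x - fourier_sum g N \<alpha> x)
        (\<lambda>x. fourier_sum g M \<beta> x - fourier_sum g N \<beta> x)\<bar>"
    by (simp add: norm)
qed

lemma fourier_wD_pure_second:
  assumes "H10 unit_cube w" "Hk 2 unit_cube w"
  shows "fourier (wD unit_cube (mi_pair i i) w) k = - (real (k i) * pi)\<^sup>2 * fourier w k"
proof -
  have "cube_inner (wD unit_cube (mi_pair i i) w) (sine k mi_zero) =
      cube_inner w (cpartial (cpartial (sine k mi_zero) i) i)"
    using sine_poly_zero_on_frontier[of _ "{k}" "\<lambda>_. 1"]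
    by (intro H10_H2_second_integration_by_parts assms smooth_sine) (simp add: sine_poly_singleton)
  also have "cpartial (cpartial (sine k mi_zero) i) i = sine k (mi_pair i i)"
    by (simp add: cpartial_sine zero_fun_upd_Suc mi_unit_fun_upd_Suc del: fun_upd_apply)
  also have "cube_inner w (sine k (mi_pair i i)) =
      - (real (k i) * pi)\<^sup>2 * cube_inner w (sine k mi_zero)"
    unfolding sine_pure_second by (subst integral_mult_right_zero[symmetric]) (simp add: mult_ac)
  finally show ?thesis by (simp add: fourier_def)
qed

lemma fourier_sum_pure_second_tendsto:
  assumes "H10 unit_cube w" "Hk 2 unit_cube w"
  shows "L2_tendsto unit_cube (\<lambda>N. fourier_sum w N (mi_pair i i)) (wD unit_cube (mi_pair i i) w)"
proof -
  have "fourier_sum w N (mi_pair i i) = fourier_sum (wD unit_cube (mi_pair i i) w) N mi_zero" for N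
    by (auto simp: fun_eq_iff sine_poly_def sine_pure_second fourier_wD_pure_second[OF assms]
        intro!: sum.cong)
  moreover have "L2 unit_cube (wD unit_cube (mi_pair i i) w)"
    by (rule Hk_wD[OF assms(2)]) (simp add: mi_order_pair)
  ultimately show ?thesis using fourier_L2_tendsto by simp
qed

theorem fourier_sum_H2_tendsto:
  fixes w :: "real^'n::finite \<Rightarrow> real"
  assumes w: "H10 unit_cube w" "Hk 2 unit_cube w" and \<alpha>: "mi_order \<alpha> \<le> 2"
  shows "L2_tendsto unit_cube (\<lambda>N. fourier_sum w N \<alpha>) (wD unit_cube \<alpha> w)"
proof (rule weak_deriv_closed[OF weak_deriv_sine_poly])
  have L2_w: "L2 unit_cube w" using w(2) by (simp add: Hk_def)
  show "L2_tendsto unit_cube (\<lambda>N. fourier_sum w N mi_zero) w" by (rule fourier_L2_tendsto[OF L2_w])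
  note zero = L2_Cauchy_fourier_sum[OF L2_w]
    and pure = L2_tendsto_imp_Cauchy[OF fourier_sum_pure_second_tendsto[OF w]]
  from \<alpha> show "L2_Cauchy unit_cube (\<lambda>N. fourier_sum w N \<alpha>)"
  proof (cases rule: mi_order_le_2_cases)
    case 1
    then show ?thesis using zero by simp
  next
    case (2 i)
    have "L2_Cauchy unit_cube (\<lambda>N. fourier_sum w N (mi_unit i))"
    proof (rule L2_Cauchy_fourier_sum_interpolation[OF zero pure[of i]])
      fix K and c :: "('n \<Rightarrow> nat) \<Rightarrow> real"
      have "0 \<le> L2_norm_sq unit_cube (sine_poly K c (mi_unit i))" by simp
      then show "L2_norm_sq unit_cube (sine_poly K c (mi_unit i)) =
          \<bar>cube_inner (sine_poly K c mi_zero) (sine_poly K c (mi_pair i i))\<bar>"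
        using sine_poly_gradient_inner[of K c i K c] unfolding power2_eq_square by linarith
    qed
    then show ?thesis using 2 by simp
  next
    case (3 i j)
    have "L2_Cauchy unit_cube (\<lambda>N. fourier_sum w N (mi_pair i j))"
    proof (rule L2_Cauchy_fourier_sum_interpolation[OF pure[of i] pure[of j]])
      fix K and c :: "('n \<Rightarrow> nat) \<Rightarrow> real"
      have "0 \<le> L2_norm_sq unit_cube (sine_poly K c (mi_pair i j))" by simp
      then show "L2_norm_sq unit_cube (sine_poly K c (mi_pair i j)) =
          \<bar>cube_inner (sine_poly K c (mi_pair i i)) (sine_poly K c (mi_pair j j))\<bar>"
        using sine_poly_hessian_inner[of K c i j K c] unfolding power2_eq_square by linarith
    qed
    then show ?thesis using 3 by simp
  qed
qed (rule Hk_wD(1)[OF w(2) \<alpha>])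

section \<open>The energy identity\<close>

definition gradient_norm_sq :: "(real^'n::finite \<Rightarrow> real) \<Rightarrow> real" where
  "gradient_norm_sq w = (\<Sum>i\<in>UNIV. L2_norm_sq unit_cube (wD unit_cube (mi_unit i) w))"

definition hessian_norm_sq :: "(real^'n::finite \<Rightarrow> real) \<Rightarrow> real" where
  "hessian_norm_sq w =
    (\<Sum>i\<in>UNIV. \<Sum>j\<in>UNIV. L2_norm_sq unit_cube (wD unit_cube (mi_pair i j) w))"

lemma sine_poly_laplacian_norm_sq:
  "L2_norm_sq unit_cube (\<lambda>x. \<Sum>i\<in>UNIV. sine_poly K c (mi_pair i i) x) =
    (\<Sum>i\<in>UNIV. \<Sum>j\<in>UNIV. L2_norm_sq unit_cube (sine_poly K c (mi_pair i j)))"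
proof -
  let ?P = "sine_poly K c"
  let ?\<Delta> = "\<lambda>x. \<Sum>i\<in>UNIV. ?P (mi_pair i i) x"
  have "cube_inner ?\<Delta> ?\<Delta> = (\<Sum>i\<in>UNIV. cube_inner (?P (mi_pair i i)) ?\<Delta>)"
    by (intro L2_inner_sum_left L2_sum L2_sine_poly)
  also have "\<dots> = (\<Sum>i\<in>UNIV. cube_inner ?\<Delta> (?P (mi_pair i i)))"
    by (simp only: mult.commute)
  also have "\<dots> = (\<Sum>i\<in>UNIV. \<Sum>j\<in>UNIV. cube_inner (?P (mi_pair j j)) (?P (mi_pair i i)))"
    by (intro sum.cong refl L2_inner_sum_left L2_sine_poly)
  also have "\<dots> = (\<Sum>i\<in>UNIV. \<Sum>j\<in>UNIV. cube_inner (?P (mi_pair j i)) (?P (mi_pair j i)))"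
    by (intro sum.cong refl sine_poly_hessian_inner[symmetric])
  also have "\<dots> = (\<Sum>j\<in>UNIV. \<Sum>i\<in>UNIV. cube_inner (?P (mi_pair j i)) (?P (mi_pair j i)))"
    by (rule sum.swap)
  finally show ?thesis by (simp only: power2_eq_square)
qed

lemma laplacian_norm_sq:
  assumes w: "H10 unit_cube w" "Hk 2 unit_cube w"
  shows "L2_norm_sq unit_cube (wlap unit_cube w) = hessian_norm_sq w"
proof -
  let ?T = "fourier_sum w"
  have lim: "L2_tendsto unit_cube (\<lambda>N. ?T N (mi_pair i j)) (wD unit_cube (mi_pair i j) w)" for i j
    by (intro fourier_sum_H2_tendsto w) (simp add: mi_order_pair)
  have norm_lim: "L2_tendsto unit_cube F f \<Longrightarrow>
      (\<lambda>N. L2_norm_sq unit_cube (F N)) \<longlonglongrightarrow> L2_norm_sq unit_cube f" for F f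
    unfolding power2_eq_square by (rule L2_tendsto_inner)
  have "(\<lambda>N. L2_norm_sq unit_cube (\<lambda>x. \<Sum>i\<in>UNIV. ?T N (mi_pair i i) x)) \<longlonglongrightarrow>
      L2_norm_sq unit_cube (wlap unit_cube w)"
    unfolding wlap_eq by (intro norm_lim L2_tendsto_sum lim)
  moreover have "(\<lambda>N. L2_norm_sq unit_cube (\<lambda>x. \<Sum>i\<in>UNIV. ?T N (mi_pair i i) x)) \<longlonglongrightarrow>
      hessian_norm_sq w"
    unfolding sine_poly_laplacian_norm_sq hessian_norm_sq_def by (intro tendsto_sum norm_lim lim)
  ultimately show ?thesis by (rule LIMSEQ_unique)
qed

definition admissible_potential :: "(real^'n::finite \<Rightarrow> real) \<Rightarrow> bool" where
  "admissible_potential V \<longleftrightarrow> Linf unit_cube V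
     \<and> (\<forall>\<alpha>. mi_order \<alpha> \<le> 2 \<longrightarrow> (\<exists>v. weak_deriv unit_cube \<alpha> V v))
     \<and> (\<forall>\<alpha>. mi_order \<alpha> = 1 \<longrightarrow> Linf unit_cube (wD unit_cube \<alpha> V))
     \<and> Linf unit_cube (wlap unit_cube V)"

lemma admissible_potential_Linf:
  assumes "admissible_potential V"
  shows "Linf unit_cube V" "Linf unit_cube (wD unit_cube (mi_unit i) V)"
    "Linf unit_cube (wlap unit_cube V)"
  using assms by (auto simp: admissible_potential_def mi_order_unit)

lemma admissible_potential_weak_deriv:
  assumes "admissible_potential V" "mi_order \<alpha> \<le> 2"
  shows "weak_deriv unit_cube \<alpha> V (wD unit_cube \<alpha> V)"
  using assms unfolding admissible_potential_def by (blast intro: weak_deriv_wD)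

lemma wlap_inner_test_function:
  assumes V: "admissible_potential V" and \<psi>: "smooth \<psi>" "compact_support_in unit_cube \<psi>"
  shows "cube_inner (wlap unit_cube V) \<psi> =
    - (\<Sum>i\<in>UNIV. cube_inner (wD unit_cube (mi_unit i) V) (cpartial \<psi> i))"
proof -
  have weak: "weak_deriv unit_cube (mi_unit i) V (wD unit_cube (mi_unit i) V)"
    "weak_deriv unit_cube (mi_pair i i) V (wD unit_cube (mi_pair i i) V)" for i
    by (intro admissible_potential_weak_deriv[OF V]; simp add: mi_order_unit mi_order_pair)+
  have "cube_inner (wlap unit_cube V) \<psi> = (\<Sum>i\<in>UNIV. cube_inner (wD unit_cube (mi_pair i i) V) \<psi>)"
    unfolding wlap_eq sum_distrib_right
    by (intro Bochner_Integration.integral_sum loc_int_integrable_mult sets_unit_cube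
        weak_deriv_loc_int[OF weak(2)] smooth_continuous \<psi>)
  then show ?thesis
    by (simp add: weak_deriv_iterated_testD[OF weak \<psi>] sum_negf)
qed

lemma wlap_inner_zero_boundary_gradient:
  assumes V: "admissible_potential V" and \<phi>: "smooth \<phi>"
    and zero: "\<And>x. x \<in> frontier unit_cube \<Longrightarrow> \<phi> x = 0"
      "\<And>x i. x \<in> frontier unit_cube \<Longrightarrow> cpartial \<phi> i x = 0"
  shows "cube_inner (wlap unit_cube V) \<phi> = (\<Sum>i\<in>UNIV. cube_inner V (cpartial (cpartial \<phi> i) i))"
proof -
  note Linf = admissible_potential_Linf[OF V, THEN Linf_cube_integrable]
  have weak: "weak_deriv unit_cube (mi_unit i) V (wD unit_cube (mi_unit i) V)" for i
    by (intro admissible_potential_weak_deriv[OF V]) (simp add: mi_order_unit)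
  have "cube_inner (wD unit_cube (mi_unit i) V) (cpartial \<phi> i) =
      - cube_inner V (cpartial (cpartial \<phi> i) i)" for i
    by (rule weak_partial_vanishing_boundary[OF Linf(1,2) _ smooth_cpartial[OF \<phi>] zero(2)])
      (simp_all add: weak_deriv_unit_testD[OF weak])
  moreover have "cube_inner (wlap unit_cube V) \<phi> =
      - (\<Sum>i\<in>UNIV. cube_inner (wD unit_cube (mi_unit i) V) (cpartial \<phi> i))"
    by (rule weak_divergence_vanishing_boundary[OF Linf(2,3) wlap_inner_test_function[OF V]
          \<phi> zero(1)])
  ultimately show ?thesis by (simp add: sum_negf)
qed

lemma inner_second_partial_sq:
  assumes V: "Linf unit_cube V" and s: "smooth s"
  shows "cube_inner V (cpartial (cpartial (\<lambda>x. s x * s x) i) i) =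
    2 * cube_inner (\<lambda>x. V x * cpartial s i x) (cpartial s i)
    + 2 * cube_inner (\<lambda>x. V x * s x) (cpartial (cpartial s i) i)"
proof -
  let ?s' = "cpartial s i" and ?s'' = "cpartial (cpartial s i) i"
  have smooth: "smooth ?s'" "smooth ?s''" by (intro smooth_cpartial s)+
  have diff: "s differentiable (at x)" "?s' differentiable (at x)" for x
    using s smooth by (auto intro: smooth_differentiable)
  have "cpartial (\<lambda>x. s x * s x) i = (\<lambda>x. 2 * (s x * ?s' x))"
    by (simp add: cpartial_mult[OF diff(1) diff(1)] mult.commute[of "?s' _"])
  then have "cpartial (cpartial (\<lambda>x. s x * s x) i) i = (\<lambda>x. 2 * (?s' x * ?s' x + s x * ?s'' x))"
    by (simp add: cpartial_cmult[OF differentiable_mult[OF diff]] cpartial_mult[OF diff])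
  then have "cube_inner V (cpartial (cpartial (\<lambda>x. s x * s x) i) i) =
      (\<integral>x. 2 * (V x * ?s' x * ?s' x) + 2 * (V x * s x * ?s'' x) \<partial>cube_measure)"
    by (simp add: algebra_simps)
  moreover have "integrable cube_measure (\<lambda>x. V x * f x * g x)" if "smooth f" "smooth g" for f g
    by (intro L2_integrable_mult L2_Linf_mult V L2_cube_smooth that)
  ultimately show ?thesis using s smooth by simp
qed

lemma sine_poly_potential_identity:
  fixes V :: "real^'n::finite \<Rightarrow> real"
    and K :: "('n \<Rightarrow> nat) set" and c :: "('n \<Rightarrow> nat) \<Rightarrow> real"
  assumes V: "admissible_potential V"
  defines "P \<equiv> sine_poly K c"
  shows "cube_inner (\<lambda>x. wlap unit_cube V x * P mi_zero x) (P mi_zero) =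
    2 * (\<Sum>i\<in>UNIV. cube_inner (\<lambda>x. V x * P (mi_unit i) x) (P (mi_unit i)))
    + 2 * (\<Sum>i\<in>UNIV. cube_inner (\<lambda>x. V x * P mi_zero x) (P (mi_pair i i)))"
proof -
  let ?\<phi> = "\<lambda>x. P mi_zero x * P mi_zero x"
  have smooth_P: "smooth (P mi_zero)" unfolding P_def by (rule smooth_sine_poly)
  have P: "cpartial (P mi_zero) i = P (mi_unit i)"
    "cpartial (P (mi_unit i)) i = P (mi_pair i i)" for i
    unfolding P_def
    by (simp_all add: cpartial_sine_poly zero_fun_upd_Suc mi_unit_fun_upd_Suc del: fun_upd_apply)
  have "cube_inner (wlap unit_cube V) ?\<phi> = (\<Sum>i\<in>UNIV. cube_inner V (cpartial (cpartial ?\<phi> i) i))"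
  proof (rule wlap_inner_zero_boundary_gradient[OF V smooth_mult[OF smooth_P smooth_P]])
    fix x :: "real^'n" and i assume "x \<in> frontier unit_cube"
    then have "P mi_zero x = 0" unfolding P_def by (rule sine_poly_zero_on_frontier)
    then show "?\<phi> x = 0" "cpartial ?\<phi> i x = 0"
      by (simp_all add: cpartial_mult smooth_differentiable smooth_P)
  qed
  then show ?thesis
    by (simp add: inner_second_partial_sq[OF admissible_potential_Linf(1)[OF V] smooth_P] P
        sum.distrib sum_distrib_left mult.assoc)
qed

lemma potential_identity:
  assumes w: "H10 unit_cube w" "Hk 2 unit_cube w" and V: "admissible_potential V"
  shows "cube_inner (\<lambda>x. wlap unit_cube V x * w x) w =
    2 * (\<Sum>i\<in>UNIV. \<integral>x. V x * (wD unit_cube (mi_unit i) w x)\<^sup>2 \<partial>cube_measure)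
    + 2 * cube_inner (\<lambda>x. V x * w x) (wlap unit_cube w)"
proof -
  let ?D = "\<lambda>\<alpha>. wD unit_cube \<alpha> w"
  let ?T = "fourier_sum w"
  note Linf = admissible_potential_Linf[OF V]
  have lim_w: "L2_tendsto unit_cube (\<lambda>N. ?T N mi_zero) w"
    using w(2) by (intro fourier_L2_tendsto) (simp add: Hk_def)
  have lim_grad: "L2_tendsto unit_cube (\<lambda>N. ?T N (mi_unit i)) (wD unit_cube (mi_unit i) w)" for i
    by (intro fourier_sum_H2_tendsto w) (simp add: mi_order_unit)
  have lim_second: "L2_tendsto unit_cube (\<lambda>N. ?T N (mi_pair i i)) (wD unit_cube (mi_pair i i) w)"
    for i
    by (intro fourier_sum_H2_tendsto w) (simp add: mi_order_pair)
  have "(\<lambda>N. cube_inner (\<lambda>x. wlap unit_cube V x * ?T N mi_zero x) (?T N mi_zero)) \<longlonglongrightarrow>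
      cube_inner (\<lambda>x. wlap unit_cube V x * w x) w"
    by (intro L2_tendsto_inner L2_tendsto_Linf_mult Linf lim_w)
  moreover have "(\<lambda>N. cube_inner (\<lambda>x. wlap unit_cube V x * ?T N mi_zero x) (?T N mi_zero)) \<longlonglongrightarrow>
      2 * (\<Sum>i\<in>UNIV. cube_inner (\<lambda>x. V x * ?D (mi_unit i) x) (?D (mi_unit i)))
      + 2 * (\<Sum>i\<in>UNIV. cube_inner (\<lambda>x. V x * w x) (?D (mi_pair i i)))"
    unfolding sine_poly_potential_identity[OF V]
    by (intro tendsto_add tendsto_mult_left tendsto_sum L2_tendsto_inner L2_tendsto_Linf_mult Linf
        lim_w lim_grad lim_second)
  ultimately have "cube_inner (\<lambda>x. wlap unit_cube V x * w x) w =
      2 * (\<Sum>i\<in>UNIV. cube_inner (\<lambda>x. V x * ?D (mi_unit i) x) (?D (mi_unit i)))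
      + 2 * (\<Sum>i\<in>UNIV. cube_inner (\<lambda>x. V x * w x) (?D (mi_pair i i)))"
    by (rule LIMSEQ_unique)
  also have "(\<Sum>i\<in>UNIV. cube_inner (\<lambda>x. V x * w x) (?D (mi_pair i i))) =
      cube_inner (\<lambda>x. V x * w x) (wlap unit_cube w)"
    unfolding wlap_eq sum_distrib_left
    by (rule Bochner_Integration.integral_sum[symmetric])
      (intro L2_integrable_mult L2_Linf_mult Linf L2_tendstoD(2)[OF lim_w]
        L2_tendstoD(2)[OF lim_second])
  finally show ?thesis by (simp only: power2_eq_square mult.assoc)
qed

lemma L2_wlap:
  assumes "Hk 2 unit_cube u" shows "L2 unit_cube (wlap unit_cube u)"
  unfolding wlap_eq by (intro L2_sum Hk_wD[OF assms]) (simp add: mi_order_pair)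

theorem energy_identity:
  assumes w: "H10 unit_cube w" "Hk 2 unit_cube w" and V: "admissible_potential V"
  shows "L2_norm_sq unit_cube (\<lambda>x. wlap unit_cube w x - V x * w x) =
    hessian_norm_sq w
    + 2 * (\<Sum>i\<in>UNIV. \<integral>x. V x * (wD unit_cube (mi_unit i) w x)\<^sup>2 \<partial>cube_measure)
    + (\<integral>x. ((V x)\<^sup>2 - wlap unit_cube V x) * (w x)\<^sup>2 \<partial>cube_measure)"
proof -
  note Linf = admissible_potential_Linf[OF V]
  have L2_w: "L2 unit_cube w" using w(2) by (simp add: Hk_def)
  have L2_lap: "L2 unit_cube (wlap unit_cube w)" by (rule L2_wlap[OF w(2)])
  have L2_Vw: "L2 unit_cube (\<lambda>x. V x * w x)" by (intro L2_Linf_mult Linf L2_w)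
  have "L2_norm_sq unit_cube (\<lambda>x. wlap unit_cube w x - V x * w x) =
      L2_norm_sq unit_cube (wlap unit_cube w) + L2_norm_sq unit_cube (\<lambda>x. V x * w x)
      - 2 * cube_inner (\<lambda>x. V x * w x) (wlap unit_cube w)"
    unfolding L2_norm_sq_diff[OF L2_lap L2_Vw] by (simp add: mult.commute)
  also have "\<dots> = hessian_norm_sq w
      + 2 * (\<Sum>i\<in>UNIV. \<integral>x. V x * (wD unit_cube (mi_unit i) w x)\<^sup>2 \<partial>cube_measure)
      + (L2_norm_sq unit_cube (\<lambda>x. V x * w x) - cube_inner (\<lambda>x. wlap unit_cube V x * w x) w)"
    unfolding laplacian_norm_sq[OF w] potential_identity[OF w V] by simp
  also have "L2_norm_sq unit_cube (\<lambda>x. V x * w x) - cube_inner (\<lambda>x. wlap unit_cube V x * w x) w =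
      (\<integral>x. (V x * w x)\<^sup>2 - wlap unit_cube V x * w x * w x \<partial>cube_measure)"
    by (rule Bochner_Integration.integral_diff[symmetric])
      (intro L2_integrable_sq[OF L2_Vw] L2_integrable_mult L2_Linf_mult Linf L2_w)+
  also have "\<dots> = (\<integral>x. ((V x)\<^sup>2 - wlap unit_cube V x) * (w x)\<^sup>2 \<partial>cube_measure)"
    by (simp add: power_mult_distrib left_diff_distrib power2_eq_square[of "w _"] mult.assoc)
  finally show ?thesis .
qed

subsection \<open>Comparison with the norm\<close>

lemma inj_mi_unit: "inj mi_unit"
  by (rule injI) (metis mi_unit_def zero_neq_one)

lemma mi_pair_eq_iff: "mi_pair a b = mi_pair i j \<longleftrightarrow> (a = i \<and> b = j) \<or> (a = j \<and> b = i)"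
proof
  assume eq: "mi_pair a b = mi_pair i j"
  have cancel: "mi_pair k p = mi_pair k q \<Longrightarrow> p = q" for k p q :: 'a
    using inj_mi_unit by (auto simp: mi_pair_def fun_eq_iff dest: injD)
  have "0 < mi_pair i j a" using fun_cong[OF eq, of a]
    by (auto simp: mi_pair_def mi_unit_def split: if_splits)
  then consider "a = i" | "a = j" by (auto simp: mi_pair_def mi_unit_def split: if_splits)
  then show "(a = i \<and> b = j) \<or> (a = j \<and> b = i)"
  proof cases
    case 1
    then show ?thesis using eq cancel by blast
  next
    case 2
    moreover have "mi_pair i j = mi_pair j i" by (simp add: mi_pair_def add.commute)
    ultimately show ?thesis using eq cancel by metis
  qed
qed (auto simp: mi_pair_def)

lemma sum_mi_order_le_2:
  fixes h :: "('n::finite \<Rightarrow> nat) \<Rightarrow> real"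
  shows "(\<Sum>\<alpha> | mi_order \<alpha> \<le> 2. h \<alpha>) =
    h mi_zero + (\<Sum>i\<in>UNIV. h (mi_unit i)) + (\<Sum>\<alpha> | mi_order \<alpha> = 2. h \<alpha>)"
proof -
  let ?S = "\<lambda>n. {\<alpha> :: 'n \<Rightarrow> nat. mi_order \<alpha> = n}"
  have "(\<Sum>\<alpha> | mi_order \<alpha> \<le> 2. h \<alpha>) =
      (\<Sum>n\<in>{0, 1, 2}. \<Sum>\<alpha>\<in>{\<alpha>\<in>{\<alpha>. mi_order \<alpha> \<le> 2}. mi_order \<alpha> = n}. h \<alpha>)"
    by (rule sum.group[symmetric]) (auto simp: finite_mi_order_le)
  also have "\<dots> = (\<Sum>n\<in>{0, 1, 2}. sum h (?S n))"
    by (intro sum.cong) auto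
  also have "\<dots> = sum h (?S 0) + sum h (?S 1) + sum h (?S 2)" by simp
  also have "?S 0 = {mi_zero}" by (auto simp: mi_order_eq_0_iff)
  also have "?S 1 = range mi_unit" using mi_order_eq_1_iff by blast
  finally show ?thesis by (simp add: sum.reindex[OF inj_mi_unit])
qed

lemma sum_mi_pair_bounds:
  fixes h :: "('n::finite \<Rightarrow> nat) \<Rightarrow> real"
  assumes nonneg: "\<And>\<alpha>. 0 \<le> h \<alpha>"
  shows "(\<Sum>\<alpha> | mi_order \<alpha> = 2. h \<alpha>) \<le> (\<Sum>i\<in>UNIV. \<Sum>j\<in>UNIV. h (mi_pair i j))"
    and "(\<Sum>i\<in>UNIV. \<Sum>j\<in>UNIV. h (mi_pair i j)) \<le> 2 * (\<Sum>\<alpha> | mi_order \<alpha> = 2. h \<alpha>)"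
proof -
  let ?f = "\<lambda>(i, j). mi_pair i j :: 'n \<Rightarrow> nat"
  have range: "{\<alpha> :: 'n \<Rightarrow> nat. mi_order \<alpha> = 2} = range ?f"
    by (simp add: mi_order_eq_2_iff)
  have pairs: "(\<Sum>i\<in>UNIV. \<Sum>j\<in>UNIV. h (mi_pair i j)) = (\<Sum>p\<in>UNIV. h (?f p))"
    by (simp add: sum.cartesian_product split_def)
  show "(\<Sum>\<alpha> | mi_order \<alpha> = 2. h \<alpha>) \<le> (\<Sum>i\<in>UNIV. \<Sum>j\<in>UNIV. h (mi_pair i j))"
    unfolding pairs range using sum_image_le[of UNIV h ?f] nonneg by (simp add: o_def)
  have "(\<Sum>p\<in>UNIV. h (?f p)) = (\<Sum>\<alpha>\<in>range ?f. \<Sum>p | ?f p = \<alpha>. h (?f p))"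
    using sum.image_gen[of UNIV "\<lambda>p. h (?f p)" ?f] by simp
  also have "\<dots> \<le> (\<Sum>\<alpha>\<in>range ?f. 2 * h \<alpha>)"
  proof (rule sum_mono)
    fix \<alpha> assume "\<alpha> \<in> range ?f"
    then obtain i j where \<alpha>: "\<alpha> = mi_pair i j" by auto
    have "{p. ?f p = \<alpha>} \<subseteq> {(i, j), (j, i)}" by (clarsimp simp: \<alpha> mi_pair_eq_iff)
    then have "card {p. ?f p = \<alpha>} \<le> card {(i, j), (j, i)}" by (intro card_mono) auto
    also have "\<dots> \<le> 2" by (cases "i = j") simp_all
    finally have "real (card {p. ?f p = \<alpha>}) * h \<alpha> \<le> 2 * h \<alpha>"
      by (intro mult_right_mono nonneg) simp
    then show "(\<Sum>p | ?f p = \<alpha>. h (?f p)) \<le> 2 * h \<alpha>" by simp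
  qed
  finally show "(\<Sum>i\<in>UNIV. \<Sum>j\<in>UNIV. h (mi_pair i j)) \<le> 2 * (\<Sum>\<alpha> | mi_order \<alpha> = 2. h \<alpha>)"
    unfolding pairs range by (simp add: sum_distrib_left)
qed

lemma Hk_norm_sq_2_bounds:
  fixes w :: "real^'n::finite \<Rightarrow> real"
  assumes "L2 unit_cube w"
  shows "Hk_norm_sq 2 unit_cube w \<le>
      L2_norm_sq unit_cube w + gradient_norm_sq w + hessian_norm_sq w"
    and "L2_norm_sq unit_cube w + gradient_norm_sq w + hessian_norm_sq w / 2 \<le>
      Hk_norm_sq 2 unit_cube w"
proof -
  let ?S = "\<Sum>\<alpha> | mi_order \<alpha> = 2. L2_norm_sq unit_cube (wD unit_cube \<alpha> w)"
  have "L2_norm_sq unit_cube (wD unit_cube mi_zero w) = L2_norm_sq unit_cube w"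
    by (intro L2_wD weak_deriv_0 L2_cube_loc_int assms)
  then have "Hk_norm_sq 2 unit_cube w = L2_norm_sq unit_cube w + gradient_norm_sq w + ?S"
    by (simp add: Hk_norm_sq_def gradient_norm_sq_def sum_mi_order_le_2)
  moreover have "?S \<le> hessian_norm_sq w" "hessian_norm_sq w \<le> 2 * ?S"
    unfolding hessian_norm_sq_def by (rule sum_mi_pair_bounds; simp)+
  ultimately show "Hk_norm_sq 2 unit_cube w \<le>
      L2_norm_sq unit_cube w + gradient_norm_sq w + hessian_norm_sq w"
    "L2_norm_sq unit_cube w + gradient_norm_sq w + hessian_norm_sq w / 2 \<le>
      Hk_norm_sq 2 unit_cube w"
    by linarith+
qed

lemma admissible_potential_Linf_sq_diff:
  assumes "admissible_potential V"
  shows "Linf unit_cube (\<lambda>x. (V x)\<^sup>2 - wlap unit_cube V x)"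
proof -
  note Linf = admissible_potential_Linf(1,3)[OF assms]
  then obtain C D
    where "AE x in cube_measure. \<bar>V x\<bar> \<le> C" "AE x in cube_measure. \<bar>wlap unit_cube V x\<bar> \<le> D"
    unfolding Linf_def by blast
  then have "AE x in cube_measure. \<bar>(V x)\<^sup>2 - wlap unit_cube V x\<bar> \<le> C\<^sup>2 + D"
  proof eventually_elim
    case (elim x)
    have "(V x)\<^sup>2 \<le> C\<^sup>2" using power_mono[OF elim(1), of 2] by simp
    then show ?case using elim(2) zero_le_power2[of "V x"] by linarith
  qed
  then show ?thesis using Linf by (auto simp: Linf_def)
qed

lemma residual_norm_sq_lower_bound:
  assumes w: "H10 unit_cube w" "Hk 2 unit_cube w" and V: "admissible_potential V" and "0 \<le> c"
    and V_ge: "AE x in cube_measure. c \<le> V x \<and> c \<le> (V x)\<^sup>2 - wlap unit_cube V x"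
  shows "min 1 c * Hk_norm_sq 2 unit_cube w \<le>
    L2_norm_sq unit_cube (\<lambda>x. wlap unit_cube w x - V x * w x)"
proof -
  have L2_w: "L2 unit_cube w" using w(2) by (simp add: Hk_def)
  have L2_grad: "L2 unit_cube (wD unit_cube (mi_unit i) w)" for i
    by (intro Hk_wD[OF w(2)]) (simp add: mi_order_unit)
  define B G H where "B = L2_norm_sq unit_cube w" and "G = gradient_norm_sq w"
    and "H = hessian_norm_sq w"
  have nonneg: "0 \<le> B" "0 \<le> G" "0 \<le> H"
    unfolding B_def G_def H_def gradient_norm_sq_def hessian_norm_sq_def
    by (auto intro!: sum_nonneg)
  have coefficients_ge: "AE x in cube_measure. c \<le> V x"
    "AE x in cube_measure. c \<le> (V x)\<^sup>2 - wlap unit_cube V x"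
    using V_ge by auto
  have "min 1 c * Hk_norm_sq 2 unit_cube w \<le> min 1 c * (B + G + H)"
    using Hk_norm_sq_2_bounds(1)[OF L2_w] \<open>0 \<le> c\<close>
    by (intro mult_left_mono) (auto simp: B_def G_def H_def)
  also have "\<dots> = min 1 c * B + min 1 c * G + min 1 c * H" by (simp add: distrib_left)
  also have "\<dots> \<le> c * B + (2 * c) * G + 1 * H"
    using nonneg \<open>0 \<le> c\<close> by (intro add_mono mult_right_mono) auto
  also have "\<dots> = H + 2 * (c * G) + c * B" by simp
  also have "\<dots> \<le> L2_norm_sq unit_cube (\<lambda>x. wlap unit_cube w x - V x * w x)"
    unfolding energy_identity[OF w V] B_def G_def H_def gradient_norm_sq_def sum_distrib_left
    by (intro add_mono order_refl sum_mono mult_left_mono Linf_weighted_integral_ge L2_w L2_grad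
        coefficients_ge
        admissible_potential_Linf[OF V] admissible_potential_Linf_sq_diff[OF V]) simp
  finally show ?thesis .
qed

lemma residual_norm_sq_upper_bound:
  assumes w: "H10 unit_cube w" "Hk 2 unit_cube w" and V: "admissible_potential V"
    and V_le: "AE x in cube_measure. 0 \<le> V x \<and> V x \<le> C \<and> - wlap unit_cube V x \<le> C"
  shows "L2_norm_sq unit_cube (\<lambda>x. wlap unit_cube w x - V x * w x) \<le>
    2 * (1 + C + C\<^sup>2) * Hk_norm_sq 2 unit_cube w"
proof -
  have L2_w: "L2 unit_cube w" using w(2) by (simp add: Hk_def)
  have L2_grad: "L2 unit_cube (wD unit_cube (mi_unit i) w)" for i
    by (intro Hk_wD[OF w(2)]) (simp add: mi_order_unit)
  define B G H where "B = L2_norm_sq unit_cube w" and "G = gradient_norm_sq w"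
    and "H = hessian_norm_sq w"
  define K where "K = 2 * (1 + C + C\<^sup>2)"
  have nonneg: "0 \<le> B" "0 \<le> G" "0 \<le> H"
    unfolding B_def G_def H_def gradient_norm_sq_def hessian_norm_sq_def
    by (auto intro!: sum_nonneg)
  obtain x where "0 \<le> V x" "V x \<le> C" using AE_cube_ex[OF V_le] by blast
  then have "0 \<le> C" by (rule order_trans)
  have V_le_C: "AE x in cube_measure. V x \<le> C" using V_le by eventually_elim simp
  have V_sq_le: "AE x in cube_measure. (V x)\<^sup>2 - wlap unit_cube V x \<le> C + C\<^sup>2"
    using V_le
  proof eventually_elim
    case (elim x)
    then have "(V x)\<^sup>2 \<le> C\<^sup>2" by (intro power_mono) auto
    then show ?case using elim by linarith
  qed
  have "L2_norm_sq unit_cube (\<lambda>x. wlap unit_cube w x - V x * w x) \<le> H + 2 * (C * G) + (C + C\<^sup>2) * B"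
    unfolding energy_identity[OF w V] B_def G_def H_def gradient_norm_sq_def sum_distrib_left
    by (intro add_mono order_refl sum_mono mult_left_mono Linf_weighted_integral_le L2_w L2_grad
        V_le_C V_sq_le admissible_potential_Linf[OF V] admissible_potential_Linf_sq_diff[OF V]) simp
  also have "\<dots> = 1 * H + (2 * C) * G + (C + C\<^sup>2) * B" by simp
  also have "\<dots> \<le> (K / 2) * H + K * G + K * B"
    using nonneg \<open>0 \<le> C\<close> by (intro add_mono mult_right_mono) (auto simp: K_def)
  also have "\<dots> = K * (B + G + H / 2)" by (simp add: algebra_simps)
  also have "\<dots> \<le> K * Hk_norm_sq 2 unit_cube w"
    using Hk_norm_sq_2_bounds(2)[OF L2_w] \<open>0 \<le> C\<close>
    by (intro mult_left_mono) (auto simp: B_def G_def H_def K_def)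
  finally show ?thesis by (simp add: K_def)
qed

lemma E_PINN_eq_0:
  assumes "AE x in lebesgue_on \<Omega>. - wlap \<Omega> u x + V x * u x = f x"
  shows "E_PINN \<Omega> V f u = 0"
  unfolding E_PINN_def
proof (rule integral_eq_zero_AE)
  show "AE x in lebesgue_on \<Omega>. (wlap \<Omega> u x - V x * u x + f x)\<^sup>2 = 0"
    using assms by eventually_elim simp
qed

lemma wlap_diff_AE:
  assumes "Hk 2 unit_cube u" "Hk 2 unit_cube v"
  shows "AE x in cube_measure. wlap unit_cube (\<lambda>x. u x - v x) x =
    wlap unit_cube u x - wlap unit_cube v x"
proof -
  have "AE x in cube_measure. \<forall>i. wD unit_cube (mi_pair i i) (\<lambda>x. u x - v x) x =
      wD unit_cube (mi_pair i i) u x - wD unit_cube (mi_pair i i) v x"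
    by (intro eventually_all_finite wD_diff_AE[OF assms]) (simp add: mi_order_pair)
  then show ?thesis by eventually_elim (simp add: wlap_eq sum_subtractf)
qed

lemma E_PINN_eq_residual_norm_sq:
  assumes f: "L2 unit_cube f" and V: "Linf unit_cube V" and u: "Hk 2 unit_cube u" "Hk 2 unit_cube v"
    and v: "AE x in cube_measure. - wlap unit_cube v x + V x * v x = f x"
  defines "w \<equiv> \<lambda>x. u x - v x"
  shows "E_PINN unit_cube V f u = L2_norm_sq unit_cube (\<lambda>x. wlap unit_cube w x - V x * w x)"
  unfolding E_PINN_def
proof (rule L2_cong_AE)
  have L2_uv: "L2 unit_cube u" "L2 unit_cube v" using u by (auto simp: Hk_def)
  have "Hk 2 unit_cube w" unfolding w_def by (rule Hk_diff[OF u])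
  then show "L2 unit_cube (\<lambda>x. wlap unit_cube w x - V x * w x)"
    by (intro L2_diff L2_wlap L2_Linf_mult V) (simp_all add: Hk_def)
  show "(\<lambda>x. wlap unit_cube u x - V x * u x + f x) \<in> borel_measurable cube_measure"
    by (intro L2_measurable L2_add L2_diff L2_wlap L2_Linf_mult f V u L2_uv)
  show "AE x in cube_measure. wlap unit_cube u x - V x * u x + f x = wlap unit_cube w x - V x * w x"
    using v wlap_diff_AE[OF u] by eventually_elim (simp add: w_def algebra_simps)
qed

theorem mainTheorem2:
  fixes V f ustar :: "real^'n::finite \<Rightarrow> real"
    and Cmin Vmax :: real
  assumes f_L2: "L2 unit_cube f"
    and V_twice: "\<forall>\<alpha>. mi_order \<alpha> \<le> 2 \<longrightarrow> (\<exists>v. weak_deriv unit_cube \<alpha> V v)"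
    and V_Linf: "Linf unit_cube V"
    and gradV_Linf: "\<forall>\<alpha>. mi_order \<alpha> = 1 \<longrightarrow> Linf unit_cube (wD unit_cube \<alpha> V)"
    and lapV_Linf: "Linf unit_cube (wlap unit_cube V)"
    and Cmin_pos: "0 < Cmin"
    and V_bounds: "AE x in lebesgue_on unit_cube.
        Cmin < V x \<and> V x \<le> Vmax \<and> Cmin < (V x)\<^sup>2 - wlap unit_cube V x
        \<and> - wlap unit_cube V x \<le> Vmax"
    and ustar_H10: "H10 unit_cube ustar"
    and ustar_H2: "Hk 2 unit_cube ustar"
    and ustar_eq: "AE x in lebesgue_on unit_cube.
        - wlap unit_cube ustar x + V x * ustar x = f x"
  shows "\<forall>u. H10 unit_cube u \<and> Hk 2 unit_cube u \<longrightarrow>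
     min 1 Cmin * Hk_norm_sq 2 unit_cube (\<lambda>x. u x - ustar x)
       \<le> E_PINN unit_cube V f u - E_PINN unit_cube V f ustar
     \<and> E_PINN unit_cube V f u - E_PINN unit_cube V f ustar
       \<le> 2 * (1 + Vmax + Vmax\<^sup>2) * Hk_norm_sq 2 unit_cube (\<lambda>x. u x - ustar x)"
proof (intro allI impI, elim conjE)
  fix u :: "real^'n \<Rightarrow> real"
  assume u: "H10 unit_cube u" "Hk 2 unit_cube u"
  let ?w = "\<lambda>x. u x - ustar x"
  have V: "admissible_potential V"
    using V_twice V_Linf gradV_Linf lapV_Linf by (simp add: admissible_potential_def)
  have w: "H10 unit_cube ?w" "Hk 2 unit_cube ?w"
    using H10_diff[OF u(1) ustar_H10] Hk_diff[OF u(2) ustar_H2] by auto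
  have "E_PINN unit_cube V f u - E_PINN unit_cube V f ustar =
      L2_norm_sq unit_cube (\<lambda>x. wlap unit_cube ?w x - V x * ?w x)"
    using E_PINN_eq_0[OF ustar_eq] E_PINN_eq_residual_norm_sq[OF f_L2 V_Linf u(2) ustar_H2 ustar_eq]
    by simp
  moreover have "AE x in cube_measure. Cmin \<le> V x \<and> Cmin \<le> (V x)\<^sup>2 - wlap unit_cube V x"
    "AE x in cube_measure. 0 \<le> V x \<and> V x \<le> Vmax \<and> - wlap unit_cube V x \<le> Vmax"
    using V_bounds by (eventually_elim, use Cmin_pos in simp)+
  ultimately show "min 1 Cmin * Hk_norm_sq 2 unit_cube ?w
       \<le> E_PINN unit_cube V f u - E_PINN unit_cube V f ustar
     \<and> E_PINN unit_cube V f u - E_PINN unit_cube V f ustar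
       \<le> 2 * (1 + Vmax + Vmax\<^sup>2) * Hk_norm_sq 2 unit_cube ?w"
    using residual_norm_sq_lower_bound[OF w V] residual_norm_sq_upper_bound[OF w V] Cmin_pos by simp
qed

end
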